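(* Let $v$ be an object of an indecomposable admissible component of the root groupoid and let $v'\in\mathrm{Sk}(v)$ satisfy $\Delta^+_{re}(v')=\Delta^+_{re}(v)$. Then $v'=v$. In particular, if a homothety can be presented as a composition of reflexions, it is the identity.
   Context: Root groupoid. Fix a finite set $X$. A root datum is a quadruple $v=(\mathfrak h,a,b,p)$ with $\mathfrak h$ a finite-dimensional complex vector space, $a:X\to\mathfrak h$, $b:X\to\mathfrak h^*$ such that the families $(a(x))_{x\in X}$ and $(b(x))_{x\in X}$ are linearly independent, and $p:X\to\mathbb Z_2$; we write $\mathfrak h(v),a_v,b_v,p_v$. Its Cartan matrix is $a_{xy}=\langle a(x),b(y)\rangle$. An element $x\in X$ is reflectable at $v$ if: $a_{xx}=0$ implies $p(x)=1$; if $a_{xx}\ne 0$ and $p(x)=0$ then $2a_{xy}/a_{xx}\in\mathbb Z_{\le 0}$ for all $y\ne x$; if $a_{xx}\neq 0$ and $p(x)=1$ then $a_{xy}/a_{xx}\in\mathbb Z_{\le 0}$ for all $y\ne x$. For $x$ reflectable at $v$ the reflexion $r_x:v\to v'=(\mathfrak h,a',b',p')$ is defined as follows. Anisotropic case $a_{xx}\ne0$: $p'=p$, $a'(y)=a(y)-2\frac{a_{yx}}{a_{xx}}a(x)$, $b'(y)=b(y)-2\frac{a_{xy}}{a_{xx}}b(x)$. Isotropic case $a_{xx}=0$: $(a'(x),b'(x),p'(x))=(-a(x),-b(x),p(x))$; for $y\neq x$ with $a_{xy}=0$, $(a'(y),b'(y),p'(y))=(a(y),b(y),p(y))$; for $y$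 with $a_{xy}\ne0$, $(a'(y),b'(y),p'(y))=(a(y)+\frac{a_{yx}}{a_{xy}}a(x),\,b(y)+b(x),\,1+p(y))$. The root groupoid $\mathcal R$ has the root data as objects; its arrows are generated by reflexions, tautological arrows $t_\theta:(\mathfrak h,a,b,p)\to(\mathfrak h',\theta\circ a,(\theta^* )^{-1}\circ b,p)$ for linear isomorphisms $\theta:\mathfrak h\to\mathfrak h'$, and homotheties $h_\lambda:(\mathfrak h,a,b,p)\to(\mathfrak h,\lambda a,b,p)$ for $\lambda:X\to\mathbb C^*$. Each generator induces a linear isomorphism of the spaces $\mathfrak h$ (the identity for reflexions and homotheties, $\theta$ for $t_\theta$), and two compositions of generators $v\to v'$ are identified iff they induce the same isomorphism $\mathfrak h(v)\to\mathfrak h(v')$. A component is a connected component of $\mathcal R$; it is indecomposable if for $v$ in it there is no partition $X=X_1\sqcup X_2$ into nonempty subsets with $a_{xy}=a_{yx}=0$ for $x\in X_1,y\in X_2$. Admissibility. The half-baked Lie superalgebra $\tilde{\mathfrak g}(v)$ is generated by $\mathfrak h(v)$ (even) and $\tilde e_x,\tilde f_x$ ($x\in X$, of parity $p(x)$) with relations $[\mathfrak h,\mathfrak h]=0$, $[h,\tilde e_x]=\langle b(x),h\rangle\tilde e_x$, $[h,\tilde f_x]=-\langle b(x),h\rangle\tilde f_x$, $[\tilde e_x,\tilde f_y]=0$ for $x\ne y$, $[\tilde e_x,\tilde f_x]=a(x)$. A component $\mathcal R_0$ is admissible if there is a collection of quotients $\mathfrak g(v)=\tilde{\mathfrak g}(v)/I(v)$,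 $v\in\mathcal R_0$, with $I(v)\cap\mathfrak h(v)=0$, such that for each arrow $v\to v'$ in $\mathcal R_0$ the induced isomorphism $\mathfrak h(v)\to\mathfrak h(v')$ extends to an isomorphism $\mathfrak g(v)\to\mathfrak g(v')$. Equivalently: at every $v\in\mathcal R_0$, if $x$ is reflectable at $v$ and $a_{xy}=0$ then $a_{yx}=0$. Skeleton. $\mathrm{Sk}(v)$ is the set of objects obtained from $v$ by chains of reflexions; all have the same $\mathfrak h$. Real roots: $\Delta^{re}=\{b_u(x):u\in\mathrm{Sk}(v),x\in X\}\subset\mathfrak h^*$. For $u\in\mathrm{Sk}(v)$, $\Delta^+_{re}(u)=\Delta^{re}\cap\sum_x\mathbb Z_{\ge0}b_u(x)$. *)

theory Defs
  imports Complex_Main "HOL-Library.Z2" "HOL-Library.Poly_Mapping" "HOL-Library.Nonpos_Ints"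
begin

section \<open>Root data and the root groupoid\<close>

text \<open>
  The finite set \<open>X\<close> is the type \<open>'x::finite\<close>. The space \<open>\<hh>\<close> is the type \<open>'h\<close>, made into a complex
  vector space by an explicit scalar multiplication \<open>scale\<close>; finite-dimensionality is assumed where
  it is needed, through the locale \<^locale>\<open>finite_dimensional_vector_space\<close>. Covectors are
  linear functions \<open>'h \<Rightarrow> complex\<close>, and parities live in the two-element field \<^typ>\<open>bit\<close>.

  Only root data on the one (arbitrary) space \<open>'h\<close> are objects here. This is a full subgroupoid
  meeting every component of dimension \<open>dim 'h\<close>, because tautological arrows commute with
  reflexions and homotheties.
\<close>

record ('x, 'h) root_datum =
  simple_coroot :: "'x \<Rightarrow> 'h"
  simple_root :: "'x \<Rightarrow> 'h \<Rightarrow> complex"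
  parity :: "'x \<Rightarrow> bit"

definition is_root_datum :: "(complex \<Rightarrow> 'h \<Rightarrow> 'h) \<Rightarrow> ('x::finite, 'h::ab_group_add) root_datum \<Rightarrow> bool"
  where "is_root_datum scale v \<longleftrightarrow>
    (\<forall>x. Vector_Spaces.linear scale (*) (simple_root v x)) \<and>
    (\<forall>c. (\<Sum>x\<in>UNIV. scale (c x) (simple_coroot v x)) = 0 \<longrightarrow> (\<forall>x. c x = 0)) \<and>
    (\<forall>c. (\<forall>h. (\<Sum>x\<in>UNIV. c x * simple_root v x h) = 0) \<longrightarrow> (\<forall>x. c x = 0))"

definition cartan :: "('x, 'h) root_datum \<Rightarrow> 'x \<Rightarrow> 'x \<Rightarrow> complex"
  where "cartan v x y = simple_root v y (simple_coroot v x)"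

definition reflectable :: "('x, 'h) root_datum \<Rightarrow> 'x \<Rightarrow> bool"
  where "reflectable v x \<longleftrightarrow>
    (cartan v x x = 0 \<longrightarrow> parity v x = 1) \<and>
    (cartan v x x \<noteq> 0 \<and> parity v x = 0 \<longrightarrow>
      (\<forall>y. y \<noteq> x \<longrightarrow> 2 * cartan v x y / cartan v x x \<in> \<int>\<^sub>\<le>\<^sub>0)) \<and>
    (cartan v x x \<noteq> 0 \<and> parity v x = 1 \<longrightarrow>
      (\<forall>y. y \<noteq> x \<longrightarrow> cartan v x y / cartan v x x \<in> \<int>\<^sub>\<le>\<^sub>0))"

definition reflexion ::
  "(complex \<Rightarrow> 'h \<Rightarrow> 'h) \<Rightarrow> 'x \<Rightarrow> ('x, 'h::ab_group_add) root_datum \<Rightarrow> ('x, 'h) root_datum"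
  where "reflexion scale x v =
    (if cartan v x x \<noteq> 0 then
       \<lparr> simple_coroot = (\<lambda>y. simple_coroot v y - scale (2 * cartan v y x / cartan v x x) (simple_coroot v x)),
         simple_root = (\<lambda>y h. simple_root v y h - 2 * cartan v x y / cartan v x x * simple_root v x h),
         parity = parity v \<rparr>
     else
       \<lparr> simple_coroot = (\<lambda>y. if y = x then - simple_coroot v x
                       else if cartan v x y = 0 then simple_coroot v y
                       else simple_coroot v y + scale (cartan v y x / cartan v x y) (simple_coroot v x)),
         simple_root = (\<lambda>y. if y = x then (\<lambda>h. - simple_root v x h)
                     else if cartan v x y = 0 then simple_root v y
                     else (\<lambda>h. simple_root v y h + simple_root v x h)),
         parity = (\<lambda>y. if y = x then parity v x
                       else if cartan v x y = 0 then parity v y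
                       else 1 + parity v y) \<rparr>)"

definition transport :: "('h \<Rightarrow> 'h) \<Rightarrow> ('x, 'h) root_datum \<Rightarrow> ('x, 'h) root_datum"
  where "transport \<theta> v =
    \<lparr> simple_coroot = (\<lambda>x. \<theta> (simple_coroot v x)), simple_root = (\<lambda>x h. simple_root v x (inv \<theta> h)), parity = parity v \<rparr>"

definition rescale ::
  "(complex \<Rightarrow> 'h \<Rightarrow> 'h) \<Rightarrow> ('x \<Rightarrow> complex) \<Rightarrow> ('x, 'h) root_datum \<Rightarrow> ('x, 'h) root_datum"
  where "rescale scale \<mu> v =
    \<lparr> simple_coroot = (\<lambda>x. scale (\<mu> x) (simple_coroot v x)), simple_root = simple_root v, parity = parity v \<rparr>"

text \<open>
  Since compositions of generators are identified as soon as they induce the same isomorphism, an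
  arrow is a triple of its source, the induced isomorphism and its target.
\<close>

type_synonym ('x, 'h) arrow = "('x, 'h) root_datum \<times> ('h \<Rightarrow> 'h) \<times> ('x, 'h) root_datum"

definition identity_arrow :: "('x, 'h) root_datum \<Rightarrow> ('x, 'h) arrow"
  where "identity_arrow v = (v, id, v)"

definition reflexion_arrow ::
  "(complex \<Rightarrow> 'h \<Rightarrow> 'h) \<Rightarrow> 'x \<Rightarrow> ('x, 'h::ab_group_add) root_datum \<Rightarrow> ('x, 'h) arrow"
  where "reflexion_arrow scale x v = (v, id, reflexion scale x v)"

definition tautological_arrow :: "('h \<Rightarrow> 'h) \<Rightarrow> ('x, 'h) root_datum \<Rightarrow> ('x, 'h) arrow"
  where "tautological_arrow \<theta> v = (v, \<theta>, transport \<theta> v)"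

definition homothety_arrow ::
  "(complex \<Rightarrow> 'h \<Rightarrow> 'h) \<Rightarrow> ('x \<Rightarrow> complex) \<Rightarrow> ('x, 'h) root_datum \<Rightarrow> ('x, 'h) arrow"
  where "homothety_arrow scale \<mu> v = (v, id, rescale scale \<mu> v)"

definition reflexion_arrows ::
  "(complex \<Rightarrow> 'h \<Rightarrow> 'h) \<Rightarrow> ('x::finite, 'h::ab_group_add) arrow set"
  where "reflexion_arrows scale =
    {reflexion_arrow scale x v | x v. is_root_datum scale v \<and> reflectable v x}"

definition tautological_arrows ::
  "(complex \<Rightarrow> 'h \<Rightarrow> 'h) \<Rightarrow> ('x::finite, 'h::ab_group_add) arrow set"
  where "tautological_arrows scale =
    {tautological_arrow \<theta> v | \<theta> v.
       is_root_datum scale v \<and> Vector_Spaces.linear scale scale \<theta> \<and> bij \<theta>}"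

definition homothety_arrows ::
  "(complex \<Rightarrow> 'h \<Rightarrow> 'h) \<Rightarrow> ('x::finite, 'h::ab_group_add) arrow set"
  where "homothety_arrows scale =
    {homothety_arrow scale \<mu> v | \<mu> v. is_root_datum scale v \<and> (\<forall>x. \<mu> x \<noteq> 0)}"

text \<open>
  The set of generators is closed under inverses (the inverse of the reflexion \<open>r\<^sub>x : v \<rightarrow> v'\<close> is
  the reflexion \<open>r\<^sub>x\<close> at \<open>v'\<close>), so the composites of generators already form a groupoid.
\<close>

inductive_set composites ::
  "(complex \<Rightarrow> 'h \<Rightarrow> 'h) \<Rightarrow> ('x::finite, 'h::ab_group_add) arrow set \<Rightarrow> ('x, 'h) arrow set"
  for scale :: "complex \<Rightarrow> 'h \<Rightarrow> 'h" and G :: "('x::finite, 'h::ab_group_add) arrow set"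
  where
    identity: "is_root_datum scale v \<Longrightarrow> identity_arrow v \<in> composites scale G"
  | compose: "(v, \<phi>, u) \<in> composites scale G \<Longrightarrow> (u, \<psi>, w) \<in> G \<Longrightarrow>
      (v, \<psi> \<circ> \<phi>, w) \<in> composites scale G"

definition groupoid_arrows ::
  "(complex \<Rightarrow> 'h \<Rightarrow> 'h) \<Rightarrow> ('x::finite, 'h::ab_group_add) arrow set"
  where "groupoid_arrows scale =
    composites scale (reflexion_arrows scale \<union> tautological_arrows scale \<union> homothety_arrows scale)"

definition is_component ::
  "(complex \<Rightarrow> 'h \<Rightarrow> 'h) \<Rightarrow> ('x::finite, 'h::ab_group_add) root_datum set \<Rightarrow> bool"
  where "is_component scale R \<longleftrightarrow>
    (\<exists>v. is_root_datum scale v \<and> R = {u. \<exists>\<phi>. (v, \<phi>, u) \<in> groupoid_arrows scale})"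

definition indecomposable :: "('x, 'h) root_datum set \<Rightarrow> bool"
  where "indecomposable R \<longleftrightarrow>
    (\<forall>v\<in>R. \<nexists>X1 X2. X1 \<noteq> {} \<and> X2 \<noteq> {} \<and> X1 \<inter> X2 = {} \<and> X1 \<union> X2 = UNIV \<and>
      (\<forall>x\<in>X1. \<forall>y\<in>X2. cartan v x y = 0 \<and> cartan v y x = 0))"

definition skeleton ::
  "(complex \<Rightarrow> 'h \<Rightarrow> 'h) \<Rightarrow> ('x::finite, 'h::ab_group_add) root_datum \<Rightarrow> ('x, 'h) root_datum set"
  where "skeleton scale v = {u. \<exists>\<phi>. (v, \<phi>, u) \<in> composites scale (reflexion_arrows scale)}"

definition real_roots ::
  "(complex \<Rightarrow> 'h \<Rightarrow> 'h) \<Rightarrow> ('x::finite, 'h::ab_group_add) root_datum \<Rightarrow> ('h \<Rightarrow> complex) set"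
  where "real_roots scale v = {simple_root u x | u x. u \<in> skeleton scale v}"

text \<open>
  \<open>positive_real_roots scale v u\<close> is the set \<open>\<Delta>\<^sup>+(u)\<close> of positive real roots at \<open>u\<close>, for \<open>u\<close> in
  the skeleton of \<open>v\<close>.
\<close>

definition positive_real_roots ::
  "(complex \<Rightarrow> 'h \<Rightarrow> 'h) \<Rightarrow> ('x::finite, 'h::ab_group_add) root_datum \<Rightarrow> ('x, 'h) root_datum \<Rightarrow>
   ('h \<Rightarrow> complex) set"
  where "positive_real_roots scale v u =
    real_roots scale v \<inter> {(\<lambda>h. \<Sum>x\<in>UNIV. of_nat (n x) * simple_root u x h) | n :: 'x \<Rightarrow> nat. True}"


section \<open>Superalgebras, ideals and quotients\<close>

text \<open>Superalgebras are not assumed associative; \<open>part\<close> gives the homogeneous components.\<close>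

record 'g superalgebra =
  space :: "'g set"
  add :: "'g \<Rightarrow> 'g \<Rightarrow> 'g"
  zero :: 'g
  scl :: "complex \<Rightarrow> 'g \<Rightarrow> 'g"
  bracket :: "'g \<Rightarrow> 'g \<Rightarrow> 'g"
  part :: "bit \<Rightarrow> 'g set"

definition graded_ideal :: "'g superalgebra \<Rightarrow> 'g set \<Rightarrow> bool"
  where "graded_ideal L I \<longleftrightarrow>
    I \<subseteq> space L \<and> zero L \<in> I \<and>
    (\<forall>u\<in>I. \<forall>w\<in>I. add L u w \<in> I) \<and>
    (\<forall>c. \<forall>u\<in>I. scl L c u \<in> I) \<and>
    (\<forall>u\<in>I. \<forall>w\<in>space L. bracket L u w \<in> I \<and> bracket L w u \<in> I) \<and>
    (\<forall>u\<in>I. \<exists>u0\<in>I \<inter> part L 0. \<exists>u1\<in>I \<inter> part L 1. u = add L u0 u1)"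

definition ideal_generated :: "'g superalgebra \<Rightarrow> 'g set \<Rightarrow> 'g set"
  where "ideal_generated L S = \<Inter>{I. graded_ideal L I \<and> S \<subseteq> I}"

definition coset :: "'g superalgebra \<Rightarrow> 'g set \<Rightarrow> 'g \<Rightarrow> 'g set"
  where "coset L I u = add L u ` I"

text \<open>
  As in \<open>HOL-Algebra\<close>, the operations on cosets are unions over all representatives; for an ideal
  the members of these unions coincide.
\<close>

definition quotient :: "'g superalgebra \<Rightarrow> 'g set \<Rightarrow> 'g set superalgebra"
  where "quotient L I =
    \<lparr> space = coset L I ` space L,
      add = (\<lambda>P Q. \<Union>u\<in>P. \<Union>w\<in>Q. coset L I (add L u w)),
      zero = I,
      scl = (\<lambda>c P. \<Union>u\<in>P. coset L I (scl L c u)),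
      bracket = (\<lambda>P Q. \<Union>u\<in>P. \<Union>w\<in>Q. coset L I (bracket L u w)),
      part = (\<lambda>i. coset L I ` part L i) \<rparr>"

definition superalgebra_iso :: "'g superalgebra \<Rightarrow> 'k superalgebra \<Rightarrow> ('g \<Rightarrow> 'k) \<Rightarrow> bool"
  where "superalgebra_iso L M \<Phi> \<longleftrightarrow>
    bij_betw \<Phi> (space L) (space M) \<and>
    (\<forall>u\<in>space L. \<forall>w\<in>space L. \<Phi> (add L u w) = add M (\<Phi> u) (\<Phi> w)) \<and>
    (\<forall>c. \<forall>u\<in>space L. \<Phi> (scl L c u) = scl M c (\<Phi> u)) \<and>
    (\<forall>u\<in>space L. \<forall>w\<in>space L. \<Phi> (bracket L u w) = bracket M (\<Phi> u) (\<Phi> w)) \<and>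
    (\<forall>i. \<Phi> ` part L i = part M i)"


section \<open>Lie superalgebras by generators and relations\<close>

text \<open>
  The free nonassociative superalgebra has as basis the bracketed words (the free magma) in the
  generators. The free Lie superalgebra is its quotient by super-antisymmetry and the super Jacobi
  identity.
\<close>

datatype 'g magma = Gen 'g | Br "'g magma" "'g magma"

type_synonym 'g free = "'g magma \<Rightarrow>\<^sub>0 complex"

primrec magma_parity :: "('g \<Rightarrow> bit) \<Rightarrow> 'g magma \<Rightarrow> bit"
  where
    "magma_parity \<pi> (Gen g) = \<pi> g"
  | "magma_parity \<pi> (Br s t) = magma_parity \<pi> s + magma_parity \<pi> t"

definition free_gen :: "'g \<Rightarrow> 'g free"
  where "free_gen g = Poly_Mapping.single (Gen g) 1"

definition free_scale :: "complex \<Rightarrow> 'g free \<Rightarrow> 'g free"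
  where "free_scale c u = Poly_Mapping.map ((*) c) u"

definition free_bracket :: "'g free \<Rightarrow> 'g free \<Rightarrow> 'g free"
  where "free_bracket u w =
    (\<Sum>s\<in>Poly_Mapping.keys u. \<Sum>t\<in>Poly_Mapping.keys w.
      Poly_Mapping.single (Br s t) (Poly_Mapping.lookup u s * Poly_Mapping.lookup w t))"

definition free_part :: "('g \<Rightarrow> bit) \<Rightarrow> bit \<Rightarrow> 'g free set"
  where "free_part \<pi> i = {u. \<forall>m\<in>Poly_Mapping.keys u. magma_parity \<pi> m = i}"

definition free_superalgebra :: "('g \<Rightarrow> bit) \<Rightarrow> 'g free superalgebra"
  where "free_superalgebra \<pi> =
    \<lparr> space = UNIV, add = (+), zero = 0, scl = free_scale, bracket = free_bracket,
      part = free_part \<pi> \<rparr>"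

definition koszul_sign :: "bit \<Rightarrow> bit \<Rightarrow> complex"
  where "koszul_sign i j = (if i = 1 \<and> j = 1 then - 1 else 1)"

definition lie_relations :: "('g \<Rightarrow> bit) \<Rightarrow> 'g free set"
  where "lie_relations \<pi> =
    {free_bracket u w + free_scale (koszul_sign i j) (free_bracket w u) | u w i j.
       u \<in> free_part \<pi> i \<and> w \<in> free_part \<pi> j} \<union>
    {free_bracket u (free_bracket w z) - free_bracket (free_bracket u w) z
       - free_scale (koszul_sign i j) (free_bracket w (free_bracket u z)) | u w z i j.
       u \<in> free_part \<pi> i \<and> w \<in> free_part \<pi> j}"

definition presented_lie_superalgebra ::
  "('g \<Rightarrow> bit) \<Rightarrow> 'g free set \<Rightarrow> 'g free set superalgebra"
  where "presented_lie_superalgebra \<pi> R =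
    quotient (free_superalgebra \<pi>) (ideal_generated (free_superalgebra \<pi>) (lie_relations \<pi> \<union> R))"

definition presented_gen :: "('g \<Rightarrow> bit) \<Rightarrow> 'g free set \<Rightarrow> 'g \<Rightarrow> 'g free set"
  where "presented_gen \<pi> R g =
    coset (free_superalgebra \<pi>) (ideal_generated (free_superalgebra \<pi>) (lie_relations \<pi> \<union> R))
      (free_gen g)"


section \<open>The half-baked Lie superalgebra and admissibility\<close>

datatype ('x, 'h) hb_gen = H 'h | E 'x | F 'x

primrec hb_parity :: "('x, 'h) root_datum \<Rightarrow> ('x, 'h) hb_gen \<Rightarrow> bit"
  where
    "hb_parity v (H h) = 0"
  | "hb_parity v (E x) = parity v x"
  | "hb_parity v (F x) = parity v x"

text \<open>
  The first two sets make \<open>H\<close> linear, so that the space \<open>\<hh>\<close>, and not merely its underlying set,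
  is among the generators.
\<close>

definition hb_relations ::
  "(complex \<Rightarrow> 'h \<Rightarrow> 'h) \<Rightarrow> ('x, 'h::ab_group_add) root_datum \<Rightarrow> ('x, 'h) hb_gen free set"
  where "hb_relations scale v =
    {free_gen (H (h + k)) - free_gen (H h) - free_gen (H k) | h k. True} \<union>
    {free_gen (H (scale c h)) - free_scale c (free_gen (H h)) | c h. True} \<union>
    {free_bracket (free_gen (H h)) (free_gen (H k)) | h k. True} \<union>
    {free_bracket (free_gen (H h)) (free_gen (E x)) - free_scale (simple_root v x h) (free_gen (E x))
       | h x. True} \<union>
    {free_bracket (free_gen (H h)) (free_gen (F x)) + free_scale (simple_root v x h) (free_gen (F x))
       | h x. True} \<union>
    {free_bracket (free_gen (E x)) (free_gen (F y)) | x y. x \<noteq> y} \<union>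
    {free_bracket (free_gen (E x)) (free_gen (F x)) - free_gen (H (simple_coroot v x)) | x. True}"

definition half_baked ::
  "(complex \<Rightarrow> 'h \<Rightarrow> 'h) \<Rightarrow> ('x, 'h::ab_group_add) root_datum \<Rightarrow>
   ('x, 'h) hb_gen free set superalgebra"
  where "half_baked scale v = presented_lie_superalgebra (hb_parity v) (hb_relations scale v)"

definition half_baked_h ::
  "(complex \<Rightarrow> 'h \<Rightarrow> 'h) \<Rightarrow> ('x, 'h::ab_group_add) root_datum \<Rightarrow> 'h \<Rightarrow> ('x, 'h) hb_gen free set"
  where "half_baked_h scale v h = presented_gen (hb_parity v) (hb_relations scale v) (H h)"

text \<open>
  \<open>I v \<inter> \<hh>(v) = 0\<close> is read inside the vector space \<open>\<hh>(v)\<close>: only \<open>h = 0\<close> is sent into \<open>I v\<close> by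
  the canonical map \<open>\<hh>(v) \<rightarrow> half_baked scale v\<close>.
\<close>

definition admissible ::
  "(complex \<Rightarrow> 'h \<Rightarrow> 'h) \<Rightarrow> ('x::finite, 'h::ab_group_add) root_datum set \<Rightarrow> bool"
  where "admissible scale R \<longleftrightarrow>
    (\<exists>I. (\<forall>v\<in>R. graded_ideal (half_baked scale v) (I v) \<and> {h. half_baked_h scale v h \<in> I v} = {0}) \<and>
      (\<forall>v\<in>R. \<forall>\<phi> v'. (v, \<phi>, v') \<in> groupoid_arrows scale \<longrightarrow>
        (\<exists>\<Phi>. superalgebra_iso (quotient (half_baked scale v) (I v))
                (quotient (half_baked scale v') (I v')) \<Phi> \<and>
          (\<forall>h. \<Phi> (coset (half_baked scale v) (I v) (half_baked_h scale v h)) =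
             coset (half_baked scale v') (I v') (half_baked_h scale v' (\<phi> h))))))"

end

theory Submission
  imports Defs
begin

text \<open>
  Let \<open>u\<close> run over the skeleton of \<open>v\<close>. In a quotient of the half-baked superalgebra that meets
  \<open>\<hh>\<close> trivially, all weights are nonnegative or nonpositive combinations of the simple roots, and
  the weight spaces of \<open>\<plusminus>b(x)\<close> are spanned by \<open>e\<^sub>x\<close> and \<open>f\<^sub>x\<close>. So admissibility makes every real root
  positive or negative at every \<open>u\<close>, and makes the parity of a real root, and its coroot up to a
  factor, independent of \<open>u\<close>.

  Call a real root an inversion of \<open>u\<close> if it is positive at \<open>u\<close> and negative at \<open>v\<close>. A reflexion
  \<open>r\<^sub>x\<close> adds or removes one inversion. A simple root of \<open>u\<close> that is an inversion was reflected on the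
  way from \<open>v\<close> to \<open>u\<close>; hence it is reflectable, and one can descend from any \<open>u\<close> to an object
  without inversions. Two descents \<open>r\<^sub>x\<close> and \<open>r\<^sub>y\<close> from \<open>u\<close> are confluent: the alternating paths
  \<open>xyx\<dots>\<close> and \<open>yxy\<dots>\<close> both end where the roots of \<open>x\<close> and \<open>y\<close> are the negatives of those at \<open>u\<close>,
  their lengths agree, the last roots reflected show that no permutation intervenes, and a
  symmetrizer of the rank two Cartan matrix shows that the coroots agree. As in Newman's lemma, the
  object without inversions is unique, and it is \<open>v\<close>.
\<close>

section \<open>Ideals and quotients of the free superalgebra\<close>

text \<open>Equality of the positive real roots only says that \<open>v\<close> and
  \<open>v'\<close> have the same set of simple roots, with proportional coroots. A relabelling of
  \<open>X\<close> and a rescaling of the coroots remain to be excluded. Neither can be read off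
  from the two end points, so paths of reflexions have to be compared. The length function of a
  Coxeter group is not at hand for this: an isotropic reflexion need not come from a symmetry of the
  real roots, and a simple root need not be reflectable. The inversion set takes its place; it is
  finite along the skeleton even when there are infinitely many real roots. Admissibility is used
  for one kind of arrow only, composites of reflexions. They induce the identity of the Cartan
  space, so the isomorphisms of superalgebras preserve weights, and elements of different quotients
  can be compared weight by weight.\<close>

lemma lookup_free_scale [simp]: "Poly_Mapping.lookup (free_scale c u) m = c * Poly_Mapping.lookup u m"
  unfolding free_scale_def by (simp add: Poly_Mapping.map.rep_eq when_def)

global_interpretation free: vector_space free_scale
  by unfold_locales (auto intro!: poly_mapping_eqI simp: lookup_add algebra_simps)

section \<open>Bilinearity of the free bracket\<close>

lemma free_bracket_superset:
  assumes "finite A" "Poly_Mapping.keys u \<subseteq> A" "finite B" "Poly_Mapping.keys w \<subseteq> B"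
  shows "free_bracket u w = (\<Sum>s\<in>A. \<Sum>t\<in>B.
    Poly_Mapping.single (Br s t) (Poly_Mapping.lookup u s * Poly_Mapping.lookup w t))"
proof -
  have "free_bracket u w = (\<Sum>s\<in>Poly_Mapping.keys u. \<Sum>t\<in>B.
    Poly_Mapping.single (Br s t) (Poly_Mapping.lookup u s * Poly_Mapping.lookup w t))"
    unfolding free_bracket_def using assms(3,4)
    by (intro sum.cong refl sum.mono_neutral_left) (auto simp: in_keys_iff)
  also have "\<dots> = (\<Sum>s\<in>A. \<Sum>t\<in>B.
    Poly_Mapping.single (Br s t) (Poly_Mapping.lookup u s * Poly_Mapping.lookup w t))"
    using assms(1,2) by (intro sum.mono_neutral_left) (auto simp: in_keys_iff)
  finally show ?thesis .
qed

lemma free_scale_single [simp]: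
  "free_scale c (Poly_Mapping.single m d) = Poly_Mapping.single m (c * d)"
  unfolding free_scale_def by simp

lemma free_bracket_add_left:
  "free_bracket (u + u') w = free_bracket u w + free_bracket u' w"
proof -
  let ?A = "Poly_Mapping.keys u \<union> Poly_Mapping.keys u'"
  have "free_bracket x w = (\<Sum>s\<in>?A. \<Sum>t\<in>Poly_Mapping.keys w.
    Poly_Mapping.single (Br s t) (Poly_Mapping.lookup x s * Poly_Mapping.lookup w t))"
    if "Poly_Mapping.keys x \<subseteq> ?A" for x
    using that by (intro free_bracket_superset) auto
  from this[of u] this[of u'] this[of "u + u'"] show ?thesis
    using Poly_Mapping.keys_add[of u u']
    by (auto simp: lookup_add distrib_right single_add sum.distrib)
qed

lemma free_bracket_add_right:
  "free_bracket u (w + w') = free_bracket u w + free_bracket u w'"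
proof -
  let ?A = "Poly_Mapping.keys w \<union> Poly_Mapping.keys w'"
  have "free_bracket u x = (\<Sum>s\<in>Poly_Mapping.keys u. \<Sum>t\<in>?A.
    Poly_Mapping.single (Br s t) (Poly_Mapping.lookup u s * Poly_Mapping.lookup x t))"
    if "Poly_Mapping.keys x \<subseteq> ?A" for x
    using that by (intro free_bracket_superset) auto
  from this[of w] this[of w'] this[of "w + w'"] show ?thesis
    using Poly_Mapping.keys_add[of w w']
    by (auto simp: lookup_add distrib_left single_add sum.distrib)
qed

lemma free_bracket_scale_left: "free_bracket (free_scale c u) w = free_scale c (free_bracket u w)"
proof -
  have "free_bracket (free_scale c u) w = (\<Sum>s\<in>Poly_Mapping.keys u. \<Sum>t\<in>Poly_Mapping.keys w.
    Poly_Mapping.single (Br s t) (Poly_Mapping.lookup (free_scale c u) s * Poly_Mapping.lookup w t))"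
    by (intro free_bracket_superset) (auto simp: in_keys_iff)
  then show ?thesis
    by (simp add: free_bracket_def free.scale_sum_right mult.assoc)
qed

lemma free_bracket_scale_right: "free_bracket u (free_scale c w) = free_scale c (free_bracket u w)"
proof -
  have "free_bracket u (free_scale c w) = (\<Sum>s\<in>Poly_Mapping.keys u. \<Sum>t\<in>Poly_Mapping.keys w.
    Poly_Mapping.single (Br s t) (Poly_Mapping.lookup u s * Poly_Mapping.lookup (free_scale c w) t))"
    by (intro free_bracket_superset) (auto simp: in_keys_iff)
  then show ?thesis
    by (simp add: free_bracket_def free.scale_sum_right mult_ac)
qed

lemma free_bracket_zero [simp]: "free_bracket 0 w = 0" "free_bracket u 0 = 0"
  by (simp_all add: free_bracket_def)

lemma free_bracket_minus:
  "free_bracket (- u) w = - free_bracket u w" "free_bracket u (- w) = - free_bracket u w"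
  using free_bracket_scale_left[of "-1" u w] free_bracket_scale_right[of u "-1" w] by simp_all

lemma free_bracket_diff:
  "free_bracket (u - u') w = free_bracket u w - free_bracket u' w"
  "free_bracket u (w - w') = free_bracket u w - free_bracket u w'"
  using free_bracket_add_left[of u "- u'" w] free_bracket_add_right[of u w "- w'"]
  by (simp_all add: free_bracket_minus)

lemmas free_bracket_linear = free_bracket_add_left free_bracket_add_right free_bracket_diff
  free_bracket_minus free_bracket_scale_left free_bracket_scale_right

lemma free_bracket_single:
  "free_bracket (Poly_Mapping.single s 1) (Poly_Mapping.single t 1) = Poly_Mapping.single (Br s t) 1"
  by (simp add: free_bracket_def)

lemma sum_monomials: "u = (\<Sum>m\<in>Poly_Mapping.keys u. Poly_Mapping.single m (Poly_Mapping.lookup u m))"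
  by (intro poly_mapping_eqI)
    (auto simp: lookup_sum lookup_single when_def in_keys_iff)

lemma free_in_subspace:
  assumes "free.subspace T" "\<And>m. m \<in> Poly_Mapping.keys u \<Longrightarrow> Poly_Mapping.single m 1 \<in> T"
  shows "u \<in> T"
proof -
  have "(\<Sum>m\<in>Poly_Mapping.keys u. free_scale (Poly_Mapping.lookup u m) (Poly_Mapping.single m 1)) \<in> T"
    using assms by (intro free.subspace_sum free.subspace_scale) auto
  then show ?thesis using sum_monomials[of u] by simp
qed

section \<open>The grading of the free superalgebra and its graded ideals\<close>

lemma subspace_free_part: "free.subspace (free_part \<pi> i)"
  unfolding free.subspace_def free_part_def
  using Poly_Mapping.keys_add by (fastforce simp: in_keys_iff)

lemma free_part_disjoint: "u \<in> free_part \<pi> 0 \<Longrightarrow> u \<in> free_part \<pi> 1 \<Longrightarrow> u = 0"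
  by (rule poly_mapping_eqI) (force simp: free_part_def in_keys_iff)

lemma free_part_decompose: "\<exists>u0\<in>free_part \<pi> 0. \<exists>u1\<in>free_part \<pi> 1. u = u0 + u1"
proof -
  have "free.subspace {u0 + u1 | u0 u1. u0 \<in> free_part \<pi> 0 \<and> u1 \<in> free_part \<pi> 1}"
    using free.subspace_sums[OF subspace_free_part[of \<pi> 0] subspace_free_part[of \<pi> 1]] .
  moreover have "Poly_Mapping.single m 1 \<in> {u0 + u1 | u0 u1. u0 \<in> free_part \<pi> 0 \<and> u1 \<in> free_part \<pi> 1}" for m
  proof -
    let ?m = "Poly_Mapping.single m (1::complex)"
    have "?m \<in> free_part \<pi> (magma_parity \<pi> m)"
      by (simp add: free_part_def)
    then consider "?m \<in> free_part \<pi> 0" | "?m \<in> free_part \<pi> 1"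
      by (cases "magma_parity \<pi> m") simp_all
    moreover have zero: "0 \<in> free_part \<pi> i" for i
      by (rule free.subspace_0[OF subspace_free_part])
    ultimately show ?thesis
    proof cases
      case 1
      then show ?thesis using zero[of 1] by (intro CollectI exI[of _ ?m] exI[of _ 0]) simp
    next
      case 2
      then show ?thesis using zero[of 0] by (intro CollectI exI[of _ 0] exI[of _ ?m]) simp
    qed
  qed
  ultimately show ?thesis using free_in_subspace[of _ u] by blast
qed

lemma free_part_unique:
  assumes "u0 \<in> free_part \<pi> 0" "u1 \<in> free_part \<pi> 1" "w0 \<in> free_part \<pi> 0" "w1 \<in> free_part \<pi> 1"
    and "u0 + u1 = w0 + w1"
  shows "u0 = w0" "u1 = w1"
proof -
  have "u0 - w0 = w1 - u1" using assms(5) by (simp add: algebra_simps)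
  moreover have "u0 - w0 \<in> free_part \<pi> 0" "w1 - u1 \<in> free_part \<pi> 1"
    using assms subspace_free_part free.subspace_diff by blast+
  ultimately have "u0 - w0 = 0" using free_part_disjoint by metis
  then show "u0 = w0" "u1 = w1" using assms(5) by auto
qed

abbreviation free_graded_ideal :: "('g \<Rightarrow> bit) \<Rightarrow> 'g free set \<Rightarrow> bool"
  where "free_graded_ideal \<pi> K \<equiv> graded_ideal (free_superalgebra \<pi>) K"

lemma free_graded_ideal_iff:
  "free_graded_ideal \<pi> K \<longleftrightarrow> free.subspace K \<and>
    (\<forall>u\<in>K. \<forall>w. free_bracket u w \<in> K \<and> free_bracket w u \<in> K) \<and>
    (\<forall>u\<in>K. \<exists>u0\<in>K \<inter> free_part \<pi> 0. \<exists>u1\<in>K \<inter> free_part \<pi> 1. u = u0 + u1)"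
  unfolding graded_ideal_def free.subspace_def free_superalgebra_def by auto

text \<open>Homogeneous components in the free superalgebra are unique, so the components of
  \<open>u\<close> found inside the various ideals agree and lie in the intersection.\<close>

lemma free_graded_ideal_generated: "free_graded_ideal \<pi> (ideal_generated (free_superalgebra \<pi>) S)"
proof -
  let ?F = "{I. free_graded_ideal \<pi> I \<and> S \<subseteq> I}"
  have "free.subspace (\<Inter>?F)"
    by (intro free.subspace_Inter) (auto simp: free_graded_ideal_iff)
  moreover have "free_bracket u w \<in> \<Inter>?F" "free_bracket w u \<in> \<Inter>?F" if "u \<in> \<Inter>?F" for u w
    using that unfolding free_graded_ideal_iff by blast+
  moreover have "\<exists>u0\<in>\<Inter>?F \<inter> free_part \<pi> 0. \<exists>u1\<in>\<Inter>?F \<inter> free_part \<pi> 1. u = u0 + u1"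
    if u: "u \<in> \<Inter>?F" for u
  proof -
    obtain u0 u1 where d: "u0 \<in> free_part \<pi> 0" "u1 \<in> free_part \<pi> 1" "u = u0 + u1"
      using free_part_decompose by blast
    have "u0 \<in> I \<and> u1 \<in> I" if I: "I \<in> ?F" for I
    proof -
      have "u \<in> I" using u I by blast
      moreover have "free_graded_ideal \<pi> I" using I by simp
      ultimately obtain w0 w1 where "w0 \<in> I \<inter> free_part \<pi> 0" "w1 \<in> I \<inter> free_part \<pi> 1" "u = w0 + w1"
        unfolding free_graded_ideal_iff by meson
      then show ?thesis using free_part_unique[of u0 \<pi> u1 w0 w1] d(1,2) unfolding d(3) by simp
    qed
    then have "u0 \<in> \<Inter>?F" "u1 \<in> \<Inter>?F" by auto
    then show ?thesis using d by blast
  qed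
  ultimately have "free_graded_ideal \<pi> (\<Inter>?F)" by (subst free_graded_ideal_iff) simp
  then show ?thesis unfolding ideal_generated_def .
qed

lemma ideal_generated_superset: "S \<subseteq> ideal_generated L S"
  by (auto simp: ideal_generated_def)

text \<open>Iterated quotients are handled through the surjection \<open>\<rho>\<close> from the free superalgebra.\<close>

locale free_image =
  fixes \<pi> :: "'g \<Rightarrow> bit" and L :: "'k superalgebra" and \<rho> :: "'g free \<Rightarrow> 'k"
  assumes space_image: "space L = range \<rho>"
    and zero_image: "zero L = \<rho> 0"
    and add_image: "add L (\<rho> u) (\<rho> w) = \<rho> (u + w)"
    and scl_image: "scl L c (\<rho> u) = \<rho> (free_scale c u)"
    and bracket_image: "bracket L (\<rho> u) (\<rho> w) = \<rho> (free_bracket u w)"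
    and part_image: "part L i = \<rho> ` free_part \<pi> i"
begin

definition kernel :: "'g free set" where "kernel = {u. \<rho> u = \<rho> 0}"

lemma image_eq_iff: "\<rho> u = \<rho> w \<longleftrightarrow> u - w \<in> kernel"
proof -
  have "\<rho> x = \<rho> y \<Longrightarrow> \<rho> (x + z) = \<rho> (y + z)" for x y z by (metis add_image)
  from this[of u w "- w"] this[of "u - w" 0 w] show ?thesis by (auto simp: kernel_def)
qed

text \<open>The components of \<open>\<rho> u\<close> inside \<open>I\<close> lift to homogeneous
  \<open>w0\<close> and \<open>w1\<close> whose sum equals \<open>u\<close> only modulo
  \<open>kernel\<close>; the defect is then split by the grading of \<open>kernel\<close>.\<close>

lemma kernel_preimage:
  assumes "graded_ideal L I" "free_graded_ideal \<pi> kernel"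
  shows "free_graded_ideal \<pi> (\<rho> -` I)"
proof -
  let ?K = "\<rho> -` I"
  have I: "\<rho> 0 \<in> I" "\<And>u w. \<rho> u \<in> I \<Longrightarrow> \<rho> w \<in> I \<Longrightarrow> \<rho> (u + w) \<in> I"
    "\<And>c u. \<rho> u \<in> I \<Longrightarrow> \<rho> (free_scale c u) \<in> I"
    "\<And>u w. \<rho> u \<in> I \<Longrightarrow> \<rho> (free_bracket u w) \<in> I \<and> \<rho> (free_bracket w u) \<in> I"
    using assms(1) unfolding graded_ideal_def
    by (simp_all add: space_image zero_image flip: add_image scl_image bracket_image)
  have sub: "free.subspace ?K" using I by (auto simp: free.subspace_def)
  have ker: "kernel \<subseteq> ?K" using I(1) by (auto simp: kernel_def)
  have "\<exists>u0\<in>?K \<inter> free_part \<pi> 0. \<exists>u1\<in>?K \<inter> free_part \<pi> 1. u = u0 + u1" if "u \<in> ?K" for u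
  proof -
    from that assms(1) obtain p0 p1 where p: "p0 \<in> I \<inter> part L 0" "p1 \<in> I \<inter> part L 1" "\<rho> u = add L p0 p1"
      unfolding graded_ideal_def by auto
    then obtain w0 w1 where w: "p0 = \<rho> w0" "w0 \<in> free_part \<pi> 0" "p1 = \<rho> w1" "w1 \<in> free_part \<pi> 1"
      by (auto simp: part_image)
    have "u - (w0 + w1) \<in> kernel" using p(3) w by (simp add: add_image flip: image_eq_iff)
    then obtain k0 k1 where k: "k0 \<in> kernel \<inter> free_part \<pi> 0" "k1 \<in> kernel \<inter> free_part \<pi> 1"
      "u - (w0 + w1) = k0 + k1"
      using assms(2) by (auto simp: free_graded_ideal_iff)
    have "u = (w0 + k0) + (w1 + k1)" using k(3) by (simp add: algebra_simps)
    moreover have "w0 + k0 \<in> ?K \<inter> free_part \<pi> 0" "w1 + k1 \<in> ?K \<inter> free_part \<pi> 1"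
      using p w k ker sub subspace_free_part[of \<pi>] by (auto intro: free.subspace_add I(2))
    ultimately show ?thesis by blast
  qed
  then show ?thesis using sub I(4) by (auto simp: free_graded_ideal_iff)
qed

lemma coset_image:
  assumes "graded_ideal L I"
  shows "coset L I (\<rho> u) = {\<rho> w | w. w - u \<in> \<rho> -` I}"
proof -
  have "I \<subseteq> range \<rho>" using assms by (auto simp: graded_ideal_def space_image)
  then have "I = \<rho> ` (\<rho> -` I)" by auto
  then have "coset L I (\<rho> u) = add L (\<rho> u) ` \<rho> ` (\<rho> -` I)"
    unfolding coset_def by simp
  also have "\<dots> = (\<lambda>k. \<rho> (u + k)) ` (\<rho> -` I)"
    unfolding image_image add_image ..
  also have "\<dots> = {\<rho> w | w. w - u \<in> \<rho> -` I}"
  proof -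
    have "\<exists>k\<in>\<rho> -` I. w = u + k" if "w - u \<in> \<rho> -` I" for w
      using that by (intro bexI[of _ "w - u"]) simp_all
    moreover have "u + k - u = k" for k by simp
    ultimately show ?thesis by (smt (verit) Collect_cong image_def)
  qed
  finally show ?thesis .
qed

lemma coset_eq_iff:
  assumes "graded_ideal L I" "free_graded_ideal \<pi> kernel"
  shows "coset L I (\<rho> u) = coset L I (\<rho> w) \<longleftrightarrow> u - w \<in> \<rho> -` I"
proof
  have sub: "free.subspace (\<rho> -` I)"
    using kernel_preimage[OF assms] by (simp add: free_graded_ideal_iff)
  have ker: "k \<in> kernel \<Longrightarrow> k \<in> \<rho> -` I" for k
    using free.subspace_0[OF sub] by (auto simp: kernel_def)
  { assume "coset L I (\<rho> u) = coset L I (\<rho> w)"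
    moreover have "\<rho> u \<in> coset L I (\<rho> u)"
      using free.subspace_0[OF sub] by (auto simp: coset_image[OF assms(1)] intro!: exI[of _ u])
    ultimately obtain z where "\<rho> u = \<rho> z" "z - w \<in> \<rho> -` I"
      by (auto simp: coset_image[OF assms(1)])
    then have "(u - z) + (z - w) \<in> \<rho> -` I"
      using ker sub by (intro free.subspace_add) (auto simp: image_eq_iff)
    then show "u - w \<in> \<rho> -` I" by simp }
  assume uw: "u - w \<in> \<rho> -` I"
  have "z - u \<in> \<rho> -` I \<longleftrightarrow> z - w \<in> \<rho> -` I" for z
    using free.subspace_add[OF sub uw, of "z - u"] free.subspace_diff[OF sub _ uw, of "z - w"] by auto
  then show "coset L I (\<rho> u) = coset L I (\<rho> w)" by (simp add: coset_image[OF assms(1)])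
qed

text \<open>Each operation on cosets is a union over representatives. Since the preimage of
  \<open>I\<close> is an ideal, this is a nonempty union of equal cosets and collapses to one. The
  conclusion has the form of the hypothesis, so the lemma can be applied again to a quotient of a
  quotient.\<close>

lemma free_image_quotient:
  assumes "graded_ideal L I" "free_graded_ideal \<pi> kernel"
  shows "free_image \<pi> (quotient L I) (\<lambda>u. coset L I (\<rho> u))"
proof
  note K = kernel_preimage[OF assms, unfolded free_graded_ideal_iff]
  note sub = conjunct1[OF K]
  note eq = coset_eq_iff[OF assms] and im = coset_image[OF assms(1)]
  have mem: "\<rho> u \<in> coset L I (\<rho> u)" for u
    using free.subspace_0[OF sub] by (auto simp: im intro!: exI[of _ u])
  then have ne: "coset L I (\<rho> u) \<noteq> {}" for u by blast
  fix u w c i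
  show "space (quotient L I) = range (\<lambda>u. coset L I (\<rho> u))"
    by (auto simp: quotient_def space_image)
  show "part (quotient L I) i = (\<lambda>u. coset L I (\<rho> u)) ` free_part \<pi> i"
    by (auto simp: quotient_def part_image)
  have "I \<subseteq> range \<rho>" using assms by (auto simp: graded_ideal_def space_image)
  then show "zero (quotient L I) = coset L I (\<rho> 0)" by (auto simp: quotient_def im)
  have "coset L I (add L p q) = coset L I (\<rho> (u + w))"
    if pq: "p \<in> coset L I (\<rho> u)" "q \<in> coset L I (\<rho> w)" for p q
  proof -
    obtain p' where p: "p = \<rho> p'" "p' - u \<in> \<rho> -` I" using pq(1) by (auto simp: im)
    obtain q' where q: "q = \<rho> q'" "q' - w \<in> \<rho> -` I" using pq(2) by (auto simp: im)
    have "p' + q' - (u + w) = (p' - u) + (q' - w)" by simp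
    then have "p' + q' - (u + w) \<in> \<rho> -` I" using free.subspace_add[OF sub p(2) q(2)] by presburger
    then show ?thesis by (simp add: p(1) q(1) add_image eq)
  qed
  then show "add (quotient L I) (coset L I (\<rho> u)) (coset L I (\<rho> w)) = coset L I (\<rho> (u + w))"
    using ne by (simp add: quotient_def)
  have "coset L I (scl L c p) = coset L I (\<rho> (free_scale c u))" if p: "p \<in> coset L I (\<rho> u)" for p
  proof -
    obtain p' where "p = \<rho> p'" "p' - u \<in> \<rho> -` I" using p by (auto simp: im)
    moreover have "free_scale c p' - free_scale c u = free_scale c (p' - u)"
      by (simp add: free.scale_right_diff_distrib)
    ultimately show ?thesis using free.subspace_scale[OF sub] by (simp add: scl_image eq)
  qed
  then show "scl (quotient L I) c (coset L I (\<rho> u)) = coset L I (\<rho> (free_scale c u))"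
    using ne by (simp add: quotient_def)
  have "coset L I (bracket L p q) = coset L I (\<rho> (free_bracket u w))"
    if pq: "p \<in> coset L I (\<rho> u)" "q \<in> coset L I (\<rho> w)" for p q
  proof -
    obtain p' where p: "p = \<rho> p'" "p' - u \<in> \<rho> -` I" using pq(1) by (auto simp: im)
    obtain q' where q: "q = \<rho> q'" "q' - w \<in> \<rho> -` I" using pq(2) by (auto simp: im)
    have "free_bracket p' q' - free_bracket u w
        = free_bracket (p' - u) q' + free_bracket u (q' - w)"
      by (simp add: free_bracket_diff)
    moreover have "free_bracket (p' - u) q' \<in> \<rho> -` I" "free_bracket u (q' - w) \<in> \<rho> -` I"
      using p q K by simp_all
    ultimately show ?thesis using free.subspace_add[OF sub] by (simp add: p q bracket_image eq)
  qed
  then show "bracket (quotient L I) (coset L I (\<rho> u)) (coset L I (\<rho> w)) = coset L I (\<rho> (free_bracket u w))"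
    using ne by (simp add: quotient_def)
qed

end

section \<open>Weights and the triangular decomposition\<close>

lemma subspace_bracket_right: "free.subspace N \<Longrightarrow> free.subspace {t. free_bracket u t \<in> N}"
  by (auto simp: free.subspace_def free_bracket_linear)

lemma subspace_bracket_left: "free.subspace N \<Longrightarrow> free.subspace {t. free_bracket t u \<in> N}"
  by (auto simp: free.subspace_def free_bracket_linear)

lemma subspace_diff_mem:
  assumes "free.subspace T" "u - w \<in> T" "w \<in> T" shows "u \<in> T"
  using free.subspace_add[OF assms] by simp

lemma subspace_diff_mem':
  assumes "free.subspace T" "u - w \<in> T" "u \<in> T" shows "w \<in> T"
  using free.subspace_diff[OF assms(1,3,2)] by simp

section \<open>Computation modulo an ideal that contains the Lie relations\<close>

locale lie_ideal =
  fixes \<pi> :: "'g \<Rightarrow> bit" and K :: "'g free set"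
  assumes ideal: "free_graded_ideal \<pi> K" and lie: "lie_relations \<pi> \<subseteq> K"
begin

lemma subspace_K: "free.subspace K"
  and K_bracket: "u \<in> K \<Longrightarrow> free_bracket u w \<in> K" "u \<in> K \<Longrightarrow> free_bracket w u \<in> K"
  and K_graded: "u \<in> K \<Longrightarrow> \<exists>u0\<in>K \<inter> free_part \<pi> 0. \<exists>u1\<in>K \<inter> free_part \<pi> 1. u = u0 + u1"
  using ideal by (auto simp: free_graded_ideal_iff)

lemmas K_closed = free.subspace_0[OF subspace_K] free.subspace_add[OF subspace_K]
  free.subspace_diff[OF subspace_K] free.subspace_neg[OF subspace_K]
  free.subspace_scale[OF subspace_K]

lemma antisymmetry:
  assumes "u \<in> free_part \<pi> i" "w \<in> free_part \<pi> j"
  shows "free_bracket u w + free_scale (koszul_sign i j) (free_bracket w u) \<in> K"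
  using lie assms unfolding lie_relations_def by blast

lemma jacobi:
  assumes "u \<in> free_part \<pi> i" "w \<in> free_part \<pi> j"
  shows "free_bracket u (free_bracket w z) - free_bracket (free_bracket u w) z
    - free_scale (koszul_sign i j) (free_bracket w (free_bracket u z)) \<in> K"
  using lie assms unfolding lie_relations_def by blast

text \<open>Here and in the next two lemmas, membership in a subspace \<open>T\<close> containing
  \<open>K\<close> absorbs both the Koszul sign and the error term, so later arguments need not
  compute signs.\<close>

lemma bracket_commute_mem:
  assumes "free.subspace T" "K \<subseteq> T" "u \<in> free_part \<pi> i" "w \<in> free_part \<pi> j" "free_bracket w u \<in> T"
  shows "free_bracket u w \<in> T"
  using free.subspace_diff[OF assms(1) subsetD[OF assms(2) antisymmetry[OF assms(3,4)]]
      free.subspace_scale[OF assms(1,5)]] by (metis add_diff_cancel_right')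

lemma bracket_bracket_mem:
  assumes "free.subspace T" "K \<subseteq> T" "u \<in> free_part \<pi> i" "w \<in> free_part \<pi> j"
    and "free_bracket (free_bracket u w) z \<in> T" "free_bracket w (free_bracket u z) \<in> T"
  shows "free_bracket u (free_bracket w z) \<in> T"
  using assms jacobi[OF assms(3,4), of z]
  by (meson free.subspace_scale subsetD subspace_diff_mem)

lemma bracket_bracket_mem_left:
  assumes "free.subspace T" "K \<subseteq> T" "u \<in> free_part \<pi> i" "w \<in> free_part \<pi> j"
    and "free_bracket u (free_bracket w z) \<in> T" "free_bracket w (free_bracket u z) \<in> T"
  shows "free_bracket (free_bracket u w) z \<in> T"
  using assms jacobi[OF assms(3,4), of z]
  by (meson free.subspace_scale subsetD subspace_diff_mem subspace_diff_mem')

text \<open>The homogeneous components of \<open>u - w\<close> are \<open>u\<close> and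
  \<open>- w\<close>, and a graded ideal contains the components of its elements.\<close>

lemma homogeneous_diff_in_K:
  assumes "u \<in> free_part \<pi> i" "w \<in> free_part \<pi> j" "i \<noteq> j" "u - w \<in> K"
  shows "u \<in> K"
proof -
  obtain k0 k1 where k: "k0 \<in> K \<inter> free_part \<pi> 0" "k1 \<in> K \<inter> free_part \<pi> 1" "u - w = k0 + k1"
    using K_graded[OF assms(4)] by auto
  have neg: "- w \<in> free_part \<pi> j" using assms(2) free.subspace_neg subspace_free_part by blast
  show ?thesis
  proof (cases "i = 0")
    case True
    then have "u = k0"
      using assms(1,3) neg k free_part_unique(1)[of u \<pi> "- w" k0 k1] by (cases j) auto
    then show ?thesis using k by simp
  next
    case False
    then have "u = k1"
      using assms(1,3) neg k free_part_unique(2)[of "- w" \<pi> u k0 k1] by (cases j) auto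
    then show ?thesis using k by simp
  qed
qed

end

text \<open>The last letter of a word is kept separate, because a word has at least one letter.\<close>

definition word :: "('x \<Rightarrow> 'g free) \<Rightarrow> 'x list \<Rightarrow> 'x \<Rightarrow> 'g free"
  where "word e ys x = foldr (\<lambda>y. free_bracket (e y)) ys (e x)"

lemma word_simps [simp]:
  "word e [] x = e x"
  "word e (y # ys) x = free_bracket (e y) (word e ys x)"
  by (simp_all add: word_def)

definition word_weight :: "('x \<Rightarrow> 'h \<Rightarrow> complex) \<Rightarrow> 'x list \<Rightarrow> 'x \<Rightarrow> 'h \<Rightarrow> complex"
  where "word_weight b ys x = (\<lambda>h. b x h + (\<Sum>y\<leftarrow>ys. b y h))"

section \<open>Weight vectors modulo an ideal\<close>

locale weight_action = lie_ideal \<pi> K for \<pi> :: "'g \<Rightarrow> bit" and K +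
  fixes hh :: "'h \<Rightarrow> 'g free"
  assumes hh_even: "hh h \<in> free_part \<pi> 0"
    and hh_hh: "free_bracket (hh h) (hh k) \<in> K"
begin

definition weight_vector :: "('h \<Rightarrow> complex) \<Rightarrow> 'g free \<Rightarrow> bool"
  where "weight_vector \<beta> u \<longleftrightarrow> (\<forall>h. free_bracket (hh h) u - free_scale (\<beta> h) u \<in> K)"

lemma weight_vector_hh: "weight_vector (\<lambda>h. 0) (hh k)"
  using hh_hh by (simp add: weight_vector_def)

lemma subspace_weight_vector: "free.subspace {u. weight_vector \<beta> u}"
proof -
  have "free_bracket (hh h) (u + w) - free_scale (\<beta> h) (u + w) =
    (free_bracket (hh h) u - free_scale (\<beta> h) u) + (free_bracket (hh h) w - free_scale (\<beta> h) w)"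
    "free_bracket (hh h) (free_scale c u) - free_scale (\<beta> h) (free_scale c u) =
    free_scale c (free_bracket (hh h) u - free_scale (\<beta> h) u)" for h u w c
    by (simp_all add: free_bracket_linear free.scale_right_distrib free.scale_right_diff_distrib mult_ac)
  then show ?thesis
    using K_closed by (simp add: free.subspace_def weight_vector_def)
qed

lemma weight_vector_bracket:
  assumes "u \<in> free_part \<pi> i" "weight_vector \<beta> u" "weight_vector \<gamma> w"
  shows "weight_vector (\<lambda>h. \<beta> h + \<gamma> h) (free_bracket u w)"
  unfolding weight_vector_def
proof
  fix h
  let ?J = "free_bracket (hh h) (free_bracket u w) - free_bracket (free_bracket (hh h) u) w
    - free_bracket u (free_bracket (hh h) w)"
  have "?J \<in> K" using jacobi[OF hh_even assms(1), of h w] by (simp add: koszul_sign_def)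
  moreover have "free_bracket (free_bracket (hh h) u - free_scale (\<beta> h) u) w \<in> K"
    "free_bracket u (free_bracket (hh h) w - free_scale (\<gamma> h) w) \<in> K"
    using assms K_bracket by (auto simp: weight_vector_def)
  ultimately have "?J + free_bracket (free_bracket (hh h) u - free_scale (\<beta> h) u) w
    + free_bracket u (free_bracket (hh h) w - free_scale (\<gamma> h) w) \<in> K"
    using K_closed(2) by blast
  then show "free_bracket (hh h) (free_bracket u w) - free_scale (\<beta> h + \<gamma> h) (free_bracket u w) \<in> K"
    by (simp add: free_bracket_linear free.scale_left_distrib algebra_simps)
qed

lemma weight_vector_word:
  assumes "\<And>x. e x \<in> free_part \<pi> (q x)" "\<And>x. weight_vector (b x) (e x)"
  shows "weight_vector (word_weight b ys x) (word e ys x)"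
proof (induction ys)
  case Nil
  then show ?case using assms(2)[of x] by (simp add: word_weight_def)
next
  case (Cons y ys)
  show ?case using weight_vector_bracket[OF assms(1)[of y] assms(2)[of y] Cons]
    by (simp add: word_weight_def add.left_commute)
qed

text \<open>Apply \<open>ad h - \<beta>\<^sub>0(h)\<close> to the sum: this kills one summand and rescales the others.\<close>

lemma weight_vectors_independent:
  assumes "finite B" "\<And>\<beta>. \<beta> \<in> B \<Longrightarrow> weight_vector \<beta> (t \<beta>)" "(\<Sum>\<beta>\<in>B. t \<beta>) \<in> K" "\<beta> \<in> B"
  shows "t \<beta> \<in> K"
  using assms
proof (induction B arbitrary: t \<beta> rule: finite_induct)
  case empty
  then show ?case by simp
next
  case (insert \<beta>0 B)
  have *: "t \<beta> \<in> K" if "\<beta> \<in> B" for \<beta>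
  proof -
    have "\<beta> \<noteq> \<beta>0" using that insert by auto
    then obtain h where h: "\<beta> h \<noteq> \<beta>0 h" by auto
    have "(\<Sum>\<gamma>\<in>B. free_scale (\<gamma> h - \<beta>0 h) (t \<gamma>)) =
      free_bracket (hh h) (\<Sum>\<gamma>\<in>insert \<beta>0 B. t \<gamma>) - free_scale (\<beta>0 h) (\<Sum>\<gamma>\<in>insert \<beta>0 B. t \<gamma>)
      - (\<Sum>\<gamma>\<in>insert \<beta>0 B. free_bracket (hh h) (t \<gamma>) - free_scale (\<gamma> h) (t \<gamma>))"
    proof -
      have br: "free_bracket (hh h) (\<Sum>\<gamma>\<in>C. t \<gamma>) = (\<Sum>\<gamma>\<in>C. free_bracket (hh h) (t \<gamma>))" for C
        by (induction C rule: infinite_finite_induct) (simp_all add: free_bracket_add_right)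
      have "(\<Sum>\<gamma>\<in>insert \<beta>0 B. free_scale (\<gamma> h - \<beta>0 h) (t \<gamma>)) =
        (\<Sum>\<gamma>\<in>B. free_scale (\<gamma> h - \<beta>0 h) (t \<gamma>))"
        using insert by simp
      then show ?thesis
        unfolding br by (simp add: free.scale_left_diff_distrib sum_subtractf free.scale_sum_right)
    qed
    also have "\<dots> \<in> K"
    proof -
      have "(\<Sum>\<gamma>\<in>insert \<beta>0 B. free_bracket (hh h) (t \<gamma>) - free_scale (\<gamma> h) (t \<gamma>)) \<in> K"
        using insert.prems(1) by (intro free.subspace_sum[OF subspace_K]) (simp add: weight_vector_def)
      then show ?thesis
        by (rule K_closed(3)[OF K_closed(3)[OF K_bracket(2)[OF insert.prems(2)] K_closed(5)[OF insert.prems(2)]]])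
    qed
    finally have "(\<Sum>\<gamma>\<in>B. free_scale (\<gamma> h - \<beta>0 h) (t \<gamma>)) \<in> K" .
    moreover have "weight_vector \<gamma> (free_scale (\<gamma> h - \<beta>0 h) (t \<gamma>))" if "\<gamma> \<in> B" for \<gamma>
      using that insert.prems(1) free.subspace_scale[OF subspace_weight_vector] by auto
    ultimately have "free_scale (\<beta> h - \<beta>0 h) (t \<beta>) \<in> K"
      using insert.IH[of "\<lambda>\<gamma>. free_scale (\<gamma> h - \<beta>0 h) (t \<gamma>)" \<beta>] that by simp
    then have "free_scale (inverse (\<beta> h - \<beta>0 h)) (free_scale (\<beta> h - \<beta>0 h) (t \<beta>)) \<in> K"
      by (rule K_closed(5))
    then show ?thesis using h by simp
  qed
  then have "(\<Sum>\<beta>\<in>B. t \<beta>) \<in> K" by (intro free.subspace_sum[OF subspace_K])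
  moreover have "t \<beta>0 + (\<Sum>\<beta>\<in>B. t \<beta>) \<in> K" using insert by simp
  ultimately have "t \<beta>0 \<in> K" using K_closed(3) by fastforce
  then show ?case using * insert.prems(3) by blast
qed

text \<open>Modulo \<open>K\<close>, \<open>w\<close> is a finite sum of components, one for each
  weight. By independence of weights only the component of weight \<beta> can survive, and it is
  spanned by the \<open>g i\<close> of that weight.\<close>

lemma weight_vector_in_span:
  assumes g: "\<And>i. weight_vector (wt i) (g i)"
    and w: "w \<in> free.span (K \<union> range g)" "weight_vector \<beta> w"
  shows "w \<in> free.span (K \<union> g ` {i. wt i = \<beta>})"
proof -
  define S where "S \<gamma> = free.span (g ` {i. wt i = \<gamma>})" for \<gamma>
  \<comment> \<open>Elements that have a weight decomposition modulo \<open>K\<close>. The value 0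
    outside \<open>B\<close> allows two decompositions to be added over the union of their index
    sets.\<close>
  define D where "D = {u. \<exists>B t. finite B \<and> (\<forall>\<gamma>. t \<gamma> \<in> S \<gamma>) \<and> (\<forall>\<gamma>. \<gamma> \<notin> B \<longrightarrow> t \<gamma> = 0) \<and> u - (\<Sum>\<gamma>\<in>B. t \<gamma>) \<in> K}"
  have S: "u \<in> S \<gamma> \<Longrightarrow> weight_vector \<gamma> u" for u \<gamma>
    using free.span_minimal[OF _ subspace_weight_vector, of "g ` {i. wt i = \<gamma>}" \<gamma>] g
    by (auto simp: S_def)
  have D: "u \<in> D \<longleftrightarrow> (\<exists>B t. finite B \<and> (\<forall>\<gamma>. t \<gamma> \<in> S \<gamma>) \<and> (\<forall>\<gamma>. \<gamma> \<notin> B \<longrightarrow> t \<gamma> = 0) \<and> u - (\<Sum>\<gamma>\<in>B. t \<gamma>) \<in> K)" for u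
    by (simp add: D_def)
  have S0: "0 \<in> S \<gamma>" and S_add: "u \<in> S \<gamma> \<Longrightarrow> w \<in> S \<gamma> \<Longrightarrow> u + w \<in> S \<gamma>"
    and S_scale: "u \<in> S \<gamma> \<Longrightarrow> free_scale c u \<in> S \<gamma>" for u w c \<gamma>
    unfolding S_def by (rule free.span_zero free.span_add free.span_scale; assumption)+
  have "free.subspace D"
    unfolding free.subspace_def
  proof (intro conjI ballI allI)
    show "0 \<in> D" unfolding D using S0 K_closed(1) by (intro exI[of _ "{}"] exI[of _ "\<lambda>_. 0"]) simp
  next
    fix u w assume "u \<in> D" "w \<in> D"
    then obtain B t C s where t: "finite B" "\<forall>\<gamma>. t \<gamma> \<in> S \<gamma>" "\<forall>\<gamma>. \<gamma> \<notin> B \<longrightarrow> t \<gamma> = 0" "u - (\<Sum>\<gamma>\<in>B. t \<gamma>) \<in> K"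
      and s: "finite C" "\<forall>\<gamma>. s \<gamma> \<in> S \<gamma>" "\<forall>\<gamma>. \<gamma> \<notin> C \<longrightarrow> s \<gamma> = 0" "w - (\<Sum>\<gamma>\<in>C. s \<gamma>) \<in> K"
      unfolding D by blast
    have "(\<Sum>\<gamma>\<in>B. t \<gamma>) = (\<Sum>\<gamma>\<in>B \<union> C. t \<gamma>)" "(\<Sum>\<gamma>\<in>C. s \<gamma>) = (\<Sum>\<gamma>\<in>B \<union> C. s \<gamma>)"
      using t s by (auto intro!: sum.mono_neutral_left)
    then have "u + w - (\<Sum>\<gamma>\<in>B \<union> C. t \<gamma> + s \<gamma>) = (u - (\<Sum>\<gamma>\<in>B. t \<gamma>)) + (w - (\<Sum>\<gamma>\<in>C. s \<gamma>))"
      by (simp add: sum.distrib)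
    then have "u + w - (\<Sum>\<gamma>\<in>B \<union> C. t \<gamma> + s \<gamma>) \<in> K" using t s K_closed(2) by presburger
    moreover have "\<forall>\<gamma>. t \<gamma> + s \<gamma> \<in> S \<gamma>" using t(2) s(2) S_add by blast
    ultimately show "u + w \<in> D" unfolding D using t(1,3) s(1,3)
      by (intro exI[of _ "B \<union> C"] exI[of _ "\<lambda>\<gamma>. t \<gamma> + s \<gamma>"]) simp
  next
    fix c u assume "u \<in> D"
    then obtain B t where t: "finite B" "\<forall>\<gamma>. t \<gamma> \<in> S \<gamma>" "\<forall>\<gamma>. \<gamma> \<notin> B \<longrightarrow> t \<gamma> = 0" "u - (\<Sum>\<gamma>\<in>B. t \<gamma>) \<in> K"
      unfolding D by blast
    have "free_scale c (u - (\<Sum>\<gamma>\<in>B. t \<gamma>)) \<in> K" by (rule K_closed(5)[OF t(4)])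
    then have "free_scale c u - (\<Sum>\<gamma>\<in>B. free_scale c (t \<gamma>)) \<in> K"
      by (simp add: free.scale_right_diff_distrib free.scale_sum_right)
    moreover have "\<forall>\<gamma>. free_scale c (t \<gamma>) \<in> S \<gamma>" using t(2) S_scale by blast
    ultimately show "free_scale c u \<in> D" unfolding D using t(1,3)
      by (intro exI[of _ B] exI[of _ "\<lambda>\<gamma>. free_scale c (t \<gamma>)"]) simp
  qed
  moreover have "K \<union> range g \<subseteq> D"
  proof -
    have "u \<in> D" if "u \<in> K" for u
      unfolding D using that S0 by (intro exI[of _ "{}"] exI[of _ "\<lambda>_. 0"]) simp
    moreover have "g i \<in> D" for i
    proof -
      have "g i \<in> S (wt i)" unfolding S_def by (intro free.span_base) simp
      then show ?thesis unfolding D using S0 K_closed(1)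
        by (intro exI[of _ "{wt i}"] exI[of _ "\<lambda>\<gamma>. if \<gamma> = wt i then g i else 0"]) simp
    qed
    ultimately show ?thesis by blast
  qed
  ultimately have "w \<in> D" using subsetD[OF free.span_minimal w(1)] by simp
  then obtain B t where t: "finite B" "\<forall>\<gamma>. t \<gamma> \<in> S \<gamma>" "\<forall>\<gamma>. \<gamma> \<notin> B \<longrightarrow> t \<gamma> = 0" "w - (\<Sum>\<gamma>\<in>B. t \<gamma>) \<in> K"
    unfolding D by blast
  \<comment> \<open>Moving \<open>w\<close> into the summand of weight \<beta> gives a relation
    modulo \<open>K\<close> between vectors of distinct weights. Summing over
    \<open>insert \<beta> B\<close> covers the case that \<beta> did not occur.\<close>
  define t' where "t' \<gamma> = (if \<gamma> = \<beta> then t \<gamma> - w else t \<gamma>)" for \<gamma>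
  have "(\<Sum>\<gamma>\<in>insert \<beta> B. t' \<gamma>) = (\<Sum>\<gamma>\<in>insert \<beta> B. t \<gamma> - (if \<gamma> = \<beta> then w else 0))"
    by (intro sum.cong) (simp_all add: t'_def)
  also have "\<dots> = (\<Sum>\<gamma>\<in>insert \<beta> B. t \<gamma>) - w"
    using t(1) by (simp add: sum_subtractf)
  also have "(\<Sum>\<gamma>\<in>insert \<beta> B. t \<gamma>) = (\<Sum>\<gamma>\<in>B. t \<gamma>)"
    using t by (intro sum.mono_neutral_right) auto
  finally have "(\<Sum>\<gamma>\<in>insert \<beta> B. t' \<gamma>) = - (w - (\<Sum>\<gamma>\<in>B. t \<gamma>))" by simp
  then have "(\<Sum>\<gamma>\<in>insert \<beta> B. t' \<gamma>) \<in> K" using t(4) K_closed(4) by presburger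
  moreover have "weight_vector \<gamma> (t' \<gamma>)" for \<gamma>
    using S t(2) w(2) free.subspace_diff[OF subspace_weight_vector] by (auto simp: t'_def)
  ultimately have "t' \<beta> \<in> K" using weight_vectors_independent[of "insert \<beta> B" t' \<beta>] t(1) by blast
  then have "t \<beta> - w \<in> K" by (simp add: t'_def)
  then have "t \<beta> - w \<in> free.span (K \<union> g ` {i. wt i = \<beta>})"
    by (intro free.span_base UnI1)
  moreover have "t \<beta> \<in> free.span (K \<union> g ` {i. wt i = \<beta>})"
    using t(2) free.span_mono[OF Un_upper2] unfolding S_def by blast
  ultimately show ?thesis by (rule subspace_diff_mem'[OF free.subspace_span])
qed

end

text \<open>The letters \<open>e\<close> and \<open>f\<close> play interchangeable roles; the locale
  is instantiated once with each as the raising letters. Only the fact that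
  \<open>[e x, f y]\<close> is a Cartan element modulo \<open>K\<close> is recorded, which treats
  \<open>x = y\<close> and \<open>x \<noteq> y\<close> alike.\<close>

locale triangular = weight_action \<pi> K hh
  for \<pi> :: "'g \<Rightarrow> bit" and K and hh :: "'h \<Rightarrow> 'g free" +
  fixes e f :: "'x \<Rightarrow> 'g free" and b c :: "'x \<Rightarrow> 'h \<Rightarrow> complex" and q :: "'x \<Rightarrow> bit"
  assumes e_part: "e x \<in> free_part \<pi> (q x)" and f_part: "f x \<in> free_part \<pi> (q x)"
    and e_weight: "weight_vector (b x) (e x)" and f_weight: "weight_vector (c x) (f x)"
    and e_f: "free_bracket (e x) (f y) \<in> free.span (K \<union> range hh)"
begin

text \<open>The preimage of the Borel part: the Cartan elements together with the right-normed words
  in the \<open>f x\<close>.\<close>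

definition lower :: "'g free set"
  where "lower = free.span (K \<union> range hh \<union> range (case_prod (word f)))"

lemma subspace_lower: "free.subspace lower"
  by (simp add: lower_def)

lemma lower_intros: "u \<in> K \<Longrightarrow> u \<in> lower" "hh h \<in> lower" "word f ys x \<in> lower"
  unfolding lower_def by (intro free.span_base; force)+

lemma lower_least: "free.subspace T \<Longrightarrow> K \<subseteq> T \<Longrightarrow> range hh \<subseteq> T \<Longrightarrow> (\<And>ys x. word f ys x \<in> T) \<Longrightarrow> lower \<subseteq> T"
  unfolding lower_def by (intro free.span_minimal) auto

text \<open>Modulo \<open>K\<close>, a Cartan element acts on a weight vector by a scalar.\<close>

lemma cartan_bracket:
  assumes "u \<in> free.span (K \<union> range hh)" "weight_vector \<gamma> w"
    and T: "free.subspace T" "K \<subseteq> T" "w \<in> T"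
  shows "free_bracket u w \<in> T"
proof -
  have "free_bracket (hh h) w \<in> T" for h
    using assms(2) T subspace_diff_mem[OF T(1), of _ "free_scale (\<gamma> h) w"] free.subspace_scale[OF T(1)]
    unfolding weight_vector_def by blast
  then have "K \<union> range hh \<subseteq> {u. free_bracket u w \<in> T}"
    using T(2) K_bracket(1) by auto
  then show ?thesis
    using free.span_minimal[OF _ subspace_bracket_left[OF T(1)]] assms(1) by blast
qed

lemma hh_bracket_swap:
  assumes "u \<in> free_part \<pi> i" "weight_vector \<gamma> u" "free.subspace T" "K \<subseteq> T" "u \<in> T"
  shows "free_bracket u (hh h) \<in> T"
  using assms cartan_bracket[OF _ assms(2-5), of "hh h"]
  by (intro bracket_commute_mem[OF assms(3,4,1) hh_even]) (auto intro: free.span_base)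

lemma f_lower:
  assumes "t \<in> lower"
  shows "free_bracket (f y) t \<in> lower"
proof -
  have "lower \<subseteq> {t. free_bracket (f y) t \<in> lower}"
  proof (rule lower_least[OF subspace_bracket_right[OF subspace_lower]])
    show "K \<subseteq> {t. free_bracket (f y) t \<in> lower}" using K_bracket(2) lower_intros(1) by auto
    show "range hh \<subseteq> {t. free_bracket (f y) t \<in> lower}"
      using hh_bracket_swap[OF f_part f_weight subspace_lower] lower_intros(1) lower_intros(3)[of "[]" y] by auto
    show "word f ys x \<in> {t. free_bracket (f y) t \<in> lower}" for ys x
      using lower_intros(3)[of "y # ys" x] by simp
  qed
  then show ?thesis using assms by blast
qed

text \<open>By Jacobi, \<open>[e, [f, w]]\<close> splits into \<open>[[e, f], w]\<close>, where a
  Cartan element acts on the weight vector \<open>w\<close>, and \<open>[f, [e, w]]\<close>, which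
  is covered by induction and \<open>f_lower\<close>. The claim is restricted to words, because
  \<open>[e, h]\<close> is a multiple of \<open>e\<close> modulo \<open>K\<close>.\<close>

lemma e_word: "free_bracket (e z) (word f ys x) \<in> lower"
proof (induction ys)
  case Nil
  have "free.span (K \<union> range hh) \<subseteq> lower" unfolding lower_def by (intro free.span_mono) auto
  then show ?case using e_f by auto
next
  case (Cons y ys)
  have K: "K \<subseteq> lower" using lower_intros(1) by auto
  have "weight_vector (word_weight c ys x) (word f ys x)"
    by (rule weight_vector_word[OF f_part f_weight])
  then have "free_bracket (free_bracket (e z) (f y)) (word f ys x) \<in> lower"
    by (rule cartan_bracket[OF e_f _ subspace_lower K lower_intros(3)])
  then show ?case
    using bracket_bracket_mem[OF subspace_lower K e_part f_part _ f_lower[OF Cons]] by simp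
qed

end

section \<open>Combinations of simple roots and the weights of words\<close>

definition root_comb :: "('x::finite, 'h) root_datum \<Rightarrow> ('x \<Rightarrow> complex) \<Rightarrow> 'h \<Rightarrow> complex"
  where "root_comb u c = (\<lambda>h. \<Sum>x\<in>UNIV. c x * simple_root u x h)"

definition positive_at :: "('x::finite, 'h) root_datum \<Rightarrow> ('h \<Rightarrow> complex) \<Rightarrow> bool"
  where "positive_at u \<beta> \<longleftrightarrow> (\<exists>n :: 'x \<Rightarrow> nat. \<beta> = root_comb u (\<lambda>x. of_nat (n x)))"

definition negative_at :: "('x::finite, 'h) root_datum \<Rightarrow> ('h \<Rightarrow> complex) \<Rightarrow> bool"
  where "negative_at u \<beta> \<longleftrightarrow> (\<exists>n :: 'x \<Rightarrow> nat. \<beta> = root_comb u (\<lambda>x. - of_nat (n x)))"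

lemma simple_roots_independent:
  assumes "is_root_datum scale u" "\<And>h. (\<Sum>x\<in>UNIV. c x * simple_root u x h) = 0"
  shows "c x = 0"
proof -
  have "(\<forall>h. (\<Sum>x\<in>UNIV. c x * simple_root u x h) = 0) \<longrightarrow> (\<forall>x. c x = 0)"
    using assms(1) unfolding is_root_datum_def by (elim conjE allE[of _ c])
  then show ?thesis using assms(2) by simp
qed

lemma simple_coroots_independent:
  assumes "is_root_datum scale u" "(\<Sum>x\<in>UNIV. scale (c x) (simple_coroot u x)) = 0"
  shows "c x = 0"
proof -
  have "(\<Sum>x\<in>UNIV. scale (c x) (simple_coroot u x)) = 0 \<longrightarrow> (\<forall>x. c x = 0)"
    using assms(1) unfolding is_root_datum_def by (elim conjE allE[of _ c])
  then show ?thesis using assms(2) by simp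
qed

lemma root_comb_inject:
  assumes "is_root_datum scale u" "root_comb u c = root_comb u d"
  shows "c = d"
proof -
  have "(\<Sum>x\<in>UNIV. (c x - d x) * simple_root u x h) = 0" for h
    using fun_cong[OF assms(2), of h] by (simp add: root_comb_def left_diff_distrib sum_subtractf)
  then have "c x - d x = 0" for x by (rule simple_roots_independent[OF assms(1)])
  then show ?thesis by auto
qed

lemma root_comb_single: "root_comb u (\<lambda>y. if y = x then c else 0) = (\<lambda>h. c * simple_root u x h)"
  by (simp add: root_comb_def if_distrib[of "\<lambda>a. a * _"] cong: if_cong)

lemma simple_root_as_comb: "simple_root u x = root_comb u (\<lambda>y. if y = x then 1 else 0)"
  by (simp add: root_comb_single)

lemma word_weight_simple_root:
  "word_weight (simple_root u) ys x = root_comb u (\<lambda>y. of_nat (count_list (x # ys) y))"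
proof (induction ys)
  case Nil
  have "(\<lambda>y. of_nat (count_list [x] y)) = (\<lambda>y. if y = x then 1 else 0 :: complex)" by auto
  then show ?case by (simp add: word_weight_def root_comb_single)
next
  case (Cons y ys)
  have "(\<lambda>z. of_nat (count_list (x # y # ys) z)) =
      (\<lambda>z. (if z = y then 1 else 0) + of_nat (count_list (x # ys) z) :: complex)" by auto
  moreover have "root_comb u (\<lambda>z. (if z = y then 1 else 0) + of_nat (count_list (x # ys) z)) =
      (\<lambda>h. simple_root u y h + root_comb u (\<lambda>z. of_nat (count_list (x # ys) z)) h)"
    using fun_cong[OF simple_root_as_comb[of u y]]
    by (simp add: root_comb_def distrib_right sum.distrib)
  moreover have "word_weight (simple_root u) (y # ys) x
      = (\<lambda>h. simple_root u y h + word_weight (simple_root u) ys x h)"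
    by (simp add: word_weight_def add.left_commute)
  ultimately show ?case unfolding Cons by metis
qed

lemma root_comb_minus: "(\<lambda>h. - root_comb u c h) = root_comb u (\<lambda>y. - c y)"
  by (simp add: root_comb_def sum_negf)

lemma word_weight_minus_simple_root:
  "word_weight (\<lambda>x h. - simple_root u x h) ys x = root_comb u (\<lambda>y. - of_nat (count_list (x # ys) y))"
proof -
  have "word_weight (\<lambda>x h. - simple_root u x h) ys x = (\<lambda>h. - word_weight (simple_root u) ys x h)"
    by (simp add: word_weight_def uminus_sum_list_map o_def)
  then show ?thesis unfolding word_weight_simple_root root_comb_minus .
qed

lemma count_list_eq_single:
  assumes "\<And>y. count_list (z # ys) y = (if y = x then 1 else 0)"
  shows "z = x" "ys = []"
proof -
  show "z = x" using assms[of z] by (auto split: if_splits)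
  show "ys = []"
  proof (cases ys)
    case (Cons y zs)
    then show ?thesis using assms[of y] \<open>z = x\<close> by (auto split: if_splits)
  qed simp
qed

text \<open>Indices of the spanning family behind the triangular decomposition. With indices in a
  datatype the weight becomes a function of the index, as \<open>weight_vector_in_span\<close>
  asks.\<close>

datatype ('x, 'h) normal_form = Cartan 'h | Upper "'x list" 'x | Lower "'x list" 'x

text \<open>\<open>K\<close> stands for the kernel of the map from the free superalgebra onto the
  quotient at \<open>v\<close>; \<open>nondegenerate\<close> expresses that the ideal meets the
  Cartan space trivially.\<close>

locale half_baked_ideal = vector_space scale + lie_ideal "hb_parity v" K
  for scale :: "complex \<Rightarrow> 'h::ab_group_add \<Rightarrow> 'h" and v :: "('x::finite, 'h) root_datum" and K +
  assumes root_datum: "is_root_datum scale v"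
    and relations: "hb_relations scale v \<subseteq> K"
    and nondegenerate: "free_gen (H h) \<in> K \<Longrightarrow> h = 0"
begin

abbreviation "hh \<equiv> \<lambda>h. free_gen (H h) :: ('x, 'h) hb_gen free"
abbreviation "ee \<equiv> \<lambda>x. free_gen (E x) :: ('x, 'h) hb_gen free"
abbreviation "ff \<equiv> \<lambda>x. free_gen (F x) :: ('x, 'h) hb_gen free"

lemma gen_parts:
  "hh h \<in> free_part (hb_parity v) 0" "ee x \<in> free_part (hb_parity v) (parity v x)"
  "ff x \<in> free_part (hb_parity v) (parity v x)"
  by (simp_all add: free_gen_def free_part_def)

lemma relations_K:
  "hh (h + k) - hh h - hh k \<in> K"
  "hh (scale d h) - free_scale d (hh h) \<in> K"
  "free_bracket (hh h) (hh k) \<in> K"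
  "free_bracket (hh h) (ee x) - free_scale (simple_root v x h) (ee x) \<in> K"
  "free_bracket (hh h) (ff x) + free_scale (simple_root v x h) (ff x) \<in> K"
  "x \<noteq> y \<Longrightarrow> free_bracket (ee x) (ff y) \<in> K"
  "free_bracket (ee x) (ff x) - hh (simple_coroot v x) \<in> K"
  by (rule subsetD[OF relations]; unfold hb_relations_def; blast)+

sublocale weight_action "hb_parity v" K hh
  by unfold_locales (simp_all add: gen_parts relations_K)

lemma ee_weight: "weight_vector (simple_root v x) (ee x)"
  and ff_weight: "weight_vector (\<lambda>h. - simple_root v x h) (ff x)"
  using relations_K by (simp_all add: weight_vector_def)

lemma ee_ff: "free_bracket (ee x) (ff y) \<in> free.span (K \<union> range hh)"
proof (cases "x = y")
  case True
  show ?thesis unfolding True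
    by (rule subspace_diff_mem[OF free.subspace_span free.span_base free.span_base])
      (use relations_K(7) in auto)
next
  case False
  then show ?thesis using relations_K(6) by (auto intro: free.span_base)
qed

lemma ff_ee: "free_bracket (ff x) (ee y) \<in> free.span (K \<union> range hh)"
  by (rule bracket_commute_mem[OF free.subspace_span _ gen_parts(3,2) ee_ff])
    (auto intro: free.span_base)

sublocale up: triangular "hb_parity v" K hh ee ff "simple_root v" "\<lambda>x h. - simple_root v x h" "parity v"
  by unfold_locales (simp_all add: gen_parts ee_weight ff_weight ee_ff)

sublocale down: triangular "hb_parity v" K hh ff ee "\<lambda>x h. - simple_root v x h" "simple_root v" "parity v"
  by unfold_locales (simp_all add: gen_parts ee_weight ff_weight ff_ee)

primrec normal :: "('x, 'h) normal_form \<Rightarrow> ('x, 'h) hb_gen free" where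
  "normal (Cartan h) = hh h"
| "normal (Upper ys x) = word ee ys x"
| "normal (Lower ys x) = word ff ys x"

primrec normal_weight :: "('x, 'h) normal_form \<Rightarrow> 'h \<Rightarrow> complex" where
  "normal_weight (Cartan h) = (\<lambda>_. 0)"
| "normal_weight (Upper ys x) = word_weight (simple_root v) ys x"
| "normal_weight (Lower ys x) = word_weight (\<lambda>x h. - simple_root v x h) ys x"

lemma weight_vector_normal: "weight_vector (normal_weight i) (normal i)"
  using weight_vector_word[OF gen_parts(2) ee_weight] weight_vector_word[OF gen_parts(3) ff_weight]
  by (cases i) (simp_all add: weight_vector_hh)

abbreviation "T \<equiv> free.span (K \<union> range normal)"

lemma T_intros: "u \<in> K \<Longrightarrow> u \<in> T" "normal i \<in> T"
  by (auto intro: free.span_base)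

lemma lower_in_T: "up.lower \<subseteq> T" "down.lower \<subseteq> T"
  using T_intros(2)[of "Lower _ _"] T_intros(2)[of "Upper _ _"] T_intros(2)[of "Cartan _"] T_intros(1)
  by (intro up.lower_least down.lower_least free.subspace_span; force)+

text \<open>A letter of the same kind lengthens a word, a letter of the other kind is handled by
  \<open>e_word\<close> in one of the two triangular structures, and Cartan elements act by
  weights.\<close>

lemma gen_bracket_T:
  assumes "t \<in> T" shows "free_bracket (free_gen g) t \<in> T"
proof -
  have K: "K \<subseteq> T" using T_intros by auto
  have "free_bracket (free_gen g) (normal i) \<in> T" for i
  proof (cases g)
    case (H h)
    then show ?thesis
      by (auto intro!: up.cartan_bracket[OF _ weight_vector_normal free.subspace_span K T_intros(2)] intro: free.span_base)
  next
    case (E x)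
    show ?thesis
    proof (cases i)
      case (Cartan h)
      then show ?thesis
        using up.hh_bracket_swap[OF gen_parts(2) ee_weight free.subspace_span K] T_intros(2)[of "Upper [] x"] E
        by simp
    next
      case (Upper ys y)
      then show ?thesis using T_intros(2)[of "Upper (x # ys) y"] E by simp
    next
      case (Lower ys y)
      then show ?thesis using up.e_word lower_in_T E by auto
    qed
  next
    case (F x)
    show ?thesis
    proof (cases i)
      case (Cartan h)
      then show ?thesis
        using up.hh_bracket_swap[OF gen_parts(3) ff_weight free.subspace_span K] T_intros(2)[of "Lower [] x"] F
        by simp
    next
      case (Lower ys y)
      then show ?thesis using T_intros(2)[of "Lower (x # ys) y"] F by simp
    next
      case (Upper ys y)
      then show ?thesis using down.e_word lower_in_T F by auto
    qed
  qed
  then have "K \<union> range normal \<subseteq> {t. free_bracket (free_gen g) t \<in> T}"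
    using K_bracket(2) T_intros(1) by auto
  then show ?thesis
    using free.span_minimal[OF _ subspace_bracket_right[OF free.subspace_span]] assms by blast
qed

text \<open>By Jacobi the adjoint action of a bracket is a combination of composed adjoint actions,
  so invariance of \<open>T\<close> passes from generators to all bracketed words. A word
  \<open>Br m n\<close> is then the action of \<open>m\<close> on \<open>n\<close>.\<close>

lemma T_UNIV: "u \<in> T"
proof (rule free_in_subspace[OF free.subspace_span])
  have hom: "Poly_Mapping.single m 1 \<in> free_part (hb_parity v) (magma_parity (hb_parity v) m)" for m
    by (simp add: free_part_def)
  have *: "free_bracket (Poly_Mapping.single m 1) t \<in> T" if "t \<in> T" for m t
    using that
  proof (induction m arbitrary: t)
    case (Gen g)
    then show ?case using gen_bracket_T[of t g] by (simp add: free_gen_def)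
  next
    case (Br m n)
    then show ?case
      using bracket_bracket_mem_left[OF free.subspace_span _ hom[of m] hom[of n], of "K \<union> range normal" t] T_intros(1)
      by (simp add: free_bracket_single subset_iff)
  qed
  fix m
  show "Poly_Mapping.single m 1 \<in> T"
  proof (induction m)
    case (Gen g)
    show ?case
      using T_intros(2)[of "Cartan _"] T_intros(2)[of "Upper [] _"] T_intros(2)[of "Lower [] _"]
      by (cases g) (simp_all add: free_gen_def)
  next
    case (Br m n)
    then show ?case using *[of "Poly_Mapping.single n 1" m] by (simp add: free_bracket_single)
  qed
qed

lemma weight_space_span:
  assumes "weight_vector \<beta> w"
  shows "w \<in> free.span (K \<union> normal ` {i. normal_weight i = \<beta>})"
  by (rule weight_vector_in_span[OF weight_vector_normal T_UNIV assms])

lemma weight_signs: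
  assumes "weight_vector \<beta> w" "w \<notin> K"
  shows "positive_at v \<beta> \<or> negative_at v \<beta>"
proof -
  \<comment> \<open>Without a normal form of weight \<beta>, the spanning set of that weight space
    would reduce to \<open>K\<close>.\<close>
  have "{i. normal_weight i = \<beta>} \<noteq> {}"
    using weight_space_span[OF assms(1)] assms(2) subspace_K free.span_eq_iff[of K] by (metis image_empty sup_bot_right)
  then obtain i where i: "\<beta> = normal_weight i" by auto
  show ?thesis
  proof (cases i)
    case (Cartan h)
    then show ?thesis using i by (auto simp: positive_at_def root_comb_def intro!: exI[of _ "\<lambda>_. 0"])
  next
    case (Upper ys x)
    then have "\<beta> = root_comb v (\<lambda>y. of_nat (count_list (x # ys) y))"
      using i word_weight_simple_root by auto
    then show ?thesis unfolding positive_at_def by blast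
  next
    case (Lower ys x)
    then have "\<beta> = root_comb v (\<lambda>y. - of_nat (count_list (x # ys) y))"
      using i word_weight_minus_simple_root by auto
    then show ?thesis unfolding negative_at_def by blast
  qed
qed

text \<open>The weight of a word counts its letters. Since simple roots are independent and a word
  has at least one letter, only a one-letter word has a weight
  \<open>\<plusminus>b(x)\<close>.\<close>

lemma normal_weight_eq_simple_root:
  "normal_weight i = simple_root v x \<Longrightarrow> i = Upper [] x"
  "normal_weight i = (\<lambda>h. - simple_root v x h) \<Longrightarrow> i = Lower [] x"
proof -
  note inj = root_comb_inject[OF root_datum, THEN fun_cong]
  have count: "z = x \<and> ys = []"
    if "\<And>y. of_nat (count_list (z # ys) y) = (if y = x then 1 else 0 :: complex)" for z ys
  proof -
    have "count_list (z # ys) y = (if y = x then 1 else 0)" for y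
      using that[of y] by (metis of_nat_eq_1_iff of_nat_eq_0_iff)
    then show ?thesis using count_list_eq_single by metis
  qed
  have sgn: False if "of_nat (count_list (z # ys) x) = - (1 :: complex)" for z ys
  proof -
    have "of_nat (count_list (z # ys) x + 1) = (0 :: complex)" using that by simp
    then show False by (simp only: of_nat_eq_0_iff)
  qed
  { assume "normal_weight i = simple_root v x"
    then have eq: "normal_weight i = root_comb v (\<lambda>y. if y = x then 1 else 0)"
      by (simp add: simple_root_as_comb)
    show "i = Upper [] x"
    proof (cases i)
      case (Cartan h)
      then have "root_comb v (\<lambda>y. 0) = root_comb v (\<lambda>y. if y = x then 1 else 0)"
        using eq by (simp add: root_comb_def)
      from inj[OF this, of x] show ?thesis by simp
    next
      case (Upper ys y)
      then have "root_comb v (\<lambda>z. of_nat (count_list (y # ys) z)) = root_comb v (\<lambda>y. if y = x then 1 else 0)"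
        using eq word_weight_simple_root by (metis normal_weight.simps(2))
      from count[OF inj[OF this]] show ?thesis using Upper by simp
    next
      case (Lower ys y)
      then have "root_comb v (\<lambda>z. - of_nat (count_list (y # ys) z)) = root_comb v (\<lambda>y. if y = x then 1 else 0)"
        using eq word_weight_minus_simple_root by (metis normal_weight.simps(3))
      from inj[OF this, of x] have "- of_nat (count_list (y # ys) x) = (1 :: complex)" by simp
      then show ?thesis using sgn by (metis minus_minus)
    qed }
  { assume "normal_weight i = (\<lambda>h. - simple_root v x h)"
    then have eq: "normal_weight i = root_comb v (\<lambda>y. - (if y = x then 1 else 0))"
      by (simp add: simple_root_as_comb root_comb_minus)
    show "i = Lower [] x"
    proof (cases i)
      case (Cartan h)
      then have "root_comb v (\<lambda>y. 0) = root_comb v (\<lambda>y. - (if y = x then 1 else 0))"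
        using eq by (simp add: root_comb_def)
      from inj[OF this, of x] show ?thesis by simp
    next
      case (Upper ys y)
      then have "root_comb v (\<lambda>z. of_nat (count_list (y # ys) z)) = root_comb v (\<lambda>y. - (if y = x then 1 else 0))"
        using eq word_weight_simple_root by (metis normal_weight.simps(2))
      from inj[OF this, of x] have "of_nat (count_list (y # ys) x) = - (1 :: complex)" by simp
      then show ?thesis using sgn by blast
    next
      case (Lower ys y)
      then have "root_comb v (\<lambda>z. - of_nat (count_list (y # ys) z)) = root_comb v (\<lambda>y. - (if y = x then 1 else 0))"
        using eq word_weight_minus_simple_root by (metis normal_weight.simps(3))
      from inj[OF this] have "of_nat (count_list (y # ys) z) = (if z = x then 1 else 0 :: complex)" for z
        by (metis neg_equal_iff_equal)
      from count[OF this] show ?thesis using Lower by simp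
    qed }
qed

lemma simple_weight_space:
  assumes "weight_vector (normal_weight i) w" "\<And>j. normal_weight j = normal_weight i \<Longrightarrow> j = i"
  shows "\<exists>c. w - free_scale c (normal i) \<in> K"
proof -
  have "{j. normal_weight j = normal_weight i} = {i}" using assms(2) by auto
  then have "w \<in> free.span (insert (normal i) K)"
    using weight_space_span[OF assms(1)] by simp
  then show ?thesis
    using free.span_breakdown_eq[of w "normal i" K] subspace_K by (simp add: free.span_eq_iff[THEN iffD2])
qed

lemma ee_weight_space: "weight_vector (simple_root v x) w \<Longrightarrow> \<exists>c. w - free_scale c (ee x) \<in> K"
  and ff_weight_space: "weight_vector (\<lambda>h. - simple_root v x h) w \<Longrightarrow> \<exists>c. w - free_scale c (ff x) \<in> K"
  using simple_weight_space[of "Upper [] x" w] simple_weight_space[of "Lower [] x" w]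
    normal_weight_eq_simple_root
  by (auto simp: word_weight_def)

lemma coroot_nonzero: "simple_coroot v x \<noteq> 0"
proof
  assume "simple_coroot v x = 0"
  then have "(\<Sum>y\<in>UNIV. scale (if y = x then 1 else 0) (simple_coroot v y)) = 0"
    by (intro sum.neutral) simp
  from simple_coroots_independent[OF root_datum this, of x] show False by simp
qed

text \<open>Otherwise \<open>[e, f]\<close>, which is the nonzero coroot modulo \<open>K\<close>,
  would lie in \<open>K\<close> as well.\<close>

lemma ee_notin_K: "ee x \<notin> K"
proof
  assume "ee x \<in> K"
  then have "hh (simple_coroot v x) \<in> K"
    using subspace_diff_mem'[OF subspace_K relations_K(7)] K_bracket(1) by blast
  then show False using nondegenerate coroot_nonzero by blast
qed

lemma hh_eq: "hh h - hh k \<in> K \<Longrightarrow> h = k"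
proof -
  assume "hh h - hh k \<in> K"
  moreover have "hh h - hh (h - k) - hh k \<in> K" using relations_K(1)[of "h - k" k] by simp
  ultimately have "(hh h - hh k) - (hh h - hh (h - k) - hh k) \<in> K" by (rule K_closed(3))
  then show ?thesis using nondegenerate[of "h - k"] by simp
qed

end

section \<open>From quotients of the half-baked superalgebra to ideals of the free one\<close>

context free_image
begin

lemma kernel_quotient:
  assumes "graded_ideal L I" "free_graded_ideal \<pi> kernel"
  shows "free_image.kernel (\<lambda>u. coset L I (\<rho> u)) = \<rho> -` I"
proof -
  interpret Q: free_image \<pi> "quotient L I" "\<lambda>u. coset L I (\<rho> u)"
    by (rule free_image_quotient[OF assms])
  show ?thesis
    using coset_eq_iff[OF assms, of _ 0] by (auto simp: Q.kernel_def)
qed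

end

lemma free_image_free_superalgebra: "free_image \<pi> (free_superalgebra \<pi>) id"
  by unfold_locales (simp_all add: free_superalgebra_def)

context
  fixes scale :: "complex \<Rightarrow> 'h::ab_group_add \<Rightarrow> 'h" and v :: "('x::finite, 'h) root_datum" and I
  assumes scale: "vector_space scale" and root_datum: "is_root_datum scale v"
    and I: "graded_ideal (half_baked scale v) I" and I_h: "{h. half_baked_h scale v h \<in> I} = {0}"
begin

definition half_baked_map :: "('x, 'h) hb_gen free \<Rightarrow> ('x, 'h) hb_gen free set"
  where "half_baked_map u = coset (free_superalgebra (hb_parity v)) (ideal_generated
    (free_superalgebra (hb_parity v)) (lie_relations (hb_parity v) \<union> hb_relations scale v)) u"

text \<open>The two successive quotients, by the relations and by \<open>I\<close>, become one
  quotient of the free superalgebra, whose kernel is the preimage of \<open>I\<close>.\<close>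

lemma half_baked_quotient:
  "free_image (hb_parity v) (quotient (half_baked scale v) I)
     (\<lambda>u. coset (half_baked scale v) I (half_baked_map u))"
  "half_baked_ideal scale v
     (free_image.kernel (\<lambda>u. coset (half_baked scale v) I (half_baked_map u)))"
proof -
  let ?F = "free_superalgebra (hb_parity v) :: ('x, 'h) hb_gen free superalgebra"
  let ?R = "lie_relations (hb_parity v) \<union> hb_relations scale v"
  let ?J = "ideal_generated ?F ?R"
  interpret F: free_image "hb_parity v" ?F id by (rule free_image_free_superalgebra)
  have "F.kernel = {0}" by (auto simp: F.kernel_def)
  then have F_kernel: "free_graded_ideal (hb_parity v) F.kernel"
    using free.subspace_0[OF subspace_free_part]
    by (auto simp: free_graded_ideal_iff)
  note J = free_graded_ideal_generated[of "hb_parity v" ?R]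
  have map: "half_baked_map = (\<lambda>u. coset ?F ?J (id u))" by (auto simp: half_baked_map_def)
  have hb: "half_baked scale v = quotient ?F ?J"
    by (simp add: half_baked_def presented_lie_superalgebra_def)
  interpret B: free_image "hb_parity v" "half_baked scale v" half_baked_map
    unfolding map hb by (rule F.free_image_quotient[OF J F_kernel])
  have B_kernel: "B.kernel = ?J"
    unfolding map using F.kernel_quotient[OF J F_kernel] by simp
  note BJ = J[folded B_kernel]
  show "free_image (hb_parity v) (quotient (half_baked scale v) I)
     (\<lambda>u. coset (half_baked scale v) I (half_baked_map u))"
    by (rule B.free_image_quotient[OF I BJ])
  let ?K = "half_baked_map -` I"
  have K: "free_image.kernel (\<lambda>u. coset (half_baked scale v) I (half_baked_map u)) = ?K"
    by (rule B.kernel_quotient[OF I BJ])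
  have ideal: "free_graded_ideal (hb_parity v) ?K"
    by (rule B.kernel_preimage[OF I BJ])
  then have "half_baked_map 0 \<in> I"
    using free.subspace_0 by (auto simp: free_graded_ideal_iff)
  then have "B.kernel \<subseteq> ?K" by (auto simp: B.kernel_def)
  then have rel: "?R \<subseteq> ?K"
    unfolding B_kernel by (rule order_trans[OF ideal_generated_superset])
  have "h = 0" if "half_baked_map (free_gen (H h)) \<in> I" for h
    using that I_h by (auto simp: half_baked_h_def presented_gen_def half_baked_map_def)
  then show "half_baked_ideal scale v
     (free_image.kernel (\<lambda>u. coset (half_baked scale v) I (half_baked_map u)))"
    unfolding K using scale root_datum ideal rel
    by (intro half_baked_ideal.intro lie_ideal.intro half_baked_ideal_axioms.intro) auto
qed

lemma half_baked_map_h: "half_baked_map (free_gen (H h)) = half_baked_h scale v h"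
  by (simp add: half_baked_h_def presented_gen_def half_baked_map_def)

end

section \<open>Isomorphisms that extend the identity of the Cartan space\<close>

locale half_baked_iso =
  S: free_image "hb_parity u" G \<rho> + s: half_baked_ideal scale u "free_image.kernel \<rho>" +
  S': free_image "hb_parity u'" G' \<rho>' + s': half_baked_ideal scale u' "free_image.kernel \<rho>'"
  for scale :: "complex \<Rightarrow> 'h::ab_group_add \<Rightarrow> 'h" and u u' :: "('x::finite, 'h) root_datum"
    and G :: "'k superalgebra" and G' :: "'l superalgebra" and \<rho> \<rho>' +
  fixes \<Phi>
  assumes iso: "superalgebra_iso G G' \<Phi>" and iso_h: "\<Phi> (\<rho> (free_gen (H h))) = \<rho>' (free_gen (H h))"
begin

text \<open>\<Phi> is not lifted to a map of free superalgebras. Instead a representative of each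
  image is chosen when needed, and the facts below do not depend on the choice.\<close>

lemma iso_image:
  obtains w' where "\<Phi> (\<rho> w) = \<rho>' w'"
proof -
  have "\<Phi> (\<rho> w) \<in> space G'"
    using iso S.space_image unfolding superalgebra_iso_def bij_betw_def by auto
  then show ?thesis using that S'.space_image by auto
qed

lemma iso_scale: "\<Phi> (\<rho> w) = \<rho>' w' \<Longrightarrow> \<Phi> (\<rho> (free_scale c w)) = \<rho>' (free_scale c w')"
  using iso unfolding superalgebra_iso_def
  by (metis S.scl_image S'.scl_image S.space_image rangeI)

lemma iso_bracket:
  "\<Phi> (\<rho> w) = \<rho>' w' \<Longrightarrow> \<Phi> (\<rho> z) = \<rho>' z' \<Longrightarrow> \<Phi> (\<rho> (free_bracket w z)) = \<rho>' (free_bracket w' z')"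
  using iso unfolding superalgebra_iso_def
  by (metis S.bracket_image S'.bracket_image S.space_image rangeI)

lemma iso_kernel: "\<Phi> (\<rho> w) = \<rho>' w' \<Longrightarrow> w' \<in> S'.kernel \<longleftrightarrow> w \<in> S.kernel"
proof -
  assume w: "\<Phi> (\<rho> w) = \<rho>' w'"
  obtain z where "\<Phi> (\<rho> 0) = \<rho>' z" using iso_image .
  \<comment> \<open>Preservation of zero is not among the clauses of
    \<open>superalgebra_iso\<close>; it follows from preservation of scalar multiples.\<close>
  from iso_scale[OF this, of 0] have 0: "\<Phi> (\<rho> 0) = \<rho>' 0" by simp
  have "inj_on \<Phi> (range \<rho>)"
    using iso S.space_image by (simp add: superalgebra_iso_def bij_betw_def)
  then have "\<Phi> (\<rho> w) = \<Phi> (\<rho> 0) \<longleftrightarrow> \<rho> w = \<rho> 0" by (auto dest: inj_onD)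
  then show ?thesis using w 0 by (simp add: S.kernel_def S'.kernel_def)
qed

text \<open>\<Phi> fixes the Cartan elements, hence commutes with their adjoint action.\<close>

lemma iso_weight:
  assumes "\<Phi> (\<rho> w) = \<rho>' w'" "s.weight_vector \<beta> w"
  shows "s'.weight_vector \<beta> w'"
  unfolding s'.weight_vector_def
proof
  fix h
  have "\<rho> (free_bracket (free_gen (H h)) w) = \<rho> (free_scale (\<beta> h) w)"
    using assms(2) by (simp add: s.weight_vector_def S.image_eq_iff)
  then have "\<rho>' (free_bracket (free_gen (H h)) w') = \<rho>' (free_scale (\<beta> h) w')"
    using iso_scale[OF assms(1), of "\<beta> h"] iso_bracket[OF iso_h assms(1)] by metis
  then show "free_bracket (free_gen (H h)) w' - free_scale (\<beta> h) w' \<in> S'.kernel"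
    by (simp add: S'.image_eq_iff)
qed

lemma simple_root_sign: "positive_at u' (simple_root u x) \<or> negative_at u' (simple_root u x)"
proof -
  obtain w where w: "\<Phi> (\<rho> (free_gen (E x))) = \<rho>' w" using iso_image .
  show ?thesis
    using s'.weight_signs[OF iso_weight[OF w s.ee_weight]] iso_kernel[OF w] s.ee_notin_K by blast
qed

text \<open>The weight spaces of \<open>\<plusminus>b(x)\<close> at \<open>u'\<close> are spanned by
  \<open>e\<close> and \<open>f\<close> at \<open>y\<close>. So \<Phi> sends the two generators at
  \<open>x\<close> to multiples \<open>c\<close> and \<open>d\<close> of these, and their bracket,
  the coroot, to \<open>c * d\<close> times the coroot at \<open>y\<close>.\<close>

lemma simple_root_match:
  assumes "simple_root u x = simple_root u' y"
  shows "parity u x = parity u' y" "\<exists>c. simple_coroot u x = scale c (simple_coroot u' y)"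
proof -
  obtain w where w: "\<Phi> (\<rho> (free_gen (E x))) = \<rho>' w" using iso_image .
  obtain z where z: "\<Phi> (\<rho> (free_gen (F x))) = \<rho>' z" using iso_image .
  obtain c where c: "w - free_scale c (free_gen (E y)) \<in> S'.kernel"
    using s'.ee_weight_space[of y w] iso_weight[OF w s.ee_weight] assms by auto
  obtain d where d: "z - free_scale d (free_gen (F y)) \<in> S'.kernel"
    using s'.ff_weight_space[of y z] iso_weight[OF z s.ff_weight] assms by auto
  have w': "\<Phi> (\<rho> (free_gen (E x))) = \<rho>' (free_scale c (free_gen (E y)))"
    and z': "\<Phi> (\<rho> (free_gen (F x))) = \<rho>' (free_scale d (free_gen (F y)))"
    using w z c d by (simp_all add: S'.image_eq_iff)
  have "\<rho> (free_bracket (free_gen (E x)) (free_gen (F x))) = \<rho> (free_gen (H (simple_coroot u x)))"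
    using s.relations_K(7) by (simp add: S.image_eq_iff)
  then have "\<rho>' (free_gen (H (simple_coroot u x))) =
    \<rho>' (free_scale (c * d) (free_bracket (free_gen (E y)) (free_gen (F y))))"
    using iso_bracket[OF w' z'] iso_h[of "simple_coroot u x"]
    by (simp add: free_bracket_scale_left free_bracket_scale_right mult.commute)
  also have "\<dots> = \<rho>' (free_scale (c * d) (free_gen (H (simple_coroot u' y))))"
    using s'.relations_K(7)[of y] by (metis S'.image_eq_iff S'.scl_image)
  also have "\<dots> = \<rho>' (free_gen (H (scale (c * d) (simple_coroot u' y))))"
    using s'.relations_K(2) S'.image_eq_iff by metis
  finally show "\<exists>c. simple_coroot u x = scale c (simple_coroot u' y)"
    using s'.hh_eq S'.image_eq_iff by metis
  \<comment> \<open>For the parities: the image of \<open>e\<close> is homogeneous of parity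
    \<open>parity u x\<close>, but also a nonzero multiple of a generator of parity
    \<open>parity u' y\<close>.\<close>
  have "\<rho> (free_gen (E x)) \<in> part G (parity u x)"
    using s.gen_parts(2) S.part_image by simp
  then have "\<Phi> (\<rho> (free_gen (E x))) \<in> part G' (parity u x)"
    using iso unfolding superalgebra_iso_def by blast
  then obtain t where t: "t \<in> free_part (hb_parity u') (parity u x)" "\<rho>' (free_scale c (free_gen (E y))) = \<rho>' t"
    using w' by (auto simp: S'.part_image)
  show "parity u x = parity u' y"
  proof (rule ccontr)
    assume "parity u x \<noteq> parity u' y"
    then have "free_scale c (free_gen (E y)) \<in> S'.kernel"
      using s'.homogeneous_diff_in_K[OF free.subspace_scale[OF subspace_free_part s'.gen_parts(2)] t(1)] t(2)
      by (auto simp: S'.image_eq_iff)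
    then show False using iso_kernel[OF w'] s.ee_notin_K by blast
  qed
qed

end

lemma admissible_arrow:
  assumes "vector_space scale" "admissible scale R" "u \<in> R" "u' \<in> R" "(u, id, u') \<in> groupoid_arrows scale"
    and "is_root_datum scale u" "is_root_datum scale u'"
  shows "positive_at u' (simple_root u x) \<or> negative_at u' (simple_root u x)"
    and "simple_root u x = simple_root u' y \<Longrightarrow> parity u x = parity u' y"
    and "simple_root u x = simple_root u' y \<Longrightarrow> \<exists>c. simple_coroot u x = scale c (simple_coroot u' y)"
proof -
  obtain I \<Phi> where I: "\<And>v. v \<in> R \<Longrightarrow> graded_ideal (half_baked scale v) (I v)"
      "\<And>v. v \<in> R \<Longrightarrow> {h. half_baked_h scale v h \<in> I v} = {0}"
    and \<Phi>: "superalgebra_iso (quotient (half_baked scale u) (I u)) (quotient (half_baked scale u') (I u')) \<Phi>"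
      "\<And>h. \<Phi> (coset (half_baked scale u) (I u) (half_baked_h scale u h)) =
             coset (half_baked scale u') (I u') (half_baked_h scale u' h)"
    using assms(2,3,5) unfolding admissible_def by (metis id_apply)
  note q = half_baked_quotient[OF assms(1,6) I[OF assms(3)]] and q' = half_baked_quotient[OF assms(1,7) I[OF assms(4)]]
  interpret half_baked_iso scale u u' "quotient (half_baked scale u) (I u)" "quotient (half_baked scale u') (I u')"
    "\<lambda>w. coset (half_baked scale u) (I u) (half_baked_map scale u w)"
    "\<lambda>w. coset (half_baked scale u') (I u') (half_baked_map scale u' w)" \<Phi>
    using \<Phi> by (intro half_baked_iso.intro half_baked_iso_axioms.intro q q')
      (simp_all add: half_baked_map_h[OF assms(1,6) I[OF assms(3)]] half_baked_map_h[OF assms(1,7) I[OF assms(4)]])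
  show "positive_at u' (simple_root u x) \<or> negative_at u' (simple_root u x)"
    by (rule simple_root_sign)
  show "simple_root u x = simple_root u' y \<Longrightarrow> parity u x = parity u' y"
    and "simple_root u x = simple_root u' y \<Longrightarrow> \<exists>c. simple_coroot u x = scale c (simple_coroot u' y)"
    by (rule simple_root_match; assumption)+
qed

section \<open>Reflexions\<close>

text \<open>With this coefficient and its dual, the anisotropic and isotropic formulas take one
  shape: add a multiple of the root or coroot of \<open>x\<close>. The value \<open>- 2\<close> at
  \<open>y = x\<close> produces the change of sign.\<close>

definition root_shift :: "('x, 'h) root_datum \<Rightarrow> 'x \<Rightarrow> 'x \<Rightarrow> complex"
  where "root_shift u x y =
    (if cartan u x x \<noteq> 0 then - (2 * cartan u x y / cartan u x x)
     else if y = x then - 2 else if cartan u x y = 0 then 0 else 1)"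

definition coroot_shift :: "('x, 'h) root_datum \<Rightarrow> 'x \<Rightarrow> 'x \<Rightarrow> complex"
  where "coroot_shift u x y =
    (if cartan u x x \<noteq> 0 then - (2 * cartan u y x / cartan u x x)
     else if y = x then - 2 else if cartan u x y = 0 then 0 else cartan u y x / cartan u x y)"

lemma shift_self [simp]: "root_shift u x x = - 2" "coroot_shift u x x = - 2"
  by (simp_all add: root_shift_def coroot_shift_def)

lemma simple_root_reflexion:
  "simple_root (reflexion scale x u) y = (\<lambda>h. simple_root u y h + root_shift u x y * simple_root u x h)"
  by (auto simp: reflexion_def root_shift_def)

lemma parity_reflexion:
  "parity (reflexion scale x u) y =
    (if cartan u x x = 0 \<and> y \<noteq> x \<and> cartan u x y \<noteq> 0 then 1 + parity u y else parity u y)"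
  by (auto simp: reflexion_def)

lemma is_root_datum_linear:
  assumes "is_root_datum scale u"
  shows "simple_root u x (h + k) = simple_root u x h + simple_root u x k"
    "simple_root u x (scale c h) = c * simple_root u x h"
  using assms by (simp_all add: is_root_datum_def Vector_Spaces.linear_iff)

lemma root_comb_reflexion:
  "root_comb (reflexion scale x u) c =
    root_comb u (\<lambda>y. c y + (if y = x then \<Sum>z\<in>UNIV. c z * root_shift u x z else 0))"
  unfolding root_comb_def simple_root_reflexion
  by (simp add: distrib_left distrib_right sum.distrib sum_distrib_right if_distrib[of "\<lambda>a. a * _"] mult.assoc
      cong: if_cong)

locale complex_vector_space = vector_space scale
  for scale :: "complex \<Rightarrow> 'h::ab_group_add \<Rightarrow> 'h"
begin

lemma simple_coroot_reflexion:
  "simple_coroot (reflexion scale x u) y = simple_coroot u y + scale (coroot_shift u x y) (simple_coroot u x)"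
proof -
  have "scale (- 2) h = - h - h" for h
    using scale_left_distrib[of "- 1" "- 1" h] by simp
  then show ?thesis by (auto simp: reflexion_def coroot_shift_def)
qed

lemma cartan_reflexion:
  assumes "is_root_datum scale u"
  shows "cartan (reflexion scale x u) y z = cartan u y z + root_shift u x z * cartan u y x
    + coroot_shift u x y * (cartan u x z + root_shift u x z * cartan u x x)"
  unfolding cartan_def simple_root_reflexion simple_coroot_reflexion
  by (simp add: is_root_datum_linear[OF assms] algebra_simps)

text \<open>Row and column of \<open>x\<close> change at most by a common sign, which cancels in
  both shifts; this is why a reflexion is an involution.\<close>

lemma cartan_reflexion_row:
  assumes "is_root_datum scale u"
  shows "cartan (reflexion scale x u) x y = (if cartan u x x = 0 then - cartan u x y else cartan u x y)"
    and "cartan (reflexion scale x u) y x = (if cartan u x x = 0 then - cartan u y x else cartan u y x)"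
  unfolding cartan_reflexion[OF assms]
  by (auto simp: root_shift_def coroot_shift_def)

lemma shift_reflexion:
  assumes "is_root_datum scale u"
  shows "root_shift (reflexion scale x u) x y = root_shift u x y"
    and "coroot_shift (reflexion scale x u) x y = coroot_shift u x y"
  by (simp_all add: root_shift_def coroot_shift_def cartan_reflexion_row[OF assms])

lemma reflexion_reflexion:
  assumes "is_root_datum scale u"
  shows "reflexion scale x (reflexion scale x u) = u"
proof (rule root_datum.equality)
  let ?u = "reflexion scale x u"
  show "simple_root (reflexion scale x ?u) = simple_root u"
    by (intro ext) (simp add: simple_root_reflexion shift_reflexion[OF assms] algebra_simps)
  show "simple_coroot (reflexion scale x ?u) = simple_coroot u"
  proof
    fix y
    have "scale c (simple_coroot u x + scale (- 2) (simple_coroot u x)) = - scale c (simple_coroot u x)" for c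
      using scale_left_distrib[of c "- (2 * c)" "simple_coroot u x"]
      by (simp add: scale_right_diff_distrib mult.commute)
    then show "simple_coroot (reflexion scale x ?u) y = simple_coroot u y"
      by (simp add: simple_coroot_reflexion shift_reflexion[OF assms])
  qed
  show "parity (reflexion scale x ?u) = parity u"
    by (intro ext) (auto simp: parity_reflexion cartan_reflexion_row[OF assms])
qed simp

lemma reflectable_reflexion:
  assumes "is_root_datum scale u" "reflectable u x"
  shows "reflectable (reflexion scale x u) x"
  using assms(2) unfolding reflectable_def cartan_reflexion_row[OF assms(1)]
  by (auto simp: parity_reflexion)

lemma is_root_datum_reflexion:
  assumes "is_root_datum scale u"
  shows "is_root_datum scale (reflexion scale x u)"
  unfolding is_root_datum_def
proof (intro conjI allI impI)
  fix y
  have "vector_space ((*) :: complex \<Rightarrow> complex \<Rightarrow> complex)"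
    by unfold_locales (simp_all add: algebra_simps)
  then show "Vector_Spaces.linear scale (*) (simple_root (reflexion scale x u) y)"
    using vector_space_axioms
    by (simp add: Vector_Spaces.linear_iff simple_root_reflexion is_root_datum_linear[OF assms] algebra_simps)
next
  fix c y
  assume "(\<Sum>y\<in>UNIV. scale (c y) (simple_coroot (reflexion scale x u) y)) = 0"
  moreover have "(\<Sum>y\<in>UNIV. scale (c y) (simple_coroot (reflexion scale x u) y)) =
    (\<Sum>y\<in>UNIV. scale (c y + (if y = x then \<Sum>z\<in>UNIV. c z * coroot_shift u x z else 0)) (simple_coroot u y))"
  proof -
    have "(\<Sum>y\<in>UNIV. scale (if y = x then d else 0) (simple_coroot u y)) = scale d (simple_coroot u x)" for d
      by (simp add: if_distrib[of "\<lambda>a. scale a _"] cong: if_cong)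
    then show ?thesis
      by (simp add: simple_coroot_reflexion scale_left_distrib scale_right_distrib sum.distrib scale_sum_left)
  qed
  ultimately have *: "c y + (if y = x then \<Sum>z\<in>UNIV. c z * coroot_shift u x z else 0) = 0" for y
    by (intro simple_coroots_independent[OF assms]) simp
  \<comment> \<open>Off \<open>x\<close> the coefficients are those of \<open>c\<close>, so they
    vanish; what remains at \<open>x\<close> is \<open>c x - 2 * c x\<close>.\<close>
  have c0: "c y = 0" if "y \<noteq> x" for y using *[of y] that by simp
  then have "(\<Sum>z\<in>UNIV. c z * coroot_shift u x z) = (\<Sum>z\<in>{x}. c z * coroot_shift u x z)"
    by (intro sum.mono_neutral_right) auto
  then show "c y = 0" using c0 *[of x] by (cases "y = x") auto
next
  fix c y
  assume "\<forall>h. (\<Sum>y\<in>UNIV. c y * simple_root (reflexion scale x u) y h) = 0"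
  then have "root_comb (reflexion scale x u) c = root_comb u (\<lambda>_. 0)"
    by (simp add: root_comb_def)
  from root_comb_inject[OF assms this[unfolded root_comb_reflexion]]
  have *: "c y + (if y = x then \<Sum>z\<in>UNIV. c z * root_shift u x z else 0) = 0" for y
    by (rule fun_cong)
  have c0: "c y = 0" if "y \<noteq> x" for y using *[of y] that by simp
  then have "(\<Sum>z\<in>UNIV. c z * root_shift u x z) = (\<Sum>z\<in>{x}. c z * root_shift u x z)"
    by (intro sum.mono_neutral_right) auto
  then show "c y = 0" using c0 *[of x] by (cases "y = x") auto
qed

end

section \<open>Signs of real roots\<close>

lemma Nats_minus_Nats: "(c :: complex) \<in> \<nat> \<Longrightarrow> - c \<in> \<nat> \<Longrightarrow> c = 0"
proof -
  assume "c \<in> \<nat>" "- c \<in> \<nat>"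
  then obtain m n where "c = of_nat m" "- c = of_nat n" by (auto elim!: Nats_cases)
  then have "of_nat (m + n) = (0 :: complex)" by (simp add: add_eq_0_iff)
  then have "m = 0" by (simp only: of_nat_eq_0_iff)
  then show ?thesis using \<open>c = of_nat m\<close> by simp
qed

lemma Nats_fun: "(\<forall>x. c x \<in> \<nat>) \<longleftrightarrow> (\<exists>n. c = (\<lambda>x. of_nat (n x)))"
  unfolding Nats_def image_def by (auto simp: fun_eq_iff choice_iff)

lemma positive_at_iff: "positive_at u \<beta> \<longleftrightarrow> (\<exists>c. (\<forall>x. c x \<in> \<nat>) \<and> \<beta> = root_comb u c)"
  unfolding positive_at_def Nats_fun by auto

lemma negative_at_iff: "negative_at u \<beta> \<longleftrightarrow> positive_at u (\<lambda>h. - \<beta> h)"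
proof -
  have "\<beta> = root_comb u (\<lambda>x. - of_nat (n x)) \<longleftrightarrow> (\<lambda>h. - \<beta> h) = root_comb u (\<lambda>x. of_nat (n x))" for n
    unfolding root_comb_minus[symmetric] by (auto simp: fun_eq_iff minus_equation_iff) (metis minus_minus)+
  then show ?thesis by (simp add: positive_at_def negative_at_def)
qed

lemma negative_at_minus: "negative_at u (\<lambda>h. - \<beta> h) \<longleftrightarrow> positive_at u \<beta>"
  by (simp add: negative_at_iff)

lemma positive_at_simple_root: "positive_at u (simple_root u x)"
  unfolding positive_at_iff by (intro exI[of _ "\<lambda>y. if y = x then 1 else 0"]) (simp add: simple_root_as_comb)

lemma positive_at_add: "positive_at u \<beta> \<Longrightarrow> positive_at u \<gamma> \<Longrightarrow> positive_at u (\<lambda>h. \<beta> h + \<gamma> h)"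
proof -
  assume "positive_at u \<beta>" "positive_at u \<gamma>"
  then obtain c d where "\<forall>x. c x \<in> \<nat>" "\<beta> = root_comb u c" "\<forall>x. d x \<in> \<nat>" "\<gamma> = root_comb u d"
    by (auto simp: positive_at_iff)
  then show ?thesis unfolding positive_at_iff
    by (intro exI[of _ "\<lambda>x. c x + d x"]) (simp add: root_comb_def distrib_right sum.distrib)
qed

lemma positive_at_scale: "c \<in> \<nat> \<Longrightarrow> positive_at u \<beta> \<Longrightarrow> positive_at u (\<lambda>h. c * \<beta> h)"
proof -
  assume c: "c \<in> \<nat>" and "positive_at u \<beta>"
  then obtain d where "\<forall>x. d x \<in> \<nat>" "\<beta> = root_comb u d"
    by (auto simp: positive_at_iff)
  then show ?thesis unfolding positive_at_iff using c
    by (intro exI[of _ "\<lambda>x. c * d x"]) (simp add: root_comb_def sum_distrib_left mult.assoc)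
qed

lemma positive_at_zero: "positive_at u (\<lambda>h. 0)"
  unfolding positive_at_iff by (intro exI[of _ "\<lambda>_. 0"]) (simp add: root_comb_def)

lemma positive_at_trans:
  assumes "\<And>z. positive_at w (simple_root u z)" "positive_at u \<beta>"
  shows "positive_at w \<beta>"
proof -
  obtain c where c: "\<forall>x. c x \<in> \<nat>" "\<beta> = root_comb u c" using assms(2) by (auto simp: positive_at_iff)
  have "positive_at w (\<lambda>h. \<Sum>x\<in>A. c x * simple_root u x h)" if "finite A" for A
    using that
    by (induction A rule: finite_induct)
      (simp_all add: positive_at_zero positive_at_add positive_at_scale c(1) assms(1))
  then show ?thesis by (simp add: c(2) root_comb_def)
qed

lemma signed_root_comb:
  assumes "positive_at u \<beta> \<or> negative_at u \<beta>"
  obtains k where "\<beta> = root_comb u k" "(\<forall>x. k x \<in> \<nat>) \<or> (\<forall>x. - k x \<in> \<nat>)"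
  using assms
proof
  assume "positive_at u \<beta>"
  then show thesis using that by (auto simp: positive_at_iff)
next
  assume "negative_at u \<beta>"
  then obtain n :: "'a \<Rightarrow> nat" where "\<beta> = root_comb u (\<lambda>x. - of_nat (n x))"
    by (auto simp: negative_at_def)
  then show thesis by (rule that) simp
qed

lemma root_comb_Nats:
  assumes "is_root_datum scale u"
  shows "positive_at u (root_comb u c) \<longleftrightarrow> (\<forall>x. c x \<in> \<nat>)"
    and "negative_at u (root_comb u c) \<longleftrightarrow> (\<forall>x. - c x \<in> \<nat>)"
proof -
  show *: "positive_at u (root_comb u c) \<longleftrightarrow> (\<forall>x. c x \<in> \<nat>)" for c
    unfolding positive_at_iff using root_comb_inject[OF assms] by metis
  show "negative_at u (root_comb u c) \<longleftrightarrow> (\<forall>x. - c x \<in> \<nat>)"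
    by (simp add: negative_at_iff root_comb_minus *)
qed

lemma positive_negative_zero:
  assumes "is_root_datum scale u" "positive_at u \<beta>" "negative_at u \<beta>"
  shows "\<beta> = (\<lambda>h. 0)"
proof -
  obtain c where c: "\<forall>x. c x \<in> \<nat>" "\<beta> = root_comb u c" using assms(2) by (auto simp: positive_at_iff)
  then have "\<forall>x. - c x \<in> \<nat>" using assms root_comb_Nats(2) by metis
  then have "c x = 0" for x using c Nats_minus_Nats by blast
  then show ?thesis by (simp add: c(2) root_comb_def)
qed

lemma simple_root_nonzero: "is_root_datum scale u \<Longrightarrow> simple_root u x \<noteq> (\<lambda>h. 0)"
proof
  assume u: "is_root_datum scale u" and "simple_root u x = (\<lambda>h. 0)"
  then have "root_comb u (\<lambda>y. if y = x then 1 else 0) = root_comb u (\<lambda>_. 0)"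
    by (simp add: root_comb_single root_comb_def)
  from fun_cong[OF root_comb_inject[OF u this], of x] show False by simp
qed

section \<open>The skeleton and its inversions\<close>

text \<open>The skeleton without the isomorphisms carried by arrows: all reflexions induce the
  identity, so nothing is lost, and induction over paths becomes direct.\<close>

inductive_set skeleton_of :: "(complex \<Rightarrow> 'h \<Rightarrow> 'h) \<Rightarrow> ('x, 'h::ab_group_add) root_datum \<Rightarrow> ('x, 'h) root_datum set"
  for scale v
  where
    base: "v \<in> skeleton_of scale v"
  | step: "u \<in> skeleton_of scale v \<Longrightarrow> reflectable u x \<Longrightarrow> reflexion scale x u \<in> skeleton_of scale v"

lemma skeleton_of_trans: "w \<in> skeleton_of scale u \<Longrightarrow> u \<in> skeleton_of scale v \<Longrightarrow> w \<in> skeleton_of scale v"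
  by (induction rule: skeleton_of.induct) (auto intro: skeleton_of.intros)

context complex_vector_space
begin

lemma skeleton_of_root_datum: "u \<in> skeleton_of scale v \<Longrightarrow> is_root_datum scale v \<Longrightarrow> is_root_datum scale u"
  by (induction rule: skeleton_of.induct) (auto intro: is_root_datum_reflexion)

lemma skeleton_of_sym: "u \<in> skeleton_of scale v \<Longrightarrow> is_root_datum scale v \<Longrightarrow> v \<in> skeleton_of scale u"
proof (induction rule: skeleton_of.induct)
  case base
  show ?case by (rule skeleton_of.base)
next
  case (step u x)
  have u: "is_root_datum scale u" by (rule skeleton_of_root_datum[OF step.hyps(1) step.prems])
  have "u \<in> skeleton_of scale (reflexion scale x u)"
    using skeleton_of.step[OF skeleton_of.base reflectable_reflexion[OF u step.hyps(2)], of scale]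
    by (simp add: reflexion_reflexion[OF u])
  then show ?case using step skeleton_of_trans by blast
qed

lemma skeleton_eq:
  assumes "is_root_datum scale v"
  shows "skeleton scale v = skeleton_of scale v"
proof (intro equalityI subsetI)
  fix u assume "u \<in> skeleton scale v"
  then obtain \<phi> where "(v, \<phi>, u) \<in> composites scale (reflexion_arrows scale)"
    by (auto simp: skeleton_def)
  then show "u \<in> skeleton_of scale v"
    by (induction "(v, \<phi>, u)" arbitrary: \<phi> u rule: composites.induct)
      (auto simp: identity_arrow_def reflexion_arrows_def reflexion_arrow_def intro: skeleton_of.intros)
next
  fix u assume "u \<in> skeleton_of scale v"
  then have "(v, id, u) \<in> composites scale (reflexion_arrows scale)"
  proof (induction rule: skeleton_of.induct)
    case base
    show ?case using composites.identity[OF assms] unfolding identity_arrow_def .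
  next
    case (step u x)
    have "(u, id, reflexion scale x u) \<in> reflexion_arrows scale"
      using skeleton_of_root_datum[OF step.hyps(1) assms] step.hyps(2)
      by (auto simp: reflexion_arrows_def reflexion_arrow_def)
    from composites.compose[OF step.IH this] show ?case by simp
  qed
  then show "u \<in> skeleton scale v" by (auto simp: skeleton_def)
qed

end

section \<open>Transport by linear automorphisms\<close>

lemma cartan_transport: "inj \<theta> \<Longrightarrow> cartan (transport \<theta> u) x y = cartan u x y"
  by (simp add: cartan_def transport_def)

lemma reflectable_transport: "inj \<theta> \<Longrightarrow> reflectable (transport \<theta> u) x \<longleftrightarrow> reflectable u x"
  unfolding reflectable_def by (simp add: cartan_transport) (simp add: transport_def)

lemma reflexion_transport:
  assumes "inj \<theta>" "\<And>h k. \<theta> (h + k) = \<theta> h + \<theta> k" "\<And>c h. \<theta> (scale c h) = scale c (\<theta> h)"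
  shows "reflexion scale x (transport \<theta> u) = transport \<theta> (reflexion scale x u)"
proof -
  have diff: "\<theta> (h - k) = \<theta> h - \<theta> k" for h k
    using assms(2)[of "h - k" k] by simp
  have minus: "\<theta> (- h) = - \<theta> h" for h
    using diff[of 0 h] diff[of h h] by simp
  show ?thesis
    unfolding reflexion_def cartan_transport[OF assms(1)]
    by (auto simp: transport_def fun_eq_iff assms(2,3) diff minus)
qed

text \<open>The interface between the two halves of the proof: superalgebras enter from here on only
  through \<open>sign\<close>, \<open>parity_match\<close> and \<open>coroot_match\<close>.\<close>

locale root_skeleton = complex_vector_space scale
  for scale :: "complex \<Rightarrow> 'h::ab_group_add \<Rightarrow> 'h" +
  fixes v :: "('x::finite, 'h) root_datum"
  assumes base: "is_root_datum scale v"
    and sign: "u \<in> skeleton_of scale v \<Longrightarrow> w \<in> skeleton_of scale v \<Longrightarrow>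
      positive_at w (simple_root u x) \<or> negative_at w (simple_root u x)"
    and parity_match: "u \<in> skeleton_of scale v \<Longrightarrow> w \<in> skeleton_of scale v \<Longrightarrow>
      simple_root u x = simple_root w y \<Longrightarrow> parity u x = parity w y"
    and coroot_match: "u \<in> skeleton_of scale v \<Longrightarrow> w \<in> skeleton_of scale v \<Longrightarrow>
      simple_root u x = simple_root w y \<Longrightarrow> \<exists>c. simple_coroot u x = scale c (simple_coroot w y)"
begin

abbreviation "S \<equiv> skeleton_of scale v"

lemma S_root_datum: "u \<in> S \<Longrightarrow> is_root_datum scale u"
  using skeleton_of_root_datum base by blast

lemma S_connected: "u \<in> S \<Longrightarrow> w \<in> S \<Longrightarrow> w \<in> skeleton_of scale u"
  using skeleton_of_sym[OF _ base] skeleton_of_trans by blast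

lemma comb_sign:
  assumes "u \<in> S" "w \<in> S" "simple_root w z = root_comb u c"
  shows "(\<forall>x. c x \<in> \<nat>) \<or> (\<forall>x. - c x \<in> \<nat>)"
  using sign[OF assms(2,1), of z] root_comb_Nats[OF S_root_datum[OF assms(1)], of c] assms(3) by metis

definition roots :: "('h \<Rightarrow> complex) set"
  where "roots = {simple_root u x | u x. u \<in> S}"

lemma roots_sign: "\<beta> \<in> roots \<Longrightarrow> u \<in> S \<Longrightarrow> positive_at u \<beta> \<or> negative_at u \<beta>"
  using sign by (auto simp: roots_def)

lemma not_positive_and_negative: "\<beta> \<in> roots \<Longrightarrow> u \<in> S \<Longrightarrow> positive_at u \<beta> \<Longrightarrow> negative_at u \<beta> \<Longrightarrow> False"
  using positive_negative_zero[OF S_root_datum] simple_root_nonzero[OF S_root_datum]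
  unfolding roots_def by blast

lemma simple_root_in_roots: "u \<in> S \<Longrightarrow> simple_root u x \<in> roots"
  by (auto simp: roots_def)

lemma simple_root_reflexion_self: "simple_root (reflexion scale x u) x = (\<lambda>h. - simple_root u x h)"
  by (simp add: simple_root_reflexion)

text \<open>A real root that is a multiple of a simple root equals it: it is part of a basis of the same lattice.\<close>

lemma reflexion_keeps_positive:
  assumes u: "u \<in> S" "reflectable u x" and \<beta>: "\<beta> \<in> roots" "positive_at u \<beta>" "\<beta> \<noteq> simple_root u x"
  shows "positive_at (reflexion scale x u) \<beta>"
proof (rule ccontr)
  let ?u = "reflexion scale x u"
  have S': "?u \<in> S" using u by (rule skeleton_of.step)
  obtain w z where w: "w \<in> S" "\<beta> = simple_root w z" using \<beta>(1) by (auto simp: roots_def)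
  obtain n where n: "\<forall>x. n x \<in> \<nat>" "\<beta> = root_comb u n" using \<beta>(2) by (auto simp: positive_at_iff)
  assume "\<not> positive_at ?u \<beta>"
  then have "negative_at ?u \<beta>" using roots_sign[OF \<beta>(1) S'] by blast
  then obtain m :: "'x \<Rightarrow> nat" where "\<beta> = root_comb ?u (\<lambda>x. - of_nat (m x))" by (auto simp: negative_at_def)
  \<comment> \<open>The reflexion alters only the coefficient at \<open>x\<close>, so every other
    coefficient of \<beta> is the same at both objects and has both signs.\<close>
  then have "n = (\<lambda>y. - of_nat (m y) + (if y = x then \<Sum>z\<in>UNIV. - of_nat (m z) * root_shift u x z else 0))"
    using root_comb_inject[OF S_root_datum[OF u(1)]] n(2) unfolding root_comb_reflexion by metis
  then have "n y = - of_nat (m y)" if "y \<noteq> x" for y using that by simp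
  then have "n y = 0" if "y \<noteq> x" for y using that n(1) Nats_minus_Nats[of "n y"] by (metis minus_minus of_nat_in_Nats)
  then have n_eq: "n = (\<lambda>y. if y = x then n x else 0)" by auto
  have \<beta>x: "\<beta> = (\<lambda>h. n x * simple_root u x h)"
    unfolding n(2) by (subst n_eq) (rule root_comb_single)
  obtain k where k: "simple_root u x = root_comb w k" "(\<forall>x. k x \<in> \<nat>) \<or> (\<forall>x. - k x \<in> \<nat>)"
    by (rule signed_root_comb[OF sign[OF u(1) w(1)]])
  have "root_comb w (\<lambda>y. if y = z then 1 else 0) = root_comb w (\<lambda>y. n x * k y)"
    using \<beta>x w(2) k(1) by (simp add: root_comb_single) (simp add: root_comb_def sum_distrib_left mult.assoc)
  \<comment> \<open>At \<open>w\<close> the root \<beta> is simple, so its own coefficient 1 factors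
    as \<open>n x\<close> times an integer. As \<open>n x\<close> is natural, it is 1.\<close>
  from fun_cong[OF root_comb_inject[OF S_root_datum[OF w(1)] this], of z] have nk: "n x * k z = 1" by simp
  obtain a where a: "n x = of_nat a" using n(1) by (metis Nats_cases)
  from k(2) have "k z \<in> \<nat>"
  proof
    assume "\<forall>x. - k x \<in> \<nat>"
    then have "n x * - k z \<in> \<nat>" using n(1) by (intro Nats_mult) auto
    then have "- 1 \<in> (\<nat> :: complex set)" using nk by simp
    then show ?thesis using Nats_minus_Nats[of 1] by simp
  qed simp
  then obtain b where b: "k z = of_nat b" by (metis Nats_cases)
  have "of_nat (a * b) = (1 :: complex)" using nk a b by simp
  then have "a = 1" by (simp only: of_nat_eq_1_iff nat_mult_eq_1_iff)
  then show False using \<beta>x \<beta>(3) a by simp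
qed

definition inversions :: "('x, 'h) root_datum \<Rightarrow> ('h \<Rightarrow> complex) set"
  where "inversions u = {\<beta> \<in> roots. positive_at u \<beta> \<and> negative_at v \<beta>}"

lemma inversions_base: "inversions v = {}"
  using not_positive_and_negative[OF _ skeleton_of.base] by (auto simp: inversions_def)

lemma v_sign_cases:
  assumes "u \<in> S"
  obtains "negative_at v (simple_root u x)" "\<not> positive_at v (simple_root u x)"
    | "positive_at v (simple_root u x)" "\<not> negative_at v (simple_root u x)"
  using sign[OF assms skeleton_of.base] not_positive_and_negative[OF simple_root_in_roots[OF assms] skeleton_of.base]
  by blast

text \<open>A reflexion changes the sign of no real roots but \<open>\<plusminus>b(x)\<close>.
  Applying \<open>reflexion_keeps_positive\<close> at \<open>u\<close> and, because the reflexion is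
  an involution, at its image gives the two inclusions.\<close>

lemma inversions_descent:
  assumes u: "u \<in> S" "reflectable u x" and neg: "negative_at v (simple_root u x)"
  shows "inversions (reflexion scale x u) = inversions u - {simple_root u x}"
proof -
  let ?u = "reflexion scale x u"
  have S': "?u \<in> S" using u by (rule skeleton_of.step)
  have inv: "reflexion scale x ?u = u" by (rule reflexion_reflexion[OF S_root_datum[OF u(1)]])
  have r: "reflectable ?u x" by (rule reflectable_reflexion[OF S_root_datum[OF u(1)] u(2)])
  have self: "simple_root ?u x = (\<lambda>h. - simple_root u x h)" by (rule simple_root_reflexion_self)
  have "positive_at u \<beta>" if "\<beta> \<in> roots" "positive_at ?u \<beta>" "negative_at v \<beta>" for \<beta>
  proof -
    have "positive_at v (simple_root ?u x)" using neg by (simp add: self negative_at_iff)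
    then have "\<beta> \<noteq> simple_root ?u x"
      using not_positive_and_negative[OF that(1) skeleton_of.base] that(3) by blast
    then show ?thesis using reflexion_keeps_positive[OF S' r that(1,2)] inv by simp
  qed
  moreover have "\<not> positive_at ?u (simple_root u x)"
    using not_positive_and_negative[OF simple_root_in_roots[OF u(1)] S'] positive_at_simple_root[of ?u x]
    by (auto simp: self negative_at_iff)
  ultimately show ?thesis
    using reflexion_keeps_positive[OF u] unfolding inversions_def by blast
qed

lemma inversions_ascent:
  assumes u: "u \<in> S" "reflectable u x" and pos: "positive_at v (simple_root u x)"
  shows "negative_at v (simple_root (reflexion scale x u) x)"
    and "inversions u = inversions (reflexion scale x u) - {simple_root (reflexion scale x u) x}"
proof -
  let ?u = "reflexion scale x u"
  show neg: "negative_at v (simple_root ?u x)"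
    using pos by (simp add: simple_root_reflexion_self negative_at_minus)
  show "inversions u = inversions ?u - {simple_root ?u x}"
    using inversions_descent[OF skeleton_of.step[OF u] reflectable_reflexion[OF S_root_datum[OF u(1)] u(2)] neg]
    by (simp add: reflexion_reflexion[OF S_root_datum[OF u(1)]])
qed

lemma finite_inversions: "u \<in> S \<Longrightarrow> finite (inversions u)"
proof (induction rule: skeleton_of.induct)
  case base
  then show ?case by (simp add: inversions_base)
next
  case (step u x)
  show ?case
    using v_sign_cases[OF step.hyps(1), of x]
  proof cases
    case 1
    then show ?thesis using inversions_descent[OF step.hyps] step.IH by simp
  next
    case 2
    then show ?thesis using inversions_ascent(2)[OF step.hyps] step.IH by (metis finite_Diff2 finite.emptyI finite_insert)
  qed
qed

text \<open>Along the path an inversion can only appear as the simple root at \<open>x\<close> just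
  after \<open>r_x\<close>. There the object is reflectable at \<open>x\<close>, since the step can
  be undone.\<close>

lemma inversion_reflected:
  assumes "u \<in> S" "\<beta> \<in> inversions u"
  shows "\<exists>w\<in>S. \<exists>z. reflectable w z \<and> simple_root w z = \<beta>"
  using assms
proof (induction rule: skeleton_of.induct)
  case base
  then show ?case by (simp add: inversions_base)
next
  case (step u x)
  let ?u = "reflexion scale x u"
  show ?case
  proof (cases "\<beta> = simple_root ?u x")
    case True
    then show ?thesis
      using skeleton_of.step[OF step.hyps] reflectable_reflexion[OF S_root_datum[OF step.hyps(1)] step.hyps(2)] by blast
  next
    case False
    then have "\<beta> \<in> inversions u"
      using reflexion_keeps_positive[OF skeleton_of.step[OF step.hyps]
          reflectable_reflexion[OF S_root_datum[OF step.hyps(1)] step.hyps(2)], of \<beta>] step.prems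
      by (simp add: inversions_def reflexion_reflexion[OF S_root_datum[OF step.hyps(1)]])
    then show ?thesis by (rule step.IH)
  qed
qed

text \<open>For anisotropic \<open>z\<close> the reflexion at \<open>w\<close> is the transport by a linear reflection \<open>\<theta>\<close>, so \<open>\<theta>\<close>
  permutes the skeleton.\<close>

lemma anisotropic_transport:
  assumes w: "w \<in> S" "reflectable w z" "cartan w z z \<noteq> 0"
    and u: "u \<in> S"
  defines "\<theta> \<equiv> \<lambda>h. h - scale (2 * simple_root w z h / cartan w z z) (simple_coroot w z)"
  shows "transport \<theta> u \<in> S"
    and "simple_root (transport \<theta> u) t = (\<lambda>h. simple_root u t h
      - 2 * simple_root u t (simple_coroot w z) / cartan w z z * simple_root w z h)"
proof -
  note lin = is_root_datum_linear[OF S_root_datum]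
  have zero: "simple_root u t 0 = 0" if "u \<in> S" for u t
    using lin(1)[OF that, where h=0 and k=0 and x=t] by simp
  have sub: "simple_root u t (h - k) = simple_root u t h - simple_root u t k" if "u \<in> S" for u t h k
    using lin(1)[OF that, where h="h - k" and k=k and x=t] by simp
  have \<theta>_add: "\<theta> (h + k) = \<theta> h + \<theta> k" for h k
    by (simp add: \<theta>_def lin[OF w(1)] distrib_left add_divide_distrib scale_left_distrib)
  have \<theta>_scale: "\<theta> (scale c h) = scale c (\<theta> h)" for c h
    by (simp add: \<theta>_def lin[OF w(1)] scale_right_diff_distrib mult_ac)
  have wz: "simple_root w z (simple_coroot w z) = cartan w z z" by (simp add: cartan_def)
  \<comment> \<open>\<theta> negates this root, so it is an involution; this identifies the
    \<open>inv \<theta>\<close> occurring in \<open>transport\<close>.\<close>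
  have w\<theta>: "simple_root w z (\<theta> h) = - simple_root w z h" for h
    using w(3) by (simp add: \<theta>_def sub[OF w(1)] lin[OF w(1)] wz)
  have \<theta>\<theta>: "\<theta> (\<theta> h) = h" for h
  proof -
    have "\<theta> (\<theta> h) = \<theta> h - scale (2 * simple_root w z (\<theta> h) / cartan w z z) (simple_coroot w z)"
      by (simp add: \<theta>_def)
    then show ?thesis unfolding w\<theta> by (simp add: \<theta>_def)
  qed
  then have inj: "inj \<theta>" by (metis injI)
  have inv: "inv \<theta> = \<theta>" by (intro inv_unique_comp) (simp_all add: fun_eq_iff \<theta>\<theta>)
  have root: "simple_root (transport \<theta> u) t = (\<lambda>h. simple_root u t h
      - 2 * simple_root u t (simple_coroot w z) / cartan w z z * simple_root w z h)"
    if "u \<in> S" for u t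
    by (simp add: transport_def inv fun_eq_iff) (simp add: \<theta>_def sub[OF that] lin[OF that] mult_ac)
  then show "simple_root (transport \<theta> u) t = (\<lambda>h. simple_root u t h
      - 2 * simple_root u t (simple_coroot w z) / cartan w z z * simple_root w z h)"
    using u .
  have "transport \<theta> w = reflexion scale z w"
  proof (rule root_datum.equality)
    show "simple_root (transport \<theta> w) = simple_root (reflexion scale z w)"
      using w(3) by (simp add: root[OF w(1)] fun_eq_iff reflexion_def) (simp add: cartan_def)
    show "simple_coroot (transport \<theta> w) = simple_coroot (reflexion scale z w)"
      using w(3) by (simp add: transport_def fun_eq_iff reflexion_def \<theta>_def) (simp add: cartan_def)
    show "parity (transport \<theta> w) = parity (reflexion scale z w)"
      using w(3) by (simp add: transport_def reflexion_def)
  qed simp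
  then have w': "transport \<theta> w \<in> S" using skeleton_of.step[OF w(1,2)] by simp
  \<comment> \<open>The induction starts at \<open>w\<close> rather than \<open>v\<close>, because
    the transport of \<open>w\<close> is already known to be in the skeleton; transport commutes
    with the further reflexions.\<close>
  from S_connected[OF w(1) u] show "transport \<theta> u \<in> S"
  proof (induction rule: skeleton_of.induct)
    case base
    then show ?case by (rule w')
  next
    case (step u x)
    then show ?case
      using skeleton_of.step[of "transport \<theta> u" scale v x]
      by (simp add: reflectable_transport[OF inj] reflexion_transport[where scale = scale, OF inj \<theta>_add \<theta>_scale])
  qed
qed

text \<open>Parity and the line of the coroot agree at \<open>u\<close> and \<open>w\<close>, which
  settles the isotropic case. In the anisotropic case the linear reflection at \<open>w\<close>
  sends simple roots of \<open>u\<close> to real roots, whose signs at \<open>u\<close> bound the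
  Cartan entries.\<close>

lemma reflectable_match:
  assumes u: "u \<in> S" and w: "w \<in> S" "reflectable w z" and eq: "simple_root u y = simple_root w z"
  shows "reflectable u y"
proof -
  have p: "parity u y = parity w z" by (rule parity_match[OF u w(1) eq])
  obtain c where c: "simple_coroot u y = scale c (simple_coroot w z)" using coroot_match[OF u w(1) eq] by blast
  have cartan_u: "cartan u y t = c * simple_root u t (simple_coroot w z)" for t
    by (simp add: cartan_def c is_root_datum_linear[OF S_root_datum[OF u]])
  have c0: "c \<noteq> 0"
  proof
    assume "c = 0"
    then have "(\<Sum>t\<in>UNIV. scale (if t = y then 1 else 0) (simple_coroot u t)) = 0"
      using c by (intro sum.neutral) simp
    from simple_coroots_independent[OF S_root_datum[OF u] this, of y] show False by simp
  qed
  have cartan_yy: "cartan u y y = c * cartan w z z"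
    using cartan_u[of y] by (simp add: eq cartan_def)
  have isotropic: "parity u y = 1" if "cartan u y y = 0"
    using that w(2) p c0 by (simp add: reflectable_def cartan_yy)
  define \<kappa> where "\<kappa> t = 2 * cartan u y t / cartan u y y" for t
  have \<kappa>: "- \<kappa> t \<in> \<nat>" if a: "cartan u y y \<noteq> 0" and "t \<noteq> y" for t
  proof -
    have wz: "cartan w z z \<noteq> 0" using a cartan_yy by auto
    obtain u' where u': "u' \<in> S" "simple_root u' t = (\<lambda>h. simple_root u t h
      - 2 * simple_root u t (simple_coroot w z) / cartan w z z * simple_root w z h)"
      using anisotropic_transport[OF w wz u] by blast
    have "2 * simple_root u t (simple_coroot w z) / cartan w z z = \<kappa> t"
      using c0 by (simp add: \<kappa>_def cartan_u cartan_yy[unfolded cartan_u])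
    then have "simple_root u' t = (\<lambda>h. simple_root u t h - \<kappa> t * simple_root u y h)"
      using u'(2) eq by simp
    also have "\<dots> = root_comb u (\<lambda>s. (if s = t then 1 else 0) - (if s = y then \<kappa> t else 0))"
      using fun_cong[OF root_comb_single[of u t 1]] fun_cong[OF root_comb_single[of u y "\<kappa> t"]]
      by (simp add: root_comb_def fun_eq_iff left_diff_distrib sum_subtractf)
    \<comment> \<open>The reflected root has coefficient 1 at \<open>t\<close>, so it is positive,
      and its coefficient \<open>- \<kappa> t\<close> at \<open>y\<close> is natural.\<close>
    finally have "(\<forall>s. (if s = t then 1 else 0) - (if s = y then \<kappa> t else 0) \<in> \<nat>) \<or>
      (\<forall>s. - ((if s = t then 1 else 0) - (if s = y then \<kappa> t else 0)) \<in> \<nat>)"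
      by (rule comb_sign[OF u u'(1)])
    then show ?thesis
    proof
      assume "\<forall>s. - ((if s = t then 1 else 0) - (if s = y then \<kappa> t else 0)) \<in> \<nat>"
      from this[rule_format, of t] have "- 1 \<in> (\<nat> :: complex set)" using that by simp
      then show ?thesis using Nats_minus_Nats[of 1] by simp
    next
      assume "\<forall>s. (if s = t then 1 else 0) - (if s = y then \<kappa> t else 0) \<in> \<nat>"
      from this[rule_format, of y] show ?thesis using that by simp
    qed
  qed
  \<comment> \<open>An odd root needs half of \<open>\<kappa> t\<close> to be an integer. The halved
    entries at \<open>w\<close> are integers by reflectability, and the root of \<open>t\<close> is
    an integral combination of the simple roots of \<open>w\<close>.\<close>
  have odd: "cartan u y t / cartan u y y \<in> \<int>\<^sub>\<le>\<^sub>0" if a: "cartan u y y \<noteq> 0" "parity u y = 1" and t: "t \<noteq> y" for t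
  proof -
    have wz: "cartan w z z \<noteq> 0" using a cartan_yy by auto
    have row: "cartan w z s / cartan w z z \<in> \<int>" for s
      using w(2) wz a(2) p nonpos_Ints_Int by (cases "s = z") (auto simp: reflectable_def)
    obtain k where k: "simple_root u t = root_comb w k" "(\<forall>x. k x \<in> \<nat>) \<or> (\<forall>x. - k x \<in> \<nat>)"
      by (rule signed_root_comb[OF sign[OF u w(1)]])
    have k_int: "k s \<in> \<int>" for s using k(2) by (metis Nats_subset_Ints Ints_minus minus_minus subsetD)
    have "cartan u y t / cartan u y y = simple_root u t (simple_coroot w z) / cartan w z z"
      using c0 by (simp add: cartan_u cartan_yy[unfolded cartan_u])
    also have "\<dots> = (\<Sum>s\<in>UNIV. k s * (cartan w z s / cartan w z z))"
      by (simp add: k(1) root_comb_def sum_divide_distrib cartan_def)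
    also have "\<dots> \<in> \<int>" using k_int row by (intro Ints_sum Ints_mult)
    finally obtain i where i: "cartan u y t / cartan u y y = of_int i" by (auto elim: Ints_cases)
    obtain n where "- \<kappa> t = of_nat n" using \<kappa>[OF a(1) t] by (metis Nats_cases)
    moreover have "\<kappa> t = 2 * of_int i" by (simp add: \<kappa>_def flip: i)
    ultimately have "of_int (- 2 * i) = (of_int (int n) :: complex)" by simp
    then have "i \<le> 0" by (simp only: of_int_eq_iff)
    then show ?thesis unfolding i by (rule nonpos_Ints_of_int)
  qed
  show ?thesis
    unfolding reflectable_def using isotropic \<kappa> odd by (auto simp: \<kappa>_def uminus_in_Nats_iff)
qed

lemma descent_reflectable:
  assumes "u \<in> S" "negative_at v (simple_root u x)"
  shows "reflectable u x"
proof -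
  have "simple_root u x \<in> inversions u"
    using assms positive_at_simple_root simple_root_in_roots by (auto simp: inversions_def)
  then obtain w z where "w \<in> S" "reflectable w z" "simple_root w z = simple_root u x"
    using inversion_reflected[OF assms(1)] by blast
  then show ?thesis using reflectable_match[OF assms(1), of w z x] by simp
qed

end

section \<open>Confluence of descents\<close>

definition coroot_comb :: "(complex \<Rightarrow> 'h \<Rightarrow> 'h) \<Rightarrow> ('x::finite, 'h::ab_group_add) root_datum \<Rightarrow> ('x \<Rightarrow> complex) \<Rightarrow> 'h"
  where "coroot_comb scale u c = (\<Sum>x\<in>UNIV. scale (c x) (simple_coroot u x))"

lemma root_comb_add: "root_comb u (\<lambda>x. c x + d x) = (\<lambda>h. root_comb u c h + root_comb u d h)"
  by (simp add: root_comb_def distrib_right sum.distrib)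

lemma root_comb_scale: "root_comb u (\<lambda>x. k * c x) = (\<lambda>h. k * root_comb u c h)"
  by (simp add: root_comb_def sum_distrib_left mult.assoc)

lemma root_comb_pair:
  assumes "x \<noteq> y" "\<And>z. z \<noteq> x \<Longrightarrow> z \<noteq> y \<Longrightarrow> c z = 0"
  shows "root_comb u c = (\<lambda>h. c x * simple_root u x h + c y * simple_root u y h)"
proof
  fix h
  have "root_comb u c h = (\<Sum>z\<in>{x, y}. c z * simple_root u z h)"
    unfolding root_comb_def using assms(2) by (intro sum.mono_neutral_right) auto
  then show "root_comb u c h = c x * simple_root u x h + c y * simple_root u y h"
    using assms(1) by simp
qed

lemma root_comb_comb:
  assumes "\<And>z. simple_root w z = root_comb u (M z)"
  shows "root_comb w c = root_comb u (\<lambda>i. \<Sum>z\<in>UNIV. c z * M z i)"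
proof
  fix h
  have "root_comb w c h = (\<Sum>z\<in>UNIV. \<Sum>i\<in>UNIV. c z * M z i * simple_root u i h)"
    unfolding root_comb_def[of w] assms by (simp add: root_comb_def sum_distrib_left mult.assoc)
  also have "\<dots> = root_comb u (\<lambda>i. \<Sum>z\<in>UNIV. c z * M z i) h"
    unfolding root_comb_def sum_distrib_right by (rule sum.swap)
  finally show "root_comb w c h = root_comb u (\<lambda>i. \<Sum>z\<in>UNIV. c z * M z i) h" .
qed

context complex_vector_space
begin

lemma coroot_comb_add: "coroot_comb scale u (\<lambda>x. c x + d x) = coroot_comb scale u c + coroot_comb scale u d"
  by (simp add: coroot_comb_def scale_left_distrib sum.distrib)

lemma coroot_comb_scale: "coroot_comb scale u (\<lambda>x. k * c x) = scale k (coroot_comb scale u c)"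
  by (simp add: coroot_comb_def scale_sum_right)

lemma coroot_comb_inject:
  assumes "is_root_datum scale u" "coroot_comb scale u c = coroot_comb scale u d"
  shows "c x = d x"
proof -
  have "(\<Sum>x\<in>UNIV. scale (c x - d x) (simple_coroot u x)) = 0"
    using assms(2) by (simp add: coroot_comb_def scale_left_diff_distrib sum_subtractf)
  from simple_coroots_independent[OF assms(1) this, of x] show ?thesis by simp
qed

text \<open>Roots and coroots, once rescaled by \<open>d\<close>, are shifted by the same amounts in
  both kinds of reflexion.\<close>

lemma shift_symmetrizable:
  assumes "d z * cartan w j z = d j * cartan w z j"
  shows "d z * root_shift w j z = d j * coroot_shift w j z"
proof (cases "cartan w j j = 0")
  case False
  then show ?thesis using assms by (simp add: root_shift_def coroot_shift_def field_simps)
next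
  case True
  then show ?thesis using assms by (auto simp: root_shift_def coroot_shift_def field_simps)
qed

text \<open>In the expansion of a reflected entry, transposition fixes the first and last terms and
  exchanges the other two, up to the factors of \<open>d\<close> and exchange of the two shifts.
  Hence \<open>d\<close> itself stays a symmetrizer.\<close>

lemma symmetrizable_reflexion:
  assumes w: "is_root_datum scale w"
    and sym: "\<And>i k. i \<in> I \<Longrightarrow> k \<in> I \<Longrightarrow> d k * cartan w i k = d i * cartan w k i"
    and I: "j \<in> I" "i \<in> I" "k \<in> I"
  shows "d k * cartan (reflexion scale j w) i k = d i * cartan (reflexion scale j w) k i"
proof -
  let ?r = "root_shift w j" and ?c = "coroot_shift w j" and ?a = "cartan w"
  have s: "d z * ?r z = d j * ?c z" if "z \<in> I" for z
    by (rule shift_symmetrizable[OF sym[OF I(1) that]])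
  have 1: "d k * ?a i k = d i * ?a k i" by (rule sym[OF I(2,3)])
  have 2: "d k * (?r k * ?a i j) = d i * (?c k * ?a j i)"
  proof -
    have "d k * (?r k * ?a i j) = d k * ?r k * ?a i j" by simp
    also have "\<dots> = ?c k * (d j * ?a i j)" unfolding s[OF I(3)] by simp
    also have "\<dots> = d i * (?c k * ?a j i)" unfolding sym[OF I(2,1)] by simp
    finally show ?thesis .
  qed
  have 3: "d k * (?c i * ?a j k) = d i * (?r i * ?a k j)"
  proof -
    have "d k * (?c i * ?a j k) = ?c i * (d k * ?a j k)" by simp
    also have "\<dots> = d j * ?c i * ?a k j" unfolding sym[OF I(1,3)] by simp
    also have "\<dots> = d i * (?r i * ?a k j)" unfolding s[OF I(2), symmetric] by simp
    finally show ?thesis .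
  qed
  have 4: "d k * (?c i * (?r k * ?a j j)) = d i * (?c k * (?r i * ?a j j))"
  proof -
    have "d k * (?c i * (?r k * ?a j j)) = d k * ?r k * (?c i * ?a j j)" by simp
    also have "\<dots> = d j * ?c i * (?c k * ?a j j)" unfolding s[OF I(3)] by simp
    also have "\<dots> = d i * (?c k * (?r i * ?a j j))" unfolding s[OF I(2), symmetric] by simp
    finally show ?thesis .
  qed
  show ?thesis
    unfolding cartan_reflexion[OF w] using 1 2 3 4 by (simp add: distrib_left)
qed

end

section \<open>Alternating walks\<close>

primrec walk :: "(complex \<Rightarrow> 'h \<Rightarrow> 'h) \<Rightarrow> (nat \<Rightarrow> 'x) \<Rightarrow> ('x, 'h::ab_group_add) root_datum \<Rightarrow> nat \<Rightarrow> ('x, 'h) root_datum"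
  where
    "walk scale l u 0 = u"
  | "walk scale l u (Suc k) = reflexion scale (l k) (walk scale l u k)"

definition alternating :: "'x \<Rightarrow> 'x \<Rightarrow> nat \<Rightarrow> 'x"
  where "alternating x y k = (if even k then x else y)"

lemma alternating_simps [simp]: "alternating x y 0 = x" "alternating x y (Suc k) = alternating y x k"
  by (simp_all add: alternating_def)

lemma alternating_cases: "alternating x y k = x \<and> alternating y x k = y \<or> alternating x y k = y \<and> alternating y x k = x"
  by (simp add: alternating_def)

text \<open>A two by two matrix of natural numbers with an inverse of the same kind is a permutation
  matrix.\<close>

lemma inverse_nat_matrices:
  fixes a b a' b' e f e' f' :: nat
  assumes "e * a + f * a' = 1" "e * b + f * b' = 0" "e' * a + f' * a' = 0" "e' * b + f' * b' = 1"
  shows "a = 1 \<and> b = 0 \<and> a' = 0 \<and> b' = 1 \<or> a = 0 \<and> b = 1 \<and> a' = 1 \<and> b' = 0"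
  using assms by (auto simp: add_is_1)

context root_skeleton
begin

definition descent :: "('x, 'h) root_datum \<Rightarrow> ('x, 'h) root_datum \<Rightarrow> bool"
  where "descent u u' \<longleftrightarrow> u \<in> S \<and> (\<exists>x. negative_at v (simple_root u x) \<and> u' = reflexion scale x u)"

lemma descentI: "u \<in> S \<Longrightarrow> negative_at v (simple_root u x) \<Longrightarrow> descent u (reflexion scale x u)"
  by (auto simp: descent_def)

lemma reflexion_descent:
  assumes "u \<in> S" "negative_at v (simple_root u x)"
  shows "reflexion scale x u \<in> S"
    and "inversions (reflexion scale x u) = inversions u - {simple_root u x}"
    and "simple_root u x \<in> inversions u"
    and "Suc (card (inversions (reflexion scale x u))) = card (inversions u)"
proof -
  note r = descent_reflectable[OF assms]
  show "reflexion scale x u \<in> S" using skeleton_of.step[OF assms(1) r] .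
  show i: "inversions (reflexion scale x u) = inversions u - {simple_root u x}"
    by (rule inversions_descent[OF assms(1) r assms(2)])
  show m: "simple_root u x \<in> inversions u"
    using assms simple_root_in_roots positive_at_simple_root by (auto simp: inversions_def)
  show "Suc (card (inversions (reflexion scale x u))) = card (inversions u)"
    unfolding i by (rule card_Suc_Diff1[OF finite_inversions[OF assms(1)] m])
qed

lemma descent_card: "descent u u' \<Longrightarrow> u' \<in> S \<and> card (inversions u') < card (inversions u)"
  using reflexion_descent(1,4) unfolding descent_def by (metis lessI)

lemma descents_S: "descent\<^sup>*\<^sup>* u w \<Longrightarrow> u \<in> S \<Longrightarrow> w \<in> S"
  by (induction rule: rtranclp_induct) (auto dest: descent_card)

lemma no_inversions_descent: "inversions u = {} \<Longrightarrow> \<not> descent u u'"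
  using reflexion_descent(3) by (auto simp: descent_def)

text \<open>If all simple roots of \<open>u\<close> were positive at \<open>v\<close>, every root
  positive at \<open>u\<close> would be.\<close>

lemma inversions_exists_descent:
  assumes "u \<in> S" "inversions u \<noteq> {}"
  shows "\<exists>x. negative_at v (simple_root u x)"
proof (rule ccontr)
  assume "\<not> ?thesis"
  then have pos: "positive_at v (simple_root u x)" for x
    using sign[OF assms(1) skeleton_of.base] by blast
  obtain \<beta> where "\<beta> \<in> inversions u" using assms by blast
  then show False
    using positive_at_trans[OF pos] not_positive_and_negative[OF _ skeleton_of.base, of \<beta>]
    unfolding inversions_def by blast
qed

lemma exists_bottom: "u \<in> S \<Longrightarrow> \<exists>t. descent\<^sup>*\<^sup>* u t \<and> inversions t = {}"
proof (induction "card (inversions u)" arbitrary: u rule: less_induct)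
  case less
  show ?case
  proof (cases "inversions u = {}")
    case False
    then obtain x where x: "descent u (reflexion scale x u)"
      using inversions_exists_descent[OF less.prems] descentI[OF less.prems] by blast
    then obtain t where "descent\<^sup>*\<^sup>* (reflexion scale x u) t" "inversions t = {}"
      using less.hyps descent_card by blast
    then show ?thesis using x by (meson converse_rtranclp_into_rtranclp)
  qed auto
qed

text \<open>The root of \<open>x\<close> after \<open>r_y\<close> is \<open>b(x) + s b(y)\<close>.
  Its sign at \<open>u\<close> forces \<open>s \<ge> 0\<close>, and its sign after
  \<open>r_x\<close> forces \<open>s \<le> 0\<close>.\<close>

lemma cartan_zero_sym:
  assumes u: "u \<in> S" and xy: "x \<noteq> y" and r: "reflectable u x" "reflectable u y" and zero: "cartan u x y = 0"
  shows "cartan u y x = 0"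
proof -
  let ?s = "root_shift u y x"
  let ?u = "reflexion scale x u" and ?w = "reflexion scale y u"
  have S: "?u \<in> S" "?w \<in> S" using skeleton_of.step[OF u] r by auto
  have shift0: "root_shift u x y = 0" using zero xy by (simp add: root_shift_def)
  define c where "c a z = (if z = x then a else if z = y then ?s else 0)" for a z
  have "simple_root ?w x = root_comb u (c 1)"
    using xy by (subst root_comb_pair[of x y]) (simp_all add: c_def simple_root_reflexion)
  from comb_sign[OF u S(2) this] have s1: "?s \<in> \<nat>"
    using Nats_minus_Nats[of 1] xy by (auto simp: c_def dest: spec[of _ x] spec[of _ y])
  \<comment> \<open>Since \<open>cartan u x y = 0\<close>, \<open>r_x\<close> fixes the root of
    \<open>y\<close>; only the coefficient of \<open>x\<close> changes sign.\<close>
  have "simple_root ?w x = root_comb ?u (c (- 1))"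
    using xy by (subst root_comb_pair[of x y]) (simp_all add: c_def simple_root_reflexion shift0)
  from comb_sign[OF S this] have s2: "- ?s \<in> \<nat>"
    using Nats_minus_Nats[of 1] xy by (auto simp: c_def dest: spec[of _ x] spec[of _ y])
  have "?s = 0" using Nats_minus_Nats[OF s1 s2] .
  then show ?thesis using xy by (auto simp: root_shift_def split: if_splits)
qed

text \<open>\<open>related d u I w\<close> holds for \<open>w\<close> reached from \<open>u\<close> by reflexions with letters in \<open>I\<close>: on the span
  of the roots of \<open>I\<close>, the map \<open>b(i) \<mapsto> a(i) / d(i)\<close> is the same for \<open>u\<close> and \<open>w\<close>.\<close>

definition related :: "('x \<Rightarrow> complex) \<Rightarrow> ('x, 'h) root_datum \<Rightarrow> 'x set \<Rightarrow> ('x, 'h) root_datum \<Rightarrow> bool"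
  where "related d u I w \<longleftrightarrow> w \<in> S \<and>
    (\<forall>i\<in>I. \<forall>k\<in>I. d k * cartan w i k = d i * cartan w k i) \<and>
    (\<forall>z\<in>I. \<exists>m. (\<forall>i. i \<notin> I \<longrightarrow> m i = 0) \<and> simple_root w z = root_comb u m \<and>
      simple_coroot w z = scale (d z) (coroot_comb scale u (\<lambda>i. m i / d i))) \<and>
    (\<forall>z. z \<notin> I \<longrightarrow> (\<exists>m m'. (\<forall>i. i \<notin> I \<longrightarrow> m i = 0 \<and> m' i = 0) \<and>
      simple_root w z = root_comb u (\<lambda>i. (if i = z then 1 else 0) + m i) \<and>
      simple_coroot w z = coroot_comb scale u (\<lambda>i. (if i = z then 1 else 0) + m' i)))"

lemma related_inner:
  assumes "related d u I w" "z \<in> I"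
  obtains m where "\<And>i. i \<notin> I \<Longrightarrow> m i = 0" "simple_root w z = root_comb u m"
    "simple_coroot w z = scale (d z) (coroot_comb scale u (\<lambda>i. m i / d i))"
  using assms unfolding related_def by blast

lemma related_outer:
  assumes "related d u I w" "z \<notin> I"
  obtains m m' where "\<And>i. i \<notin> I \<Longrightarrow> m i = 0 \<and> m' i = 0"
    "simple_root w z = root_comb u (\<lambda>i. (if i = z then 1 else 0) + m i)"
    "simple_coroot w z = coroot_comb scale u (\<lambda>i. (if i = z then 1 else 0) + m' i)"
  using assms unfolding related_def by blast

lemma coroot_comb_single: "coroot_comb scale u (\<lambda>i. if i = z then c else 0) = scale c (simple_coroot u z)"
  by (simp add: coroot_comb_def if_distrib[of "\<lambda>a. scale a _"] cong: if_cong)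

lemma related_refl:
  assumes "u \<in> S" "\<And>i. d i \<noteq> 0"
    and "\<And>i k. i \<in> I \<Longrightarrow> k \<in> I \<Longrightarrow> d k * cartan u i k = d i * cartan u k i"
  shows "related d u I u"
proof -
  have "\<exists>m. (\<forall>i. i \<notin> I \<longrightarrow> m i = 0) \<and> simple_root u z = root_comb u m \<and>
      simple_coroot u z = scale (d z) (coroot_comb scale u (\<lambda>i. m i / d i))" if "z \<in> I" for z
  proof (intro exI conjI)
    show "\<forall>i. i \<notin> I \<longrightarrow> (if i = z then 1 else 0) = (0 :: complex)" using that by auto
    show "simple_root u z = root_comb u (\<lambda>i. if i = z then 1 else 0)" by (rule simple_root_as_comb)
    have "(\<lambda>i. (if i = z then 1 else 0) / d i) = (\<lambda>i. if i = z then 1 / d z else 0)" by auto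
    then show "simple_coroot u z = scale (d z) (coroot_comb scale u (\<lambda>i. (if i = z then 1 else 0) / d i))"
      using assms(2) by (simp add: coroot_comb_single)
  qed
  moreover have "\<exists>m m'. (\<forall>i. i \<notin> I \<longrightarrow> m i = 0 \<and> m' i = 0) \<and>
      simple_root u z = root_comb u (\<lambda>i. (if i = z then 1 else 0) + m i) \<and>
      simple_coroot u z = coroot_comb scale u (\<lambda>i. (if i = z then 1 else 0) + m' i)" for z
    by (intro exI[of _ "\<lambda>_. 0"]) (simp add: simple_root_as_comb[of u z] coroot_comb_single)
  ultimately show ?thesis unfolding related_def using assms by simp
qed

text \<open>Inside \<open>I\<close> the symmetrizer moves root and coroot coefficients in parallel.
  Outside \<open>I\<close> it gives no control, and what persists is the coefficient 1 at
  \<open>z\<close>.\<close>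

lemma related_reflexion:
  assumes d: "\<And>i. d i \<noteq> 0" and rel: "related d u I w" and j: "j \<in> I" "reflectable w j"
  shows "related d u I (reflexion scale j w)"
proof -
  let ?w = "reflexion scale j w" and ?r = "root_shift w j" and ?c = "coroot_shift w j"
  have w: "w \<in> S" and sym: "\<And>i k. i \<in> I \<Longrightarrow> k \<in> I \<Longrightarrow> d k * cartan w i k = d i * cartan w k i"
    using rel unfolding related_def by blast+
  obtain mj where mj: "\<And>i. i \<notin> I \<Longrightarrow> mj i = 0" "simple_root w j = root_comb u mj"
    "simple_coroot w j = scale (d j) (coroot_comb scale u (\<lambda>i. mj i / d i))"
    by (rule related_inner[OF rel j(1)]) blast
  have "\<exists>m. (\<forall>i. i \<notin> I \<longrightarrow> m i = 0) \<and> simple_root ?w z = root_comb u m \<and>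
      simple_coroot ?w z = scale (d z) (coroot_comb scale u (\<lambda>i. m i / d i))" if z: "z \<in> I" for z
  proof -
    obtain m where m: "\<And>i. i \<notin> I \<Longrightarrow> m i = 0" "simple_root w z = root_comb u m"
      "simple_coroot w z = scale (d z) (coroot_comb scale u (\<lambda>i. m i / d i))"
      by (rule related_inner[OF rel z]) blast
    have s: "?c z * d j = d z * ?r z"
      using shift_symmetrizable[OF sym[OF j(1) z]] by (simp add: mult.commute)
    have "(\<lambda>i. (m i + ?r z * mj i) / d i) = (\<lambda>i. m i / d i + ?r z * (mj i / d i))"
      by (simp add: add_divide_distrib)
    then have "simple_coroot ?w z = scale (d z) (coroot_comb scale u (\<lambda>i. (m i + ?r z * mj i) / d i))"
      unfolding simple_coroot_reflexion m(3) mj(3)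
      by (simp only: coroot_comb_add coroot_comb_scale scale_right_distrib scale_scale s)
    moreover have "simple_root ?w z = root_comb u (\<lambda>i. m i + ?r z * mj i)"
      by (simp add: simple_root_reflexion m(2) mj(2) root_comb_add root_comb_scale)
    ultimately show ?thesis using m(1) mj(1) by (intro exI[of _ "\<lambda>i. m i + ?r z * mj i"]) simp
  qed
  moreover have "\<exists>m m'. (\<forall>i. i \<notin> I \<longrightarrow> m i = 0 \<and> m' i = 0) \<and>
      simple_root ?w z = root_comb u (\<lambda>i. (if i = z then 1 else 0) + m i) \<and>
      simple_coroot ?w z = coroot_comb scale u (\<lambda>i. (if i = z then 1 else 0) + m' i)" if z: "z \<notin> I" for z
  proof -
    let ?\<delta> = "\<lambda>i. if i = z then 1 else 0 :: complex"
    obtain m m' where m: "\<And>i. i \<notin> I \<Longrightarrow> m i = 0 \<and> m' i = 0"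
      "simple_root w z = root_comb u (\<lambda>i. ?\<delta> i + m i)"
      "simple_coroot w z = coroot_comb scale u (\<lambda>i. ?\<delta> i + m' i)"
      by (rule related_outer[OF rel z]) blast
    have "simple_root ?w z = root_comb u (\<lambda>i. ?\<delta> i + (m i + ?r z * mj i))"
      unfolding simple_root_reflexion m(2) mj(2) add.assoc[symmetric]
      by (simp only: root_comb_add root_comb_scale)
    moreover have "simple_coroot ?w z = coroot_comb scale u (\<lambda>i. ?\<delta> i + (m' i + (?c z * d j) * (mj i / d i)))"
      unfolding simple_coroot_reflexion m(3) mj(3) add.assoc[symmetric]
      by (simp only: coroot_comb_add coroot_comb_scale scale_scale)
    ultimately show ?thesis using m(1) mj(1)
      by (intro exI[of _ "\<lambda>i. m i + ?r z * mj i"] exI[of _ "\<lambda>i. m' i + (?c z * d j) * (mj i / d i)"] conjI) auto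
  qed
  moreover have "?w \<in> S" by (rule skeleton_of.step[OF w j(2)])
  moreover have "d k * cartan ?w i k = d i * cartan ?w k i" if "i \<in> I" "k \<in> I" for i k
    by (rule symmetrizable_reflexion[where I = I, OF S_root_datum[OF w] sym j(1) that])
  ultimately show ?thesis unfolding related_def by blast
qed

text \<open>A nonnegative row of the base change would make a root positive at \<open>v\<close> a
  sum of roots negative at \<open>v\<close>. So on \<open>x\<close> and \<open>y\<close> the base
  change and its inverse are both nonpositive, and their negatives are permutation matrices.\<close>

lemma related_opposite:
  assumes u: "u \<in> S" and xy: "x \<noteq> y" and rel: "related d u {x, y} w"
    and neg: "negative_at v (simple_root u x)" "negative_at v (simple_root u y)"
    and pos: "positive_at v (simple_root w x)" "positive_at v (simple_root w y)"
  shows "simple_root w x = (\<lambda>h. - simple_root u x h) \<and> simple_root w y = (\<lambda>h. - simple_root u y h) \<or>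
    simple_root w x = (\<lambda>h. - simple_root u y h) \<and> simple_root w y = (\<lambda>h. - simple_root u x h)"
proof -
  have w: "w \<in> S" using rel by (simp add: related_def)
  have "\<forall>z. \<exists>m. simple_root w z = root_comb u m \<and>
    (\<forall>i. i \<notin> {x, y} \<longrightarrow> m i = (if i = z then 1 else 0))"
  proof
    fix z
    show "\<exists>m. simple_root w z = root_comb u m \<and> (\<forall>i. i \<notin> {x, y} \<longrightarrow> m i = (if i = z then 1 else 0))"
    proof (cases "z \<in> {x, y}")
      case True
      obtain m where "\<And>i. i \<notin> {x, y} \<Longrightarrow> m i = 0" "simple_root w z = root_comb u m"
        by (rule related_inner[OF rel True]) blast
      then show ?thesis using True by (intro exI[of _ m]) auto
    next
      case False
      obtain m where "\<And>i. i \<notin> {x, y} \<Longrightarrow> m i = 0"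
        "simple_root w z = root_comb u (\<lambda>i. (if i = z then 1 else 0) + m i)"
        using related_outer[OF rel False] by metis
      then show ?thesis by (intro exI[of _ "\<lambda>i. (if i = z then 1 else 0) + m i"]) auto
    qed
  qed
  \<comment> \<open>The base change from \<open>u\<close> to \<open>w\<close>; its columns outside
    \<open>x\<close> and \<open>y\<close> are those of the identity.\<close>
  then obtain M where M: "\<And>z. simple_root w z = root_comb u (M z)"
    "\<And>z i. i \<notin> {x, y} \<Longrightarrow> M z i = (if i = z then 1 else 0)" by metis
  have M_pair: "simple_root w z = (\<lambda>h. M z x * simple_root u x h + M z y * simple_root u y h)" if "z \<in> {x, y}" for z
    unfolding M(1) using M(2) that by (intro root_comb_pair[OF xy]) auto
  have M_neg: "- M z x \<in> \<nat>" "- M z y \<in> \<nat>" if z: "z \<in> {x, y}" for z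
  proof -
    have "\<not> (\<forall>i. M z i \<in> \<nat>)"
    proof
      assume N: "\<forall>i. M z i \<in> \<nat>"
      have "positive_at v (\<lambda>h. M z x * - simple_root u x h + M z y * - simple_root u y h)"
        using neg N by (intro positive_at_add positive_at_scale) (auto simp: negative_at_iff)
      then have "negative_at v (simple_root w z)" unfolding M_pair[OF z] by (simp add: negative_at_iff)
      then show False
        using pos z not_positive_and_negative[OF simple_root_in_roots[OF w] skeleton_of.base] by blast
    qed
    then show "- M z x \<in> \<nat>" "- M z y \<in> \<nat>" using comb_sign[OF u w M(1)] by blast+
  qed
  \<comment> \<open>Row \<open>t\<close> of the inverse, with signs reversed. Both coordinates
    \<open>i\<close> and \<open>i'\<close> are asked for at once, so that they share
    \<open>e\<close> and \<open>f\<close>.\<close>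
  have coeffs: "\<exists>e f :: nat. (of_nat e * - M x i + of_nat f * - M y i = (if i = t then 1 else 0 :: complex)) \<and>
      (of_nat e * - M x i' + of_nat f * - M y i' = (if i' = t then 1 else 0 :: complex))"
    if t: "t \<in> {x, y}" and ii': "i \<in> {x, y}" "i' \<in> {x, y}" for t i i'
  proof -
    obtain c where c: "simple_root u t = root_comb w c" "(\<forall>z. c z \<in> \<nat>) \<or> (\<forall>z. - c z \<in> \<nat>)"
      by (rule signed_root_comb[OF sign[OF u w]])
    have "root_comb u (\<lambda>i. if i = t then 1 else 0) = root_comb u (\<lambda>i. \<Sum>z\<in>UNIV. c z * M z i)"
      using c(1) root_comb_comb[OF M(1)] simple_root_as_comb by metis
    from fun_cong[OF root_comb_inject[OF S_root_datum[OF u] this]]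
    have cM: "(\<Sum>z\<in>UNIV. c z * M z i) = (if i = t then 1 else 0)" for i by simp
    \<comment> \<open>Column \<open>i\<close> of \<open>M\<close> is a unit column, so comparing
      coefficients at \<open>i\<close> isolates \<open>c i\<close>.\<close>
    have c_out: "c i = 0" if "i \<notin> {x, y}" for i
    proof -
      have "(\<Sum>z\<in>UNIV. c z * M z i) = (\<Sum>z\<in>UNIV. c z * (if i = z then 1 else 0))"
        by (simp only: M(2)[OF that])
      also have "\<dots> = c i" by (simp add: if_distrib cong: if_cong)
      finally show ?thesis using cM[of i] that t by auto
    qed
    have "\<not> (\<forall>z. c z \<in> \<nat>)"
    proof
      assume "\<forall>z. c z \<in> \<nat>"
      then have "positive_at v (\<lambda>h. c x * simple_root w x h + c y * simple_root w y h)"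
        using pos by (intro positive_at_add positive_at_scale) auto
      moreover have "simple_root u t = (\<lambda>h. c x * simple_root w x h + c y * simple_root w y h)"
        unfolding c(1) using c_out by (intro root_comb_pair[OF xy]) auto
      ultimately have "positive_at v (simple_root u t)" by (simp only:)
      then show False
        using neg t not_positive_and_negative[OF simple_root_in_roots[OF u] skeleton_of.base, of t] by auto
    qed
    then have "- c x \<in> \<nat>" "- c y \<in> \<nat>" using c(2) by blast+
    then obtain e f where ef: "- c x = of_nat e" "- c y = of_nat f" by (metis Nats_cases)
    have "(\<Sum>z\<in>UNIV. c z * M z i) = c x * M x i + c y * M y i" for i
    proof -
      have "(\<Sum>z\<in>UNIV. c z * M z i) = (\<Sum>z\<in>{x, y}. c z * M z i)"
        using c_out by (intro sum.mono_neutral_right) auto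
      then show ?thesis using xy by simp
    qed
    then have "of_nat e * - M x i + of_nat f * - M y i = (if i = t then 1 else 0)" for i
      using cM[of i] by (simp flip: ef)
    then show ?thesis by blast
  qed
  obtain a b a' b' where ab: "- M x x = of_nat a" "- M x y = of_nat b" "- M y x = of_nat a'" "- M y y = of_nat b'"
    using M_neg by (metis Nats_cases insertCI)
  obtain e f e' f' where
    "of_nat e * of_nat a + of_nat f * of_nat a' = (1 :: complex)"
    "of_nat e * of_nat b + of_nat f * of_nat b' = (0 :: complex)"
    "of_nat e' * of_nat a + of_nat f' * of_nat a' = (0 :: complex)"
    "of_nat e' * of_nat b + of_nat f' * of_nat b' = (1 :: complex)"
    using coeffs[of x x y] coeffs[of y x y] xy unfolding ab by auto
  then have nat: "e * a + f * a' = 1" "e * b + f * b' = 0" "e' * a + f' * a' = 0" "e' * b + f' * b' = 1"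
    by (simp_all only: of_nat_mult[symmetric] of_nat_add[symmetric] of_nat_eq_1_iff of_nat_eq_0_iff)
  have M_eq: "M x x = - of_nat a" "M x y = - of_nat b" "M y x = - of_nat a'" "M y y = - of_nat b'"
    using ab by (simp_all add: minus_equation_iff)
  show ?thesis
    using inverse_nat_matrices[OF nat] M_pair[of x] M_pair[of y] unfolding M_eq by auto
qed

text \<open>Seen from \<open>w\<close>, the root of \<open>z\<close> at \<open>w'\<close> has
  coefficient 1 at \<open>z\<close>, hence is positive. Its coefficients at \<open>i\<close> and
  \<open>j\<close> are the differences \<open>m - m'\<close>, the sign being reversed because the
  roots of \<open>i\<close> and \<open>j\<close> are opposite to those of \<open>u\<close>.\<close>

lemma opposite_outer_root:
  assumes u: "u \<in> S" and w: "w \<in> S" "w' \<in> S"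
    and ij: "i \<noteq> j" "z \<noteq> i" "z \<noteq> j"
    and opp: "simple_root w i = (\<lambda>h. - simple_root u x h)" "simple_root w j = (\<lambda>h. - simple_root u y h)"
    and xy: "x \<noteq> y" "\<And>t. t \<noteq> x \<Longrightarrow> t \<noteq> y \<Longrightarrow> m t = 0 \<and> m' t = 0"
    and z: "simple_root w z = root_comb u (\<lambda>t. (if t = z then 1 else 0) + m t)"
      "simple_root w' z = root_comb u (\<lambda>t. (if t = z then 1 else 0) + m' t)"
  shows "m x - m' x \<in> \<nat>" "m y - m' y \<in> \<nat>"
proof -
  define c where "c t = (if t = z then 0 else if t = i then m x - m' x else if t = j then m y - m' y else 0)" for t
  have pair: "root_comb u n = (\<lambda>h. n x * simple_root u x h + n y * simple_root u y h)"
    if "\<And>t. t \<noteq> x \<Longrightarrow> t \<noteq> y \<Longrightarrow> n t = 0" for n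
    using that by (rule root_comb_pair[OF xy(1)])
  have "root_comb w (\<lambda>t. (if t = z then 1 else 0) + c t)
      = (\<lambda>h. simple_root w z h + (c i * simple_root w i h + c j * simple_root w j h))"
    unfolding root_comb_add
    by (subst root_comb_pair[OF ij(1), of c]) (simp_all add: c_def simple_root_as_comb[of w z])
  also have "\<dots> = simple_root w' z"
    unfolding z root_comb_add opp using xy(2) ij
    by (subst pair[of m], simp, subst pair[of m'], simp) (simp add: c_def algebra_simps)
  finally have "simple_root w' z = root_comb w (\<lambda>t. (if t = z then 1 else 0) + c t)" by simp
  from comb_sign[OF w this]
  have "\<forall>t. (if t = z then 1 else 0) + c t \<in> \<nat>"
  proof
    assume "\<forall>t. - ((if t = z then 1 else 0) + c t) \<in> \<nat>"
    from this[rule_format, of z] show ?thesis using Nats_minus_Nats[of 1] by (simp add: c_def)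
  qed
  from this[rule_format, of i] this[rule_format, of j] have "c i \<in> \<nat>" "c j \<in> \<nat>" using ij by simp_all
  then show "m x - m' x \<in> \<nat>" "m y - m' y \<in> \<nat>" using ij by (simp_all add: c_def)
qed

end

section \<open>The alternating walk down from an object with two descents\<close>

locale rank_two = root_skeleton scale v
  for scale :: "complex \<Rightarrow> 'h::ab_group_add \<Rightarrow> 'h" and v :: "('x::finite, 'h) root_datum" +
  fixes u x y d
  assumes u: "u \<in> skeleton_of scale v" and xy: "x \<noteq> y"
    and neg_x: "negative_at v (simple_root u x)" and neg_y: "negative_at v (simple_root u y)"
    and d: "d i \<noteq> 0" and d_sym: "d y * cartan u x y = d x * cartan u y x"
begin

abbreviation "l \<equiv> alternating x y"
abbreviation "W \<equiv> walk scale l u"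

lemma letters: "l k \<in> {x, y}"
  by (simp add: alternating_def)

text \<open>Besides counting steps, this records that \<open>simple_root u x\<close>, reflected in
  the first step, never becomes an inversion again; that later decides which root is reflected
  last.\<close>

lemma walk_descends:
  assumes "\<And>i. i < k \<Longrightarrow> negative_at v (simple_root (W i) (l i))"
  shows "related d u {x, y} (W k) \<and> card (inversions (W k)) + k = card (inversions u) \<and>
    inversions (W k) \<subseteq> inversions u \<and>
    (k > 0 \<longrightarrow> descent\<^sup>*\<^sup>* (reflexion scale x u) (W k) \<and> simple_root u x \<notin> inversions (W k))"
  using assms
proof (induction k)
  case 0
  have "related d u {x, y} u"
    using d_sym by (intro related_refl[OF u d]) auto
  then show ?case by simp
next
  case (Suc k)
  then have IH: "related d u {x, y} (W k)" "card (inversions (W k)) + k = card (inversions u)"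
    "inversions (W k) \<subseteq> inversions u"
    "k > 0 \<longrightarrow> descent\<^sup>*\<^sup>* (reflexion scale x u) (W k) \<and> simple_root u x \<notin> inversions (W k)" by simp_all
  have S: "W k \<in> S" using IH(1) by (simp add: related_def)
  have neg: "negative_at v (simple_root (W k) (l k))" using Suc.prems by simp
  note desc = reflexion_descent[OF S neg]
  have "related d u {x, y} (W (Suc k))"
    using related_reflexion[OF d IH(1) letters descent_reflectable[OF S neg]] by simp
  moreover have "descent\<^sup>*\<^sup>* (reflexion scale x u) (W (Suc k)) \<and> simple_root u x \<notin> inversions (W (Suc k))"
    using IH(4) descentI[OF S neg] desc(2) by (cases k) (auto intro: rtranclp.rtrancl_into_rtrancl)
  ultimately show ?case using desc(2,4) IH(2,3) by auto
qed

lemma bottom: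
  obtains k w where "k > 0" "related d u {x, y} w" "card (inversions w) + k = card (inversions u)"
    "descent\<^sup>*\<^sup>* (reflexion scale x u) w"
    "simple_root w (alternating y x k) = (\<lambda>h. - simple_root u y h)"
    "simple_root w (alternating x y k) = (\<lambda>h. - simple_root u x h)"
proof -
  let ?P = "\<lambda>k. negative_at v (simple_root (W k) (l k))"
  \<comment> \<open>Each step removes one of finitely many inversions, so the walk stops.\<close>
  have "\<exists>k. \<not> ?P k"
  proof (rule ccontr)
    assume "\<not> ?thesis"
    then have "card (inversions (W k)) + k = card (inversions u)" for k using walk_descends by blast
    from this[of "Suc (card (inversions u))"] show False by simp
  qed
  then obtain k where k: "\<not> ?P k" "\<And>i. i < k \<Longrightarrow> ?P i"
    using exists_least_iff[of "\<lambda>k. \<not> ?P k"] by auto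
  have "k \<noteq> 0"
  proof
    assume "k = 0"
    then show False using k(1) neg_x by simp
  qed
  then obtain k' where k': "k = Suc k'" using not0_implies_Suc by blast
  note wk = walk_descends[of k, OF k(2)]
  have wk': "related d u {x, y} (W k')" "inversions (W k') \<subseteq> inversions u"
    "k' > 0 \<longrightarrow> simple_root u x \<notin> inversions (W k')"
    using walk_descends[of k'] k(2) k' by simp_all
  have S: "W k \<in> S" "W k' \<in> S" using wk wk'(1) by (simp_all add: related_def)
  have last: "simple_root (W k) (l k') = (\<lambda>h. - simple_root (W k') (l k') h)"
    by (simp add: k' simple_root_reflexion_self)
  have pos1: "positive_at v (simple_root (W k) (l k'))"
  proof -
    have "negative_at v (simple_root (W k') (l k'))" using k(2)[of k'] k' by simp
    then show ?thesis unfolding last negative_at_iff .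
  qed
  have pos2: "positive_at v (simple_root (W k) (l k))"
    using sign[OF S(1) skeleton_of.base] k(1) by blast
  have l: "l k' = x \<and> l k = y \<or> l k' = y \<and> l k = x"
    by (simp add: k' alternating_def)
  have "positive_at v (simple_root (W k) x)" "positive_at v (simple_root (W k) y)"
    using pos1 pos2 l by auto
  from related_opposite[OF u xy _ neg_x neg_y this] wk
  have opp: "simple_root (W k) x = (\<lambda>h. - simple_root u x h) \<and> simple_root (W k) y = (\<lambda>h. - simple_root u y h) \<or>
    simple_root (W k) x = (\<lambda>h. - simple_root u y h) \<and> simple_root (W k) y = (\<lambda>h. - simple_root u x h)"
    by blast
  have ne: "simple_root u x \<noteq> simple_root u y"
  proof
    assume "simple_root u x = simple_root u y"
    then have "root_comb u (\<lambda>z. if z = x then 1 else 0) = root_comb u (\<lambda>z. if z = y then 1 else 0)"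
      by (simp add: simple_root_as_comb[symmetric] del: root_comb_single)
    from fun_cong[OF root_comb_inject[OF S_root_datum[OF u] this], of x] show False using xy by simp
  qed
  have gone: "simple_root u z \<notin> inversions (W k)" if "z \<in> {x, y}" for z
  proof -
    have "negative_at (W k) (simple_root u z)"
      using opp that positive_at_simple_root[of "W k" x] positive_at_simple_root[of "W k" y]
      by (auto simp: negative_at_iff)
    then show ?thesis
      using not_positive_and_negative[OF simple_root_in_roots[OF u] S(1)] by (auto simp: inversions_def)
  qed
  \<comment> \<open>The simple roots of \<open>x\<close> and \<open>y\<close> at \<open>u\<close>
    are two inversions, both gone at the end. One step removes only one, so there were at least two
    steps.\<close>
  have "k' > 0"
  proof -
    have in_u: "simple_root u x \<in> inversions u" "simple_root u y \<in> inversions u"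
      using reflexion_descent(3)[OF u] neg_x neg_y by auto
    then have "inversions (W k) \<subseteq> inversions u - {simple_root u x, simple_root u y}"
      using wk gone by blast
    then have "card (inversions (W k)) \<le> card (inversions u - {simple_root u x, simple_root u y})"
      using finite_inversions[OF u] by (intro card_mono) auto
    also have "\<dots> = card (inversions u) - 2"
      using in_u ne by (subst card_Diff_subset) auto
    finally have "card (inversions u) \<ge> 2 \<Longrightarrow> k \<ge> 2" using wk by linarith
    moreover have "card {simple_root u x, simple_root u y} \<le> card (inversions u)"
      using in_u finite_inversions[OF u] by (intro card_mono) auto
    ultimately show ?thesis using ne k' by simp
  qed
  \<comment> \<open>The root reflected last is still an inversion before its step, whereas that of
    \<open>x\<close> at \<open>u\<close> was removed in the first one. So the last root is that of
    \<open>y\<close>, which fixes the labels in \<open>opp\<close>.\<close>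
  have "simple_root (W k') (l k') \<in> inversions (W k')"
    using reflexion_descent(3)[OF S(2)] k(2)[of k'] k' by simp
  then have "simple_root (W k') (l k') \<noteq> simple_root u x" using wk'(3) \<open>k' > 0\<close> by metis
  then have "simple_root (W k) (l k') \<noteq> (\<lambda>h. - simple_root u x h)"
    unfolding last by (auto simp: fun_eq_iff)
  then have end_roots: "simple_root (W k) (l k') = (\<lambda>h. - simple_root u y h)"
    "simple_root (W k) (l k) = (\<lambda>h. - simple_root u x h)"
    using opp l by auto
  \<comment> \<open>The last letter has index \<open>k - 1\<close>, which in terms of
    \<open>k\<close> exchanges \<open>x\<close> and \<open>y\<close>.\<close>
  have letter: "l k' = alternating y x k" by (simp add: k')
  have "k > 0" by (simp add: k')
  with wk show thesis
    by (intro that[OF _ _ _ _ end_roots(1)[unfolded letter] end_roots(2)]) simp_all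
qed

end

section \<open>Closing the rank two diagrams, and uniqueness of the bottom\<close>

context root_skeleton
begin

text \<open>Inside \<open>I\<close> the coroots are functions of the roots through \<open>d\<close>.
  Outside, they agree up to a factor, and comparing the coefficients at \<open>z\<close>, both equal
  to 1, makes the factor 1.\<close>

lemma related_same_roots:
  assumes u: "u \<in> S" and d: "\<And>i. d i \<noteq> 0" and rel: "related d u I w" "related d u I w'"
    and eq: "\<And>z. simple_root w z = simple_root w' z"
  shows "w = w'"
proof (rule root_datum.equality)
  have S: "w \<in> S" "w' \<in> S" using rel by (simp_all add: related_def)
  show "simple_root w = simple_root w'" using eq by auto
  show "parity w = parity w'" using parity_match[OF S eq] by auto
  note inj = root_comb_inject[OF S_root_datum[OF u]]
  show "simple_coroot w = simple_coroot w'"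
  proof
    fix z
    show "simple_coroot w z = simple_coroot w' z"
    proof (cases "z \<in> I")
      case True
      obtain m where m: "simple_root w z = root_comb u m"
        "simple_coroot w z = scale (d z) (coroot_comb scale u (\<lambda>i. m i / d i))"
        by (rule related_inner[OF rel(1) True]) blast
      moreover obtain m' where "simple_root w' z = root_comb u m'"
        "simple_coroot w' z = scale (d z) (coroot_comb scale u (\<lambda>i. m' i / d i))"
        by (rule related_inner[OF rel(2) True]) blast
      moreover from calculation have "m = m'" using eq inj by metis
      ultimately show ?thesis by simp
    next
      case False
      let ?\<delta> = "\<lambda>i. if i = z then 1 else 0 :: complex"
      obtain m where m: "m z = 0" "simple_coroot w z = coroot_comb scale u (\<lambda>i. ?\<delta> i + m i)"
        using related_outer[OF rel(1) False] False by metis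
      obtain m' where m': "m' z = 0" "simple_coroot w' z = coroot_comb scale u (\<lambda>i. ?\<delta> i + m' i)"
        using related_outer[OF rel(2) False] False by metis
      obtain c where c: "simple_coroot w z = scale c (simple_coroot w' z)"
        using coroot_match[OF S eq] by blast
      then have "coroot_comb scale u (\<lambda>i. ?\<delta> i + m i) = coroot_comb scale u (\<lambda>i. c * (?\<delta> i + m' i))"
        by (simp only: m m' coroot_comb_scale)
      from coroot_comb_inject[OF S_root_datum[OF u] this, of z] have "c = 1" using m(1) m'(1) by simp
      then show ?thesis using c by simp
    qed
  qed
qed simp

lemma braid:
  assumes u: "u \<in> S" and xy: "x \<noteq> y"
    and neg: "negative_at v (simple_root u x)" "negative_at v (simple_root u y)"
  shows "\<exists>w. descent\<^sup>*\<^sup>* (reflexion scale x u) w \<and> descent\<^sup>*\<^sup>* (reflexion scale y u) w"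
proof -
  have zero: "cartan u x y = 0 \<longleftrightarrow> cartan u y x = 0"
    using cartan_zero_sym[OF u] xy descent_reflectable[OF u] neg by metis
  \<comment> \<open>A rank two Cartan matrix whose off-diagonal entries vanish together is
    symmetrized by these entries, or by 1 if they are zero.\<close>
  define d where "d z = (if cartan u x y = 0 then 1 else if z = x then cartan u x y
    else if z = y then cartan u y x else 1)" for z
  have d: "d z \<noteq> 0" for z using zero by (auto simp: d_def)
  have d_sym: "d y * cartan u x y = d x * cartan u y x" using zero xy by (auto simp: d_def)
  interpret A: rank_two scale v u x y d
    using u xy neg d d_sym by unfold_locales auto
  interpret B: rank_two scale v u y x d
    using u xy neg d d_sym by unfold_locales auto
  obtain k w where w: "k > 0" "related d u {x, y} w" "card (inversions w) + k = card (inversions u)"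
    "descent\<^sup>*\<^sup>* (reflexion scale x u) w"
    "simple_root w (alternating y x k) = (\<lambda>h. - simple_root u y h)"
    "simple_root w (alternating x y k) = (\<lambda>h. - simple_root u x h)"
    by (rule A.bottom)
  obtain k' w' where w': "k' > 0" "related d u {y, x} w'" "card (inversions w') + k' = card (inversions u)"
    "descent\<^sup>*\<^sup>* (reflexion scale y u) w'"
    "simple_root w' (alternating x y k') = (\<lambda>h. - simple_root u x h)"
    "simple_root w' (alternating y x k') = (\<lambda>h. - simple_root u y h)"
    by (rule B.bottom)
  have rel': "related d u {x, y} w'" using w'(2) by (simp add: insert_commute)
  have S: "w \<in> S" "w' \<in> S" using w(2) rel' by (simp_all add: related_def)
  have outer: "simple_root w z = simple_root w' z" if z: "z \<notin> {x, y}" for z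
  proof -
    obtain m where m: "\<And>i. i \<notin> {x, y} \<Longrightarrow> m i = 0"
      "simple_root w z = root_comb u (\<lambda>i. (if i = z then 1 else 0) + m i)"
      using related_outer[OF w(2) z] by metis
    obtain m' where m': "\<And>i. i \<notin> {x, y} \<Longrightarrow> m' i = 0"
      "simple_root w' z = root_comb u (\<lambda>i. (if i = z then 1 else 0) + m' i)"
      using related_outer[OF rel' z] by metis
    have ne: "alternating x y i \<noteq> alternating y x i" "z \<noteq> alternating x y i" "z \<noteq> alternating y x i" for i
      using xy z by (auto simp: alternating_def)
    \<comment> \<open>The two bottoms are symmetric here, so exchanging them gives the reverse
      inequalities.\<close>
    have "m x - m' x \<in> \<nat>" "m y - m' y \<in> \<nat>" "m' x - m x \<in> \<nat>" "m' y - m y \<in> \<nat>"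
      using opposite_outer_root[OF u S ne w(6,5) xy _ m(2) m'(2)] m(1) m'(1)
        opposite_outer_root[OF u S(2,1) ne w'(5,6) xy _ m'(2) m(2)] by simp_all
    then have "m x = m' x" "m y = m' y"
      using Nats_minus_Nats[of "m x - m' x"] Nats_minus_Nats[of "m y - m' y"] by auto
    then have "m i = m' i" for i using m(1) m'(1) by (cases "i \<in> {x, y}") auto
    then show ?thesis using m(2) m'(2) by simp
  qed
  \<comment> \<open>Up to labels, both bottoms have the same simple roots; that already makes their
    inversions, and hence the lengths \<open>k\<close> and \<open>k'\<close>, equal.\<close>
  have pos: "positive_at w' (simple_root w z)" "positive_at w (simple_root w' z)" for z
  proof -
    have "simple_root w z \<in> range (simple_root w')" "simple_root w' z \<in> range (simple_root w)" if "z \<in> {x, y}"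
      using that w(5,6) w'(5,6) alternating_cases[of x y k] alternating_cases[of x y k'] by (metis insertE rangeI singletonD)+
    then show "positive_at w' (simple_root w z)" "positive_at w (simple_root w' z)"
      using outer[of z] positive_at_simple_root by (metis rangeE)+
  qed
  have "inversions w = inversions w'"
    using positive_at_trans[OF pos(1)] positive_at_trans[OF pos(2)] unfolding inversions_def by blast
  then have "k = k'" using w(3) w'(3) by simp
  \<comment> \<open>Equal lengths have equal parity, so the opposite roots of \<open>x\<close> and
    \<open>y\<close> carry the same labels at both ends.\<close>
  then have "simple_root w z = simple_root w' z" if "z \<in> {x, y}" for z
    using that w(5,6) w'(5,6) alternating_cases[of x y k] by auto
  then have "w = w'" using outer by (intro related_same_roots[OF u d w(2) rel']) blast
  then show ?thesis using w(4) w'(4) by blast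
qed

text \<open>The two first steps are rejoined at \<open>w\<close> by \<open>braid\<close>. A bottom
  \<open>s\<close> below \<open>w\<close> lies below \<open>u1\<close> and \<open>u2\<close>, which
  have fewer inversions, so induction identifies \<open>t\<close> and \<open>t'\<close> with
  \<open>s\<close>.\<close>

lemma bottom_unique:
  assumes "u \<in> S" "descent\<^sup>*\<^sup>* u t" "inversions t = {}" "descent\<^sup>*\<^sup>* u t'" "inversions t' = {}"
  shows "t = t'"
  using assms
proof (induction "card (inversions u)" arbitrary: u t t' rule: less_induct)
  case less
  show ?case
  proof (cases "inversions u = {}")
    case True
    then show ?thesis
      using less.prems(2,4) no_inversions_descent by (metis converse_rtranclpE)
  next
    case False
    obtain u1 where u1: "descent u u1" "descent\<^sup>*\<^sup>* u1 t"
      using less.prems(2,3) False by (metis converse_rtranclpE)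
    obtain u2 where u2: "descent u u2" "descent\<^sup>*\<^sup>* u2 t'"
      using less.prems(4,5) False by (metis converse_rtranclpE)
    obtain x y where x: "negative_at v (simple_root u x)" "u1 = reflexion scale x u"
      and y: "negative_at v (simple_root u y)" "u2 = reflexion scale y u"
      using u1(1) u2(1) by (auto simp: descent_def)
    obtain w where w: "descent\<^sup>*\<^sup>* u1 w" "descent\<^sup>*\<^sup>* u2 w"
    proof (cases "x = y")
      case True
      then show ?thesis using that[of u1] x y by simp
    next
      case False
      then show ?thesis using that braid[OF less.prems(1) False x(1) y(1)] x y by blast
    qed
    have S: "u1 \<in> S" "u2 \<in> S" and card: "card (inversions u1) < card (inversions u)" "card (inversions u2) < card (inversions u)"
      using descent_card u1(1) u2(1) by auto
    obtain s where s: "descent\<^sup>*\<^sup>* w s" "inversions s = {}"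
      using exists_bottom descents_S[OF w(1) S(1)] by blast
    have "t = s" by (rule less.hyps[OF card(1) S(1) u1(2) less.prems(3) rtranclp_trans[OF w(1) s(1)] s(2)])
    moreover have "t' = s" by (rule less.hyps[OF card(2) S(2) u2(2) less.prems(5) rtranclp_trans[OF w(2) s(1)] s(2)])
    ultimately show ?thesis by simp
  qed
qed

text \<open>A path from \<open>v\<close> need not be monotone in the number of inversions. A step
  that is a descent is prepended to the given descents; a step that is an ascent becomes a descent
  when reversed, and \<open>bottom_unique\<close> carries the bottom of \<open>u\<close>
  over.\<close>

lemma bottom_eq_base: "u \<in> S \<Longrightarrow> descent\<^sup>*\<^sup>* u t \<Longrightarrow> inversions t = {} \<Longrightarrow> t = v"
proof (induction arbitrary: t rule: skeleton_of.induct)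
  case base
  then show ?case using no_inversions_descent[OF inversions_base] by (metis converse_rtranclpE)
next
  case (step u x)
  note u = step.hyps
  show ?case
    using v_sign_cases[OF u(1), of x]
  proof cases
    case 1
    then show ?thesis
      using step.IH descentI[OF u(1)] step.prems by (meson converse_rtranclp_into_rtranclp)
  next
    case 2
    let ?u = "reflexion scale x u"
    have S: "?u \<in> S" by (rule skeleton_of.step[OF u])
    have "descent ?u u"
      using descentI[OF S inversions_ascent(1)[OF u 2(1)]] reflexion_reflexion[OF S_root_datum[OF u(1)]] by simp
    moreover obtain s where s: "descent\<^sup>*\<^sup>* u s" "inversions s = {}" using exists_bottom[OF u(1)] by blast
    ultimately have "descent\<^sup>*\<^sup>* ?u s" by (meson converse_rtranclp_into_rtranclp)
    then have "t = s" using bottom_unique[OF S step.prems] s(2) by blast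
    then show ?thesis using step.IH[OF s] by simp
  qed
qed

lemma no_inversions_eq_base: "u \<in> S \<Longrightarrow> inversions u = {} \<Longrightarrow> u = v"
  using bottom_eq_base[of u u] by blast

lemma same_positive_roots_eq_base:
  assumes "u \<in> skeleton scale v" "positive_real_roots scale v u = positive_real_roots scale v v"
  shows "u = v"
proof -
  have S: "skeleton scale v = S" by (rule skeleton_eq[OF base])
  have "positive_real_roots scale v w = {\<beta> \<in> roots. positive_at w \<beta>}" for w
    by (auto simp: positive_real_roots_def real_roots_def S roots_def positive_at_def root_comb_def)
  then have "{\<beta> \<in> roots. positive_at u \<beta>} = {\<beta> \<in> roots. positive_at v \<beta>}" using assms(2) by simp
  then have "inversions u = {}"
    using not_positive_and_negative[OF _ skeleton_of.base] unfolding inversions_def by blast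
  then show ?thesis using no_inversions_eq_base assms(1) S by simp
qed

end

section \<open>The theorem\<close>

lemma composites_trans:
  assumes "(u, \<psi>, w) \<in> composites scale G" "(v, \<phi>, u) \<in> composites scale G"
  shows "(v, \<psi> \<circ> \<phi>, w) \<in> composites scale G"
proof -
  have "(v, fst (snd a) \<circ> \<phi>, snd (snd a)) \<in> composites scale G"
    if "a \<in> composites scale G" "(v, \<phi>, fst a) \<in> composites scale G" for a
    using that
  proof (induction rule: composites.induct)
    case (identity w)
    then show ?case by (simp add: identity_arrow_def)
  next
    case (compose u' \<chi> w' \<psi>' w'')
    then have "(v, \<chi> \<circ> \<phi>, w') \<in> composites scale G" by (simp add: o_def)
    from composites.compose[OF this compose.hyps(2)] show ?case by (simp add: o_def)
  qed
  from this[OF assms(1)] show ?thesis using assms(2) by simp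
qed

lemma composites_source: "(v, \<phi>, u) \<in> composites scale G \<Longrightarrow> is_root_datum scale v"
  by (induction "(v, \<phi>, u)" arbitrary: \<phi> u rule: composites.induct) (auto simp: identity_arrow_def)

lemma (in complex_vector_space) skeleton_of_arrow:
  assumes "u \<in> skeleton_of scale v" "is_root_datum scale v"
  shows "(v, id, u) \<in> groupoid_arrows scale"
  using assms(1)
proof (induction rule: skeleton_of.induct)
  case base
  show ?case using composites.identity[OF assms(2)] unfolding identity_arrow_def groupoid_arrows_def .
next
  case (step u x)
  have "(u, id, reflexion scale x u) \<in> reflexion_arrows scale"
    using skeleton_of_root_datum[OF step.hyps(1) assms(2)] step.hyps(2)
    by (auto simp: reflexion_arrows_def reflexion_arrow_def)
  then show ?case
    using composites.compose[OF step.IH[unfolded groupoid_arrows_def], of id] unfolding groupoid_arrows_def by simp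
qed

theorem corollary5p3p7:
  fixes scale :: "complex \<Rightarrow> 'h::ab_group_add \<Rightarrow> 'h"
    and Basis :: "'h set"
    and R :: "('x::finite, 'h) root_datum set"
    and v :: "('x, 'h) root_datum"
  assumes "finite_dimensional_vector_space scale Basis"
    and "is_component scale R"
    and "indecomposable R"
    and "admissible scale R"
    and "v \<in> R"
  shows "(\<forall>v'\<in>skeleton scale v.
            positive_real_roots scale v v' = positive_real_roots scale v v \<longrightarrow> v' = v) \<and>
         (\<forall>\<mu>. (\<forall>x. \<mu> x \<noteq> 0) \<and>
            homothety_arrow scale \<mu> v \<in> composites scale (reflexion_arrows scale) \<longrightarrow>
            homothety_arrow scale \<mu> v = identity_arrow v)"
proof -
  interpret complex_vector_space scale
    using assms(1) by (simp add: complex_vector_space_def finite_dimensional_vector_space_def)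
  have main: "v' = v"
    if v': "v' \<in> skeleton scale v" "positive_real_roots scale v v' = positive_real_roots scale v v" for v'
  proof -
    have base: "is_root_datum scale v" using v'(1) composites_source by (auto simp: skeleton_def)
    obtain v0 where v0: "R = {u. \<exists>\<phi>. (v0, \<phi>, u) \<in> groupoid_arrows scale}"
      using assms(2) by (auto simp: is_component_def)
    have in_R: "u \<in> R" if "u \<in> skeleton_of scale v" for u
      using composites_trans skeleton_of_arrow[OF that base] assms(5) unfolding v0 groupoid_arrows_def by blast
    have arrow: "is_root_datum scale u" "is_root_datum scale w" "(u, id, w) \<in> groupoid_arrows scale"
      if "u \<in> skeleton_of scale v" "w \<in> skeleton_of scale v" for u w
    proof -
      show u: "is_root_datum scale u" "is_root_datum scale w"
        using skeleton_of_root_datum[OF _ base] that by auto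
      have "w \<in> skeleton_of scale u"
        using skeleton_of_trans[OF that(2) skeleton_of_sym[OF that(1) base]] .
      then show "(u, id, w) \<in> groupoid_arrows scale" using skeleton_of_arrow u(1) by blast
    qed
    \<comment> \<open>The component contains the skeleton, and any two members of the skeleton are
      joined by an arrow inducing the identity; admissibility is applied to these arrows.\<close>
    note adm = admissible_arrow[OF vector_space_axioms assms(4) in_R in_R arrow(3) arrow(1) arrow(2)]
    interpret root_skeleton scale v
      using base adm by unfold_locales
    show ?thesis by (rule same_positive_roots_eq_base[OF v'])
  qed
  moreover have "homothety_arrow scale \<mu> v = identity_arrow v"
    if "homothety_arrow scale \<mu> v \<in> composites scale (reflexion_arrows scale)" for \<mu>
  proof -
    have "rescale scale \<mu> v \<in> skeleton scale v"
      using that by (auto simp: homothety_arrow_def skeleton_def)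
    \<comment> \<open>A homothety changes coroots only, so the cone of positive roots stays the
      same.\<close>
    moreover have "positive_real_roots scale v (rescale scale \<mu> v) = positive_real_roots scale v v"
      by (simp add: positive_real_roots_def rescale_def)
    ultimately have "rescale scale \<mu> v = v" by (rule main)
    then show ?thesis by (simp add: homothety_arrow_def identity_arrow_def)
  qed
  ultimately show ?thesis by blast
qed

end
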